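(* Let $N\ge 2$ be an integer, $0<c_0<2\pi$, $s\ge 1$ an integer and $\beta>0$. There exist constants $C>0$ and $\varepsilon_0>0$, depending only on $N$, $c_0$, $s$ and $\beta$, such that the following holds. Let $K\ge 1$ be an integer and $h>0$ with $$(N+1)\,h\,K^2\le c_0<2\pi ,$$ let $a_1,\dots,a_s,b_1,\dots,b_s$ be real numbers with $a_1+\dots+a_s=1$, $b_1+\dots+b_s=1$ and $|b_r|\le\beta$ for $r=1,\dots,s$, let $0<\varepsilon\le\varepsilon_0$, and let $\psi^0(x)=\sum_{j\in\mathcal K}\psi^0_j e^{ijx}$ satisfy $\|\psi^0\|_1\le\varepsilon$. Then the numerical solution $\psi^n$, $n=0,1,2,\dots$, of the splitting integrator $$\psi^{n+1}=\phi_A^{a_1h}\circ\phi_B^{b_1h}\circ\phi_A^{a_2h}\circ\phi_B^{b_2h}\circ\dots\circ\phi_A^{a_sh}\circ\phi_B^{b_sh}(\psi^n)$$ satisfies $$\varepsilon^{-2}\,\bigl|\,\|\psi^n\|_1^2-\|\psi^0\|_1^2\,\bigr|\le C\varepsilon\qquad\text{for } 0\le t_n=nh\le\varepsilon^{-N+1}.$$ In particular $C$ and $\varepsilon_0$ are independent of $\varepsilon$, $h$ and $K$.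
   Context: The integrator discretizes the cubic nonlinear Schrödinger equation $i\partial_t\psi=-\partial_x^2\psi+|\psi|^2\psi$ with $2\pi$-periodic boundary conditions in one space dimension. For an integer $K\ge1$ let $\mathcal K=\{-K,-K+1,\dots,K-1\}$. $\mathcal Q^K$ denotes trigonometric interpolation: for a continuous $2\pi$-periodic function $u$, $\mathcal Q^K(u)$ is the unique function of the form $\sum_{j\in\mathcal K}c_je^{ijx}$ that coincides with $u$ at the points $x_l=\pi l/K$, $l\in\mathcal K$. For $\alpha\in\mathbb R$ and $\eta(x)=\sum_{j\in\mathcal K}\eta_je^{ijx}$, $$\phi_A^\alpha(\eta)=\sum_{j\in\mathcal K}e^{-ij^2\alpha}\eta_je^{ijx},\qquad \phi_B^\alpha(\eta)=\mathcal Q^K\bigl(e^{-i\alpha|\eta|^2}\eta\bigr).$$ The norm is the Sobolev $H^1$-norm $\|\eta\|_1^2=\frac1{2\pi}\int_0^{2\pi}(|\eta|^2+|\partial_x\eta|^2)\,dx=\sum_j(j^2+1)|\eta_j|^2$. *)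

theory Defs
  imports "HOL-Analysis.Analysis"
begin

definition modes :: "nat \<Rightarrow> int set" where
  "modes K = {- int K .. int K - 1}"

definition trig_poly :: "nat \<Rightarrow> (int \<Rightarrow> complex) \<Rightarrow> real \<Rightarrow> complex" where
  "trig_poly K c = (\<lambda>x. \<Sum>j\<in>modes K. c j * cis (real_of_int j * x))"

definition trig_space :: "nat \<Rightarrow> (real \<Rightarrow> complex) set" where
  "trig_space K = range (trig_poly K)"

definition grid_pt :: "nat \<Rightarrow> int \<Rightarrow> real" where
  "grid_pt K l = pi * real_of_int l / real K"

text \<open>The description operator is justified by \<open>trig_interp_ex1\<close> below.\<close>

definition trig_interp :: "nat \<Rightarrow> (real \<Rightarrow> complex) \<Rightarrow> (real \<Rightarrow> complex)" where
  "trig_interp K u =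
     (THE v. v \<in> trig_space K \<and> (\<forall>l\<in>modes K. v (grid_pt K l) = u (grid_pt K l)))"

definition fourier_coeff :: "(real \<Rightarrow> complex) \<Rightarrow> int \<Rightarrow> complex" where
  "fourier_coeff \<eta> j =
     complex_of_real (1 / (2 * pi)) * integral {0..2 * pi} (\<lambda>x. \<eta> x * cis (- (real_of_int j * x)))"

definition phiA :: "nat \<Rightarrow> real \<Rightarrow> (real \<Rightarrow> complex) \<Rightarrow> (real \<Rightarrow> complex)" where
  "phiA K \<alpha> \<eta> = trig_poly K (\<lambda>j. cis (- ((real_of_int j)\<^sup>2 * \<alpha>)) * fourier_coeff \<eta> j)"

definition phiB :: "nat \<Rightarrow> real \<Rightarrow> (real \<Rightarrow> complex) \<Rightarrow> (real \<Rightarrow> complex)" where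
  "phiB K \<alpha> \<eta> = trig_interp K (\<lambda>x. cis (- (\<alpha> * (cmod (\<eta> x))\<^sup>2)) * \<eta> x)"

definition H1_norm :: "(real \<Rightarrow> complex) \<Rightarrow> real" where
  "H1_norm \<eta> = sqrt (1 / (2 * pi) *
     integral {0..2 * pi} (\<lambda>x. (cmod (\<eta> x))\<^sup>2 + (cmod (vector_derivative \<eta> (at x)))\<^sup>2))"

text \<open>One time step of the splitting integrator; the factor with index \<open>1\<close> is outermost
  (applied last), the one with index \<open>s\<close> innermost (applied first).\<close>

definition splitting_step ::
  "nat \<Rightarrow> nat \<Rightarrow> (nat \<Rightarrow> real) \<Rightarrow> (nat \<Rightarrow> real) \<Rightarrow> real \<Rightarrow> (real \<Rightarrow> complex) \<Rightarrow> (real \<Rightarrow> complex)" where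
  "splitting_step K s a b h =
     foldr (\<lambda>r \<Phi>. phiA K (a r * h) \<circ> phiB K (b r * h) \<circ> \<Phi>) [1..<Suc s] id"

definition splitting_solution ::
  "nat \<Rightarrow> nat \<Rightarrow> (nat \<Rightarrow> real) \<Rightarrow> (nat \<Rightarrow> real) \<Rightarrow> real \<Rightarrow> (real \<Rightarrow> complex) \<Rightarrow> nat \<Rightarrow> (real \<Rightarrow> complex)" where
  "splitting_solution K s a b h \<psi>0 n = (splitting_step K s a b h ^^ n) \<psi>0"

lemma finite_modes [simp]: "finite (modes K)"
  by (simp add: modes_def)

lemma sum_cis_grid:
  assumes "K \<ge> 1" "\<bar>m\<bar> < 2 * int K"
  shows "(\<Sum>l\<in>modes K. cis (pi * real_of_int m * real_of_int l / real K)) = (if m = 0 then of_nat (2 * K) else 0)"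
proof (cases "m = 0")
  case True
  then show ?thesis by (simp add: modes_def nat_add_distrib flip: nat_diff_distrib)
next
  case False
  define z where "z = cis (pi * real_of_int m / real K)"
  have zpow: "z ^ (2 * K) = 1"
  proof -
    have "z ^ (2 * K) = cis (2 * pi * real_of_int m)"
      unfolding z_def Complex.DeMoivre using assms by (simp add: field_simps)
    also have "\<dots> = 1"
      by (rule cis_multiple_2pi) auto
    finally show ?thesis .
  qed
  have z1: "z \<noteq> 1"
  proof
    assume "z = 1"
    hence "cos (pi * real_of_int m / real K) = 1"
      by (simp add: z_def complex_eq_iff)
    then obtain k :: int where "pi * real_of_int m / real K = k * 2 * pi"
      by (auto simp: cos_one_2pi_int)
    hence "real_of_int m = real_of_int (2 * k * int K)"
      using assms by (simp add: field_simps)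
    hence mk: "m = 2 * k * int K" by (simp only: of_int_eq_iff)
    with False have "k \<noteq> 0" by auto
    hence "int K * 2 * 1 \<le> int K * 2 * \<bar>k\<bar>" by (intro mult_left_mono) auto
    with mk assms show False by (simp add: abs_mult mult_ac)
  qed
  have bij: "bij_betw (\<lambda>i. int i - int K) {..<2 * K} (modes K)"
    by (rule bij_betwI[of _ _ _ "\<lambda>l. nat (l + int K)"]) (auto simp: modes_def)
  have "(\<Sum>l\<in>modes K. cis (pi * real_of_int m * real_of_int l / real K))
      = (\<Sum>i<2 * K. cis (pi * real_of_int m * real_of_int (int i - int K) / real K))"
    by (rule sum.reindex_bij_betw[OF bij, symmetric])
  also have "\<dots> = (\<Sum>i<2 * K. cis (- (pi * real_of_int m)) * z ^ i)"
    using assms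
    by (intro sum.cong) (auto simp: z_def Complex.DeMoivre cis_mult field_simps)
  also have "\<dots> = 0"
    using z1 zpow by (simp add: sum_gp_strict flip: sum_distrib_left)
  finally show ?thesis using False by simp
qed

theorem trig_interp_ex1:
  assumes K: "K \<ge> 1"
  shows "\<exists>!v. v \<in> trig_space K \<and> (\<forall>l\<in>modes K. v (grid_pt K l) = u (grid_pt K l))"
proof -
  define d where "d = (\<lambda>(w::real \<Rightarrow> complex) j. (\<Sum>l\<in>modes K. w (grid_pt K l) * cis (- (real_of_int j * grid_pt K l))) / of_nat (2 * K))"
  have small: "\<bar>i - j\<bar> < 2 * int K" if "i \<in> modes K" "j \<in> modes K" for i j
    using that by (auto simp: modes_def)
  have ex: "trig_poly K (d w) (grid_pt K l) = w (grid_pt K l)" if l: "l \<in> modes K" for w l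
  proof -
    have "trig_poly K (d w) (grid_pt K l) = (\<Sum>j\<in>modes K. \<Sum>m\<in>modes K.
       w (grid_pt K m) / of_nat (2 * K) * cis (pi * real_of_int (l - m) * real_of_int j / real K))"
      unfolding trig_poly_def d_def sum_divide_distrib sum_distrib_right
      by (intro sum.cong refl) (simp add: grid_pt_def cis_mult field_simps diff_divide_distrib)
    also have "\<dots> = (\<Sum>m\<in>modes K. \<Sum>j\<in>modes K.
       w (grid_pt K m) / of_nat (2 * K) * cis (pi * real_of_int (l - m) * real_of_int j / real K))"
      by (rule sum.swap)
    also have "\<dots> = (\<Sum>m\<in>modes K. if l = m then w (grid_pt K m) else 0)"
    proof (intro sum.cong refl, goal_cases)
      case (1 m)
      then show ?case
        unfolding sum_distrib_left[symmetric] using K l small[OF l 1]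
        by (subst sum_cis_grid) auto
    qed
    finally show ?thesis using l by simp
  qed
  have un: "d (trig_poly K c) j = c j" if j: "j \<in> modes K" for c j
  proof -
    have "d (trig_poly K c) j = (\<Sum>l\<in>modes K. \<Sum>m\<in>modes K.
       c m / of_nat (2 * K) * cis (pi * real_of_int (m - j) * real_of_int l / real K))"
      unfolding trig_poly_def d_def sum_divide_distrib sum_distrib_right
      by (intro sum.cong refl) (simp add: grid_pt_def cis_mult field_simps diff_divide_distrib)
    also have "\<dots> = (\<Sum>m\<in>modes K. \<Sum>l\<in>modes K.
       c m / of_nat (2 * K) * cis (pi * real_of_int (m - j) * real_of_int l / real K))"
      by (rule sum.swap)
    also have "\<dots> = (\<Sum>m\<in>modes K. if m = j then c m else 0)"
    proof (intro sum.cong refl, goal_cases)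
      case (1 m)
      then show ?case
        unfolding sum_distrib_left[symmetric] using K j small[OF 1 j]
        by (subst sum_cis_grid) auto
    qed
    finally show ?thesis using j by simp
  qed
  show ?thesis
  proof (rule ex1I[of _ "trig_poly K (d u)"])
    show "trig_poly K (d u) \<in> trig_space K \<and> (\<forall>l\<in>modes K. trig_poly K (d u) (grid_pt K l) = u (grid_pt K l))"
      using ex by (auto simp: trig_space_def)
  next
    fix v assume v: "v \<in> trig_space K \<and> (\<forall>l\<in>modes K. v (grid_pt K l) = u (grid_pt K l))"
    then obtain c where c: "v = trig_poly K c" by (auto simp: trig_space_def)
    have "d v = d u" using v by (auto simp: d_def fun_eq_iff intro!: sum.cong)
    hence "c j = d u j" if "j \<in> modes K" for j using un[OF that, of c] c by simp
    thus "v = trig_poly K (d u)" unfolding c by (auto simp: trig_poly_def fun_eq_iff intro!: sum.cong)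
  qed
qed

lemma has_integral_cis_int:
  "((\<lambda>x. cis (real_of_int m * x)) has_integral (if m = 0 then of_real (2 * pi) else 0)) {0..2 * pi}"
proof (cases "m = 0")
  case True
  have "((\<lambda>x. 1::complex) has_integral (2 * pi - 0) *\<^sub>R 1) {0..2 * pi}"
    using has_integral_const_real[of "1::complex" 0 "2 * pi"] by simp
  then show ?thesis using True by (simp add: scaleR_conv_of_real)
next
  case False
  define F where "F = (\<lambda>x. cis (real_of_int m * x) / (\<i> * of_int m))"
  have "((\<lambda>x. cis (real_of_int m * x)) has_integral (F (2 * pi) - F 0)) {0..2 * pi}"
  proof (rule fundamental_theorem_of_calculus)
    fix x :: real
    have "((\<lambda>x. exp (\<i> * (of_int m * of_real x)) / (\<i> * of_int m)) has_vector_derivative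
       exp (\<i> * (of_int m * of_real x))) (at x within {0..2 * pi})"
      by (rule has_vector_derivative_real_field[of "\<lambda>z. exp (\<i> * (of_int m * z)) / (\<i> * of_int m)"])
         (use False in \<open>auto intro!: derivative_eq_intros simp: complex_eq_iff\<close>)
    thus "(F has_vector_derivative cis (real_of_int m * x)) (at x within {0..2 * pi})"
      by (simp add: F_def cis_conv_exp)
  qed simp
  moreover have "F (2 * pi) = F 0"
    using cis_multiple_2pi[of "real_of_int m"] by (simp add: F_def mult_ac)
  ultimately show ?thesis using False by simp
qed

theorem fourier_coeff_trig_poly:
  assumes "j \<in> modes K"
  shows "fourier_coeff (trig_poly K c) j = c j"
proof -
  have "((\<lambda>x. \<Sum>i\<in>modes K. c i * cis (real_of_int (i - j) * x)) has_integral
         (\<Sum>i\<in>modes K. c i * (if i - j = 0 then of_real (2 * pi) else 0))) {0..2 * pi}"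
    by (intro has_integral_sum has_integral_mult_right has_integral_cis_int) auto
  moreover have "(\<lambda>x. \<Sum>i\<in>modes K. c i * cis (real_of_int (i - j) * x))
      = (\<lambda>x. trig_poly K c x * cis (- (real_of_int j * x)))"
    by (simp add: trig_poly_def sum_distrib_right mult.assoc cis_mult left_diff_distrib)
  moreover have "(\<Sum>i\<in>modes K. c i * (if i - j = 0 then of_real (2 * pi) else 0)) = c j * of_real (2 * pi)"
    using assms by (simp add: if_distrib cong: if_cong)
  ultimately show ?thesis
    by (simp add: fourier_coeff_def integral_unique)
qed

lemma integral_norm_square_trig_poly:
  "((\<lambda>x. (cmod (trig_poly K c x))\<^sup>2) has_integral 2 * pi * (\<Sum>j\<in>modes K. (cmod (c j))\<^sup>2)) {0..2 * pi}"
proof -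
  have "((\<lambda>x. \<Sum>i\<in>modes K. \<Sum>j\<in>modes K. c i * cnj (c j) * cis (real_of_int (i - j) * x)) has_integral
         (\<Sum>i\<in>modes K. \<Sum>j\<in>modes K. c i * cnj (c j) * (if i - j = 0 then of_real (2 * pi) else 0))) {0..2 * pi}"
    by (intro has_integral_sum has_integral_mult_right has_integral_cis_int) auto
  moreover have "(\<lambda>x. \<Sum>i\<in>modes K. \<Sum>j\<in>modes K. c i * cnj (c j) * cis (real_of_int (i - j) * x))
      = (\<lambda>x. of_real ((cmod (trig_poly K c x))\<^sup>2))"
    unfolding trig_poly_def complex_norm_square cnj_sum sum_product
    by (intro ext sum.cong refl)
       (simp add: cis_cnj cis_mult right_diff_distrib mult_ac)
  moreover have "(\<Sum>i\<in>modes K. \<Sum>j\<in>modes K. c i * cnj (c j) * (if i - j = 0 then of_real (2 * pi) else 0))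
      = of_real (2 * pi * (\<Sum>j\<in>modes K. (cmod (c j))\<^sup>2))"
    by (simp add: if_distrib sum_distrib_left complex_norm_square[unfolded of_real_power] mult_ac cong: if_cong)
  ultimately have "((\<lambda>x. complex_of_real ((cmod (trig_poly K c x))\<^sup>2)) has_integral
      of_real (2 * pi * (\<Sum>j\<in>modes K. (cmod (c j))\<^sup>2))) {0..2 * pi}"
    by simp
  from has_integral_Re[OF this] show ?thesis by (simp only: Re_complex_of_real)
qed

theorem H1_norm_trig_poly:
  "(H1_norm (trig_poly K c))\<^sup>2 = (\<Sum>j\<in>modes K. ((real_of_int j)\<^sup>2 + 1) * (cmod (c j))\<^sup>2)"
proof -
  have d: "vector_derivative (trig_poly K c) (at x) = trig_poly K (\<lambda>j. \<i> * of_int j * c j) x" for x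
  proof (rule vector_derivative_at)
    have "((\<lambda>x. \<Sum>j\<in>modes K. c j * exp (\<i> * (of_int j * of_real x))) has_vector_derivative
       (\<Sum>j\<in>modes K. c j * (\<i> * of_int j * exp (\<i> * (of_int j * of_real x))))) (at x)"
      by (rule has_vector_derivative_real_field[of "\<lambda>z. \<Sum>j\<in>modes K. c j * exp (\<i> * (of_int j * z))"])
         (auto intro!: derivative_eq_intros sum.cong simp: mult_ac)
    thus "(trig_poly K c has_vector_derivative trig_poly K (\<lambda>j. \<i> * of_int j * c j) x) (at x)"
      by (simp add: trig_poly_def cis_conv_exp mult_ac)
  qed
  have "((\<lambda>x. (cmod (trig_poly K c x))\<^sup>2 + (cmod (vector_derivative (trig_poly K c) (at x)))\<^sup>2) has_integral
     2 * pi * (\<Sum>j\<in>modes K. (cmod (c j))\<^sup>2) + 2 * pi * (\<Sum>j\<in>modes K. (cmod (\<i> * of_int j * c j))\<^sup>2)) {0..2 * pi}"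
    unfolding d by (intro has_integral_add integral_norm_square_trig_poly)
  also have "2 * pi * (\<Sum>j\<in>modes K. (cmod (c j))\<^sup>2) + 2 * pi * (\<Sum>j\<in>modes K. (cmod (\<i> * of_int j * c j))\<^sup>2)
     = 2 * pi * (\<Sum>j\<in>modes K. ((real_of_int j)\<^sup>2 + 1) * (cmod (c j))\<^sup>2)"
    by (simp add: norm_mult power_mult_distrib ring_distribs sum.distrib)
  finally show ?thesis
    by (simp add: H1_norm_def integral_unique sum_nonneg)
qed

end

theory Submission
  imports Defs
begin

text \<open>
  Write \<open>\<psi>\<^sub>j\<close> for the Fourier coefficients of the numerical solution and \<open>T(\<psi>) = \<Sum>\<^sub>j (j\<^sup>2 + 1) |\<psi>\<^sub>j|\<^sup>2\<close>
  for its squared \<open>H\<^sup>1\<close>-norm. The linear substeps preserve \<open>T\<close>; only the nonlinear ones change it. The proof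
  constructs, by a normal form, a modified quantity \<open>E = T + O(\<epsilon>\<^sup>4)\<close> that changes by only \<open>O(h \<epsilon>\<^bsup>2N+2\<^esup>)\<close>
  in each time step. Over the times \<open>n h \<le> \<epsilon>\<^bsup>-N+1\<^esup>\<close> the drift of \<open>E\<close> is then \<open>O(\<epsilon>\<^bsup>N+3\<^esup>)\<close>, so \<open>T\<close>
  stays within \<open>O(\<epsilon>\<^sup>4)\<close> of its initial value.

  In the rotated coefficients \<open>u\<^sub>j = e\<^bsup>i j\<^sup>2 \<sigma>\<^esup> \<psi>\<^sub>j\<close>, where \<open>\<sigma>\<close> is the accumulated duration of the linear
  substeps, those substeps disappear, and the integrator becomes the flow of a quartic Hamiltonian \<open>G(t)\<close>
  that depends on time (one unit of \<open>t\<close> per substep, so \<open>s\<close> units per time step); see \<open>trajectory_ode\<close>.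
  The numbers \<open>a\<^sub>r\<close> enter only through phases of modulus one, so the estimates do not depend on them. A
  monomial in \<open>u\<close> and its conjugate has an integer frequency \<open>\<Omega>\<close>, with \<open>{monomial, T} = i \<Omega> \<sqdot> monomial\<close>, and its
  coefficient \<open>c\<close> in \<open>G\<close> satisfies \<open>c(t + s) = e\<^bsup>i h \<Omega>\<^esup> c(t)\<close>.

  The modified quantity is sought as a Lie series \<open>E = T + E\<^sub>1 + E\<^sub>2 + \<dots>\<close> of \<open>T\<close> along a generator
  \<open>W = W\<^sub>0 + W\<^sub>1 + \<dots>\<close>, where \<open>W\<^sub>n\<close> is homogeneous of degree \<open>2n + 4\<close>. The Jacobi identity shows that
  \<open>\<partial>\<^sub>t E\<^sub>n + {E\<^bsub>n-1\<^esub>, G} = 0\<close> holds for all orders as soon as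
  \<open>\<partial>\<^sub>t W\<^sub>n + {W\<^bsub>n-1\<^esub>, G}\<close> (with \<open>G\<close> itself in place of the bracket for \<open>n = 0\<close>) is the \<open>n\<close>-th order part of a Lie
  series of terms \<open>\<rho>\<^sub>m\<close> that commute with \<open>T\<close> (\<open>lie_series_deriv_invariant\<close>, \<open>lie_series_commuting\<close>). This
  is a recursion for \<open>W\<^sub>n\<close> and \<open>\<rho>\<^sub>n\<close>: a known right-hand side has to be integrated in time, monomial by monomial.
  If \<open>\<Omega> = 0\<close>, its mean is moved into \<open>\<rho>\<^sub>n\<close>. If \<open>\<Omega> \<noteq> 0\<close>, there is a bounded antiderivative with the same
  quasi-periodicity, at the price of the divisor \<open>e\<^bsup>i h \<Omega>\<^esup> - 1\<close>. Monomials of degree \<open>2k\<close> with as many modes as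
  conjugates have \<open>|\<Omega>| \<le> k K\<^sup>2\<close>, so that \<open>|h \<Omega>| \<le> c\<^sub>0 < 2\<pi>\<close> for \<open>k \<le> N + 1\<close>; hence the divisor is at least of size
  \<open>h |\<Omega>|\<close> (\<open>homological\<close>). The factor \<open>h\<close> compensates the size \<open>O(h)\<close> of the right-hand side, and the factor
  \<open>|\<Omega>|\<close> makes not only \<open>W\<^sub>n\<close> but also \<open>{T, W\<^sub>n}\<close> bounded, although \<open>T\<close> is not.

  All constants are uniform in \<open>K\<close> because a bound on the coefficients alone suffices. By conservation of
  momentum modulo \<open>2K\<close> a Poisson bracket contracts at most one pair of modes
  (\<open>balanced_bracket_coeff\<close>), and a homogeneous polynomial with bounded coefficients is controlled by the
  \<open>\<ell>\<^sup>1\<close>-norm of \<open>u\<close> (\<open>hom_bound\<close>), hence by the \<open>H\<^sup>1\<close>-norm (\<open>sum_idxs_bound\<close>). A continuity argument keeps the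
  solution in the ball where the estimates hold (\<open>invariant_along_integrator\<close>).
\<close>

section \<open>The Poisson algebra of polynomials in the modes and their conjugates\<close>

text \<open>The letter \<open>(j, True)\<close> stands for the coefficient \<open>u\<^sub>j\<close> and \<open>(j, False)\<close> for its complex conjugate;
  the two are treated as independent variables. Polynomials are represented by the functions they
  define, so that identities such as the Jacobi identity need no normal form for coefficients.\<close>

type_synonym idx = "int \<times> bool"

inductive polyfun :: "((idx \<Rightarrow> complex) \<Rightarrow> complex) \<Rightarrow> bool" where
  const: "polyfun (\<lambda>x. a)"
| coord: "polyfun (\<lambda>x. x i)"
| add: "polyfun f \<Longrightarrow> polyfun g \<Longrightarrow> polyfun (\<lambda>x. f x + g x)"
| mult: "polyfun f \<Longrightarrow> polyfun g \<Longrightarrow> polyfun (\<lambda>x. f x * g x)"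

typedef hpoly = "Collect polyfun"
  using polyfun.const by blast

setup_lifting type_definition_hpoly

lift_definition ev :: "hpoly \<Rightarrow> (idx \<Rightarrow> complex) \<Rightarrow> complex" is "\<lambda>f. f" .
lift_definition Cst :: "complex \<Rightarrow> hpoly" is "\<lambda>a x. a" by (simp add: polyfun.const)
lift_definition Var :: "idx \<Rightarrow> hpoly" is "\<lambda>i x. x i" by (simp add: polyfun.coord)

lemma hpoly_eqI: "(\<And>x. ev p x = ev q x) \<Longrightarrow> p = q"
  by transfer auto

instantiation hpoly :: comm_ring_1
begin
lift_definition zero_hpoly :: hpoly is "\<lambda>x. 0" by (simp add: polyfun.const)
lift_definition one_hpoly :: hpoly is "\<lambda>x. 1" by (simp add: polyfun.const)
lift_definition plus_hpoly :: "hpoly \<Rightarrow> hpoly \<Rightarrow> hpoly" is "\<lambda>f g x. f x + g x"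
  by (simp add: polyfun.add)
lift_definition times_hpoly :: "hpoly \<Rightarrow> hpoly \<Rightarrow> hpoly" is "\<lambda>f g x. f x * g x"
  by (simp add: polyfun.mult)
lift_definition uminus_hpoly :: "hpoly \<Rightarrow> hpoly" is "\<lambda>f x. - f x"
  using polyfun.mult[OF polyfun.const[of "-1"]] by auto
lift_definition minus_hpoly :: "hpoly \<Rightarrow> hpoly \<Rightarrow> hpoly" is "\<lambda>f g x. f x - g x"
  using polyfun.add[OF _ polyfun.mult[OF polyfun.const[of "-1"]]] by fastforce
instance
  by standard (transfer; auto simp: fun_eq_iff algebra_simps)+
end

lemma ev_simps [simp]:
  "ev 0 x = 0" "ev 1 x = 1" "ev (p + q) x = ev p x + ev q x" "ev (p * q) x = ev p x * ev q x"
  "ev (- p) x = - ev p x" "ev (p - q) x = ev p x - ev q x" "ev (Cst a) x = a" "ev (Var i) x = x i"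
  by (transfer; simp)+

lemma ev_sum [simp]: "ev (sum f A) x = (\<Sum>i\<in>A. ev (f i) x)"
  by (induction A rule: infinite_finite_induct) auto

lemma Cst_simps: "Cst 0 = 0" "Cst 1 = 1" "Cst (a + b) = Cst a + Cst b" "Cst (a * b) = Cst a * Cst b"
  "Cst (- a) = - Cst a" "Cst (a - b) = Cst a - Cst b"
  by (rule hpoly_eqI; simp)+

lemma Cst_sum: "Cst (sum f A) = (\<Sum>i\<in>A. Cst (f i))"
  by (rule hpoly_eqI) simp

lemma hpoly_induct [case_names Cst Var add mult]:
  assumes "\<And>a. P (Cst a)" "\<And>i. P (Var i)"
    and "\<And>p q. P p \<Longrightarrow> P q \<Longrightarrow> P (p + q)" "\<And>p q. P p \<Longrightarrow> P q \<Longrightarrow> P (p * q)"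
  shows "P p"
proof -
  have "polyfun f \<Longrightarrow> P (Abs_hpoly f)" for f
  proof (induction rule: polyfun.induct)
    case (const a) then show ?case using assms(1)[of a] by (simp add: Cst_def)
  next
    case (coord i) then show ?case using assms(2)[of i] by (simp add: Var_def)
  next
    case (add f g)
    then show ?case using assms(3)[OF add.IH] by (simp add: plus_hpoly.abs_eq eq_onp_def)
  next
    case (mult f g)
    then show ?case using assms(4)[OF mult.IH] by (simp add: times_hpoly.abs_eq eq_onp_def)
  qed
  then show ?thesis by (metis Abs_hpoly_cases mem_Collect_eq)
qed

subsection \<open>Partial derivatives\<close>

lemma polyfun_pderiv_at:
  assumes "polyfun f"
  shows "(\<forall>x z. (\<lambda>z. f (x(i := z))) field_differentiable at z) \<and>
    polyfun (\<lambda>x. deriv (\<lambda>z. f (x(i := z))) (x i))"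
  using assms
proof (induction rule: polyfun.induct)
  case (const a) then show ?case by (simp add: polyfun.const)
next
  case (coord k)
  then show ?case by (cases "k = i") (auto simp: polyfun.const)
next
  case (add f g) then show ?case
    by (auto intro!: polyfun.add field_differentiable_add simp del: fun_upd_apply)
next
  case (mult f g) then show ?case
    by (auto intro!: polyfun.add polyfun.mult field_differentiable_mult simp del: fun_upd_apply)
qed

lift_definition pderiv_at :: "idx \<Rightarrow> hpoly \<Rightarrow> hpoly" is "\<lambda>i f x. deriv (\<lambda>z. f (x(i := z))) (x i)"
  using polyfun_pderiv_at by blast

lemma pderiv_at_simps [simp]:
  "pderiv_at i (Cst a) = 0" "pderiv_at i (Var k) = (if i = k then 1 else 0)" "pderiv_at i (p + q) = pderiv_at i p + pderiv_at i q"
  "pderiv_at i (p * q) = pderiv_at i p * q + p * pderiv_at i q"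
proof -
  show "pderiv_at i (Cst a) = 0" by transfer simp
  show "pderiv_at i (Var k) = (if i = k then 1 else 0)" by (transfer) (auto simp: fun_eq_iff)
  show "pderiv_at i (p + q) = pderiv_at i p + pderiv_at i q"
    by transfer (use polyfun_pderiv_at in \<open>auto simp: fun_eq_iff\<close>)
  show "pderiv_at i (p * q) = pderiv_at i p * q + p * pderiv_at i q"
    by transfer (use polyfun_pderiv_at in \<open>auto simp: fun_eq_iff\<close>)
qed

subsection \<open>The bracket\<close>

text \<open>The normalisation is \<open>{u\<^sub>j, v\<^sub>j} = - i\<close>, where \<open>v\<^sub>j\<close> is the conjugate letter of \<open>u\<^sub>j\<close>, so that the equation of
  motion \<open>u\<^sub>j' = {u\<^sub>j, H}\<close> reads \<open>i u\<^sub>j' = \<partial>H / \<partial>v\<^sub>j\<close>.\<close>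

definition br :: "nat \<Rightarrow> hpoly \<Rightarrow> hpoly \<Rightarrow> hpoly" where
  "br K p q = Cst (- \<i>) * (\<Sum>j\<in>modes K. pderiv_at (j, True) p * pderiv_at (j, False) q - pderiv_at (j, False) p * pderiv_at (j, True) q)"

lemma br_antisym: "br K p q = - br K q p"
  unfolding br_def
  by (subst mult_minus_right[symmetric], subst sum_negf[symmetric])
    (intro arg_cong2[where f = "(*)"] sum.cong refl, simp add: algebra_simps)

lemma br_Cst [simp]: "br K (Cst a) p = 0" "br K p (Cst a) = 0"
  by (auto simp: br_def)

lemma br_add_left: "br K (p + q) r = br K p r + br K q r"
  by (simp add: br_def sum.distrib sum_subtractf algebra_simps)

lemma br_mult_left: "br K (p * q) r = p * br K q r + q * br K p r"
  by (simp add: br_def sum_distrib_left sum.distrib sum_subtractf algebra_simps)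

lemma br_add_right: "br K r (p + q) = br K r p + br K r q"
  by (subst (1 2 3) br_antisym) (simp add: br_add_left)

lemma br_mult_right: "br K r (p * q) = p * br K r q + q * br K r p"
  by (subst (1 2 3) br_antisym) (simp add: br_mult_left)

lemma br_0 [simp]: "br K 0 p = 0" "br K p 0 = 0"
  by (metis br_Cst(1) Cst_simps(1), metis br_Cst(2) Cst_simps(1))

lemma br_uminus: "br K (- p) q = - br K p q" "br K p (- q) = - br K p q"
proof -
  show "br K (- p) q = - br K p q"
    using br_add_left[of K "- p" p q] by (simp add: eq_neg_iff_add_eq_0)
  show "br K p (- q) = - br K p q"
    using br_add_right[of K p "- q" q] by (simp add: eq_neg_iff_add_eq_0)
qed

lemma br_diff: "br K (p - r) q = br K p q - br K r q" "br K p (q - r) = br K p q - br K p r"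
  using br_add_left[of K p "- r" q] br_add_right[of K p q "- r"] by (simp_all add: br_uminus)

lemma br_Cst_mult: "br K (Cst a * p) q = Cst a * br K p q" "br K p (Cst a * q) = Cst a * br K p q"
  by (simp_all add: br_mult_left br_mult_right)

lemma br_sum_left: "br K (sum f A) q = (\<Sum>i\<in>A. br K (f i) q)"
  by (induction A rule: infinite_finite_induct) (auto simp: br_add_left)

lemma br_sum_right: "br K q (sum f A) = (\<Sum>i\<in>A. br K q (f i))"
  by (induction A rule: infinite_finite_induct) (auto simp: br_add_right)

lemma br_Var_Var: "\<exists>a. br K (Var i) (Var k) = Cst a"
proof -
  have "br K (Var i) (Var k) = Cst (- \<i> * (\<Sum>j\<in>modes K. (if (j, True) = i then 1 else 0) * (if (j, False) = k then 1 else 0)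
     - (if (j, False) = i then 1 else 0) * (if (j, True) = k then 1 else 0)))"
    unfolding br_def Cst_simps(4) Cst_sum
    by (intro arg_cong2[where f = "(*)"] sum.cong refl) (auto simp: Cst_simps)
  then show ?thesis by blast
qed

definition jacobiator :: "nat \<Rightarrow> hpoly \<Rightarrow> hpoly \<Rightarrow> hpoly \<Rightarrow> hpoly" where
  "jacobiator K f g h = br K f (br K g h) + br K g (br K h f) + br K h (br K f g)"

text \<open>The Jacobiator is a derivation in each argument, so it vanishes once it vanishes on coordinates.
  For three coordinates it is zero because brackets of coordinates are constants.\<close>

lemma jacobiator_reduce:
  assumes "\<And>i. jacobiator K (Var i) g h = 0"
  shows "jacobiator K f g h = 0"
proof (induction f rule: hpoly_induct)
  case (Cst a) then show ?case by (simp add: jacobiator_def)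
next
  case (Var i) then show ?case by (rule assms)
next
  case (add p q)
  have "jacobiator K (p + q) g h = jacobiator K p g h + jacobiator K q g h"
    by (simp add: jacobiator_def br_add_left br_add_right algebra_simps)
  then show ?case using add by simp
next
  case (mult p q)
  have cross: "br K g p + br K p g = 0" "br K g q + br K q g = 0"
    using br_antisym[of K g p] br_antisym[of K g q] by auto
  have "jacobiator K (p * q) g h = p * jacobiator K q g h + q * jacobiator K p g h
      + br K h q * (br K g p + br K p g) + br K h p * (br K g q + br K q g)"
    by (simp only: jacobiator_def br_mult_left br_mult_right br_add_left br_add_right) (simp add: algebra_simps)
  then show ?case using mult by (simp add: cross)
qed

lemma jacobiator_cyclic: "jacobiator K f g h = jacobiator K g h f"
  by (simp add: jacobiator_def algebra_simps)

lemma jacobiator_zero: "jacobiator K f g h = 0"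
proof (rule jacobiator_reduce)
  fix i show "jacobiator K (Var i) g h = 0"
    unfolding jacobiator_cyclic[of K "Var i"]
  proof (rule jacobiator_reduce)
    fix j show "jacobiator K (Var j) h (Var i) = 0"
      unfolding jacobiator_cyclic[of K "Var j"]
    proof (rule jacobiator_reduce)
      fix k
      show "jacobiator K (Var k) (Var i) (Var j) = 0"
        using br_Var_Var[of K i j] br_Var_Var[of K j k] br_Var_Var[of K k i] by (auto simp: jacobiator_def)
    qed
  qed
qed

lemma br_jacobi: "br K (br K f g) h = br K (br K f h) g + br K f (br K g h)"
proof -
  have 1: "br K (br K f g) h = - br K h (br K f g)"
    by (rule br_antisym)
  have 2: "br K (br K f h) g = br K g (br K h f)"
    by (subst br_antisym, subst br_antisym[of K f h]) (simp only: br_uminus minus_minus)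
  have "br K f (br K g h) + br K g (br K h f) + br K h (br K f g) = 0"
    using jacobiator_zero[of K f g h] by (simp only: jacobiator_def)
  then show ?thesis unfolding 1 2
    by (subst eq_commute, subst eq_neg_iff_add_eq_0) (simp only: ac_simps)
qed

section \<open>Homogeneous polynomials given by coefficients\<close>

definition idxs :: "nat \<Rightarrow> idx set" where "idxs K = modes K \<times> UNIV"

definition words :: "nat \<Rightarrow> nat \<Rightarrow> idx list set" where
  "words K d = {xs. set xs \<subseteq> idxs K \<and> length xs = d}"

definition mon :: "idx list \<Rightarrow> hpoly" where "mon xs = prod_list (map Var xs)"

text \<open>Coefficients are attached to ordered words and are not symmetrised. They are therefore not unique,
  but products and derivatives become plain operations on words.\<close>

definition hom :: "nat \<Rightarrow> nat \<Rightarrow> (idx list \<Rightarrow> complex) \<Rightarrow> hpoly" where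
  "hom K d c = (\<Sum>xs\<in>words K d. Cst (c xs) * mon xs)"

definition insert_at :: "nat \<Rightarrow> idx \<Rightarrow> idx list \<Rightarrow> idx list" where
  "insert_at a i xs = take a xs @ i # drop a xs"

lemma finite_idxs [simp]: "finite (idxs K)" by (simp add: idxs_def)

lemma finite_words [simp]: "finite (words K d)"
  using finite_lists_length_eq[OF finite_idxs, of K d] by (simp add: words_def)

lemma words_0 [simp]: "words K 0 = {[]}" by (auto simp: words_def)

lemma Cons_words [simp]: "i # xs \<in> words K (Suc d) \<longleftrightarrow> i \<in> idxs K \<and> xs \<in> words K d"
  by (auto simp: words_def)

lemma words_sum_Suc: "(\<Sum>xs\<in>words K (Suc d). F xs) = (\<Sum>i\<in>idxs K. \<Sum>xs\<in>words K d. F (i # xs))"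
proof -
  have "bij_betw (\<lambda>(i, xs). i # xs) (idxs K \<times> words K d) (words K (Suc d))"
    by (rule bij_betwI[of _ _ _ "\<lambda>xs. (hd xs, tl xs)"])
      (auto simp: words_def length_Suc_conv)
  then have "(\<Sum>xs\<in>words K (Suc d). F xs) = (\<Sum>p\<in>idxs K \<times> words K d. F (case p of (i, xs) \<Rightarrow> i # xs))"
    by (rule sum.reindex_bij_betw[symmetric])
  then show ?thesis by (simp add: sum.cartesian_product split_def)
qed

lemma hom_0 [simp]: "hom K 0 c = Cst (c [])"
  by (simp add: hom_def mon_def)

lemma hom_Suc: "hom K (Suc d) c = (\<Sum>i\<in>idxs K. Var i * hom K d (\<lambda>xs. c (i # xs)))"
  unfolding hom_def words_sum_Suc
  by (intro sum.cong refl) (simp add: sum_distrib_left mon_def mult.left_commute)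

lemma hom_add: "hom K d (\<lambda>xs. c xs + c' xs) = hom K d c + hom K d c'"
  by (simp add: hom_def Cst_simps distrib_right sum.distrib)

lemma hom_scale: "hom K d (\<lambda>xs. a * c xs) = Cst a * hom K d c"
  by (simp add: hom_def Cst_simps sum_distrib_left mult.assoc)

lemma hom_uminus: "hom K d (\<lambda>xs. - c xs) = - hom K d c"
  by (simp add: hom_def Cst_simps sum_negf)

lemma hom_zero [simp]: "hom K d (\<lambda>xs. 0) = 0"
  by (simp add: hom_def Cst_simps)

lemma hom_sum: "finite A \<Longrightarrow> hom K d (\<lambda>xs. \<Sum>a\<in>A. c a xs) = (\<Sum>a\<in>A. hom K d (c a))"
  by (induction A rule: finite_induct) (simp_all add: hom_add)

lemma hom_cong: "(\<And>xs. xs \<in> words K d \<Longrightarrow> c xs = c' xs) \<Longrightarrow> hom K d c = hom K d c'"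
  by (simp add: hom_def)

lemma pderiv_at_sum: "pderiv_at k (sum f A) = (\<Sum>i\<in>A. pderiv_at k (f i))"
proof -
  have "pderiv_at k 0 = 0" using pderiv_at_simps(1)[of k 0] by (simp add: Cst_simps)
  then show ?thesis by (induction A rule: infinite_finite_induct) auto
qed

text \<open>Differentiation deletes one letter \<open>k\<close>. Read backwards, the coefficient of what is left collects all
  the places where \<open>k\<close> can be put back.\<close>

lemma pderiv_at_hom:
  assumes "k \<in> idxs K"
  shows "pderiv_at k (hom K (Suc d) c) = hom K d (\<lambda>zs. \<Sum>a\<le>d. c (insert_at a k zs))"
proof (induction d arbitrary: c)
  case 0
  have "pderiv_at k (hom K (Suc 0) c) = (\<Sum>i\<in>idxs K. if k = i then Cst (c [i]) else 0)"
    unfolding hom_Suc pderiv_at_sum by (intro sum.cong refl) simp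
  then show ?case using assms by (simp add: insert_at_def)
next
  case (Suc d)
  have "pderiv_at k (hom K (Suc (Suc d)) c) = (\<Sum>i\<in>idxs K. if k = i then hom K (Suc d) (\<lambda>xs. c (i # xs)) else 0)
      + (\<Sum>i\<in>idxs K. Var i * hom K d (\<lambda>zs. \<Sum>a\<le>d. c (i # insert_at a k zs)))"
    unfolding hom_Suc[of K "Suc d"] pderiv_at_sum sum.distrib[symmetric]
    by (intro sum.cong refl) (simp add: Suc.IH)
  also have "(\<Sum>i\<in>idxs K. if k = i then hom K (Suc d) (\<lambda>xs. c (i # xs)) else 0) = hom K (Suc d) (\<lambda>xs. c (k # xs))"
    using assms by simp
  also have "(\<Sum>i\<in>idxs K. Var i * hom K d (\<lambda>zs. \<Sum>a\<le>d. c (i # insert_at a k zs)))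
      = hom K (Suc d) (\<lambda>zs. \<Sum>a\<le>d. c (insert_at (Suc a) k zs))"
    unfolding hom_Suc[of K d "\<lambda>zs. \<Sum>a\<le>d. c (insert_at (Suc a) k zs)"] by (simp add: insert_at_def)
  finally show ?case
    unfolding hom_add[symmetric] sum.atMost_Suc_shift by (simp add: insert_at_def)
qed

lemma hom_mult: "hom K d c * hom K e c' = hom K (d + e) (\<lambda>zs. c (take d zs) * c' (drop d zs))"
proof (induction d arbitrary: c)
  case 0
  then show ?case by (simp add: hom_scale)
next
  case (Suc d)
  show ?case
    unfolding hom_Suc[of K d] add_Suc hom_Suc[of K "d + e"] sum_distrib_right
    by (intro sum.cong refl) (simp add: Suc.IH mult.assoc)
qed

definition bracket_coeff :: "nat \<Rightarrow> nat \<Rightarrow> nat \<Rightarrow> (idx list \<Rightarrow> complex) \<Rightarrow> (idx list \<Rightarrow> complex) \<Rightarrow> idx list \<Rightarrow> complex" where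
  "bracket_coeff K d e c c' zs = - \<i> * (\<Sum>j\<in>modes K.
     (\<Sum>a\<le>d. c (insert_at a (j, True) (take d zs))) * (\<Sum>b\<le>e. c' (insert_at b (j, False) (drop d zs)))
   - (\<Sum>a\<le>d. c (insert_at a (j, False) (take d zs))) * (\<Sum>b\<le>e. c' (insert_at b (j, True) (drop d zs))))"

lemma br_hom: "br K (hom K (Suc d) c) (hom K (Suc e) c') = hom K (d + e) (bracket_coeff K d e c c')"
proof -
  have "br K (hom K (Suc d) c) (hom K (Suc e) c') = Cst (- \<i>) * (\<Sum>j\<in>modes K.
    hom K (d + e) (\<lambda>zs. (\<Sum>a\<le>d. c (insert_at a (j, True) (take d zs))) * (\<Sum>b\<le>e. c' (insert_at b (j, False) (drop d zs)))
   - (\<Sum>a\<le>d. c (insert_at a (j, False) (take d zs))) * (\<Sum>b\<le>e. c' (insert_at b (j, True) (drop d zs)))))"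
    unfolding br_def
    by (intro arg_cong2[where f = "(*)"] sum.cong refl)
      (simp add: pderiv_at_hom idxs_def hom_mult diff_conv_add_uminus hom_add hom_uminus del: add_uminus_conv_diff)
  also have "\<dots> = hom K (d + e) (bracket_coeff K d e c c')"
    unfolding bracket_coeff_def hom_scale hom_sum[OF finite_modes] ..
  finally show ?thesis .
qed

subsection \<open>Momentum, charge and frequency\<close>

definition letter_sign :: "bool \<Rightarrow> int" where "letter_sign b = (if b then 1 else - 1)"

definition momentum :: "idx list \<Rightarrow> int" where "momentum xs = (\<Sum>(j, b)\<leftarrow>xs. letter_sign b * j)"
definition charge :: "idx list \<Rightarrow> int" where "charge xs = (\<Sum>(j, b)\<leftarrow>xs. letter_sign b)"
text \<open>The frequency of a word is the number \<open>\<Omega>\<close> for which \<open>e\<^bsup>i h \<Omega>\<^esup>\<close> is the phase acquired by its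
  monomial under the linear flow of duration \<open>h\<close>. The flow has phases \<open>j\<^sup>2 h\<close>, but on words of charge zero
  \<open>j\<^sup>2 + 1\<close> gives the same \<open>\<Omega>\<close>, and it is the weight of the squared Sobolev norm.\<close>

definition frequency :: "idx list \<Rightarrow> int" where "frequency xs = (\<Sum>(j, b)\<leftarrow>xs. - letter_sign b * (j\<^sup>2 + 1))"

text \<open>Momentum is conserved only modulo \<open>2K\<close> because modes that differ by \<open>2K\<close> coincide on the grid.\<close>

definition conserving :: "nat \<Rightarrow> idx list \<Rightarrow> bool" where
  "conserving K xs \<longleftrightarrow> 2 * int K dvd momentum xs \<and> charge xs = 0"

lemma sum_list_insert_at: "sum_list (map f (insert_at a i xs)) = f i + (sum_list (map f xs) :: int)"
  by (simp add: insert_at_def) (metis append_take_drop_id map_append sum_list_append take_map drop_map)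

lemma sum_list_take_drop: "sum_list (map f (take d zs)) + sum_list (map f (drop d zs)) = (sum_list (map f zs) :: int)"
  by (metis append_take_drop_id map_append sum_list_append)

lemma momentum_insert_at: "momentum (insert_at a (j, b) xs) = letter_sign b * j + momentum xs"
  and charge_insert_at: "charge (insert_at a (j, b) xs) = letter_sign b + charge xs"
  and frequency_insert_at: "frequency (insert_at a (j, b) xs) = - letter_sign b * (j\<^sup>2 + 1) + frequency xs"
  by (simp_all add: momentum_def charge_def frequency_def sum_list_insert_at)

text \<open>On words of charge zero all terms \<open>j\<^sup>2 + 1\<close> may be shifted by the common amount \<open>K\<^sup>2 / 2 + 1\<close>, after which
  each letter contributes at most \<open>K\<^sup>2 / 2\<close>.\<close>

lemma frequency_bound:
  assumes "K \<ge> 1" "xs \<in> words K d" "charge xs = 0"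
  shows "\<bar>2 * frequency xs\<bar> \<le> int d * (int K)\<^sup>2"
proof -
  \<comment> \<open>The induction needs a statement without the charge condition, which is not inherited by tails.\<close>
  have "\<bar>2 * frequency xs + ((int K)\<^sup>2 + 2) * charge xs\<bar> \<le> int d * (int K)\<^sup>2"
    using assms(2)
  proof (induction xs arbitrary: d)
    case Nil then show ?case by (simp add: frequency_def charge_def)
  next
    case (Cons i xs)
    obtain j b where i: "i = (j, b)" by force
    obtain e where d: "d = Suc e" using Cons.prems by (cases d) (auto simp: words_def)
    have "\<bar>j\<bar> \<le> int K" using Cons.prems by (auto simp: d i idxs_def modes_def)
    then have j: "j\<^sup>2 \<le> (int K)\<^sup>2" by (metis abs_of_nat power2_le_iff_abs_le of_nat_0_le_iff power2_abs abs_le_square_iff)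
    have "\<bar>letter_sign b * ((int K)\<^sup>2 - 2 * j\<^sup>2)\<bar> \<le> (int K)\<^sup>2"
      using j zero_le_power2[of j] unfolding abs_le_iff by (cases b) (simp_all add: letter_sign_def)
    moreover have "\<bar>2 * frequency xs + ((int K)\<^sup>2 + 2) * charge xs\<bar> \<le> int e * (int K)\<^sup>2"
      using Cons by (auto simp: d)
    moreover have "2 * frequency (i # xs) + ((int K)\<^sup>2 + 2) * charge (i # xs) =
      (2 * frequency xs + ((int K)\<^sup>2 + 2) * charge xs) + letter_sign b * ((int K)\<^sup>2 - 2 * j\<^sup>2)"
      by (simp add: frequency_def charge_def i algebra_simps)
    ultimately show ?case by (simp add: d algebra_simps)
  qed
  then show ?thesis using assms(3) by simp
qed

lemma modes_unique:
  assumes "j \<in> modes K" "j' \<in> modes K" "2 * int K dvd letter_sign b * j + m" "2 * int K dvd letter_sign b * j' + m"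
  shows "j = j'"
proof -
  have "2 * int K dvd letter_sign b * (j - j')"
    using dvd_diff[OF assms(3,4)] by (simp add: algebra_simps)
  then have "2 * int K dvd j - j'" by (cases b) (auto simp: letter_sign_def dvd_diff_commute)
  moreover have "\<bar>j - j'\<bar> < 2 * int K" using assms(1,2) by (auto simp: modes_def)
  ultimately show ?thesis using dvd_imp_le_int[of "j - j'" "2 * int K"] by (cases "j = j'") auto
qed

lemma sum_le_one_term:
  fixes f :: "'a \<Rightarrow> real"
  assumes "finite A" "M \<ge> 0" "\<And>j. j \<in> A \<Longrightarrow> f j \<le> M" "\<And>j j'. j \<in> A \<Longrightarrow> j' \<in> A \<Longrightarrow> f j \<noteq> 0 \<Longrightarrow> f j' \<noteq> 0 \<Longrightarrow> j = j'"
  shows "sum f A \<le> M"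
proof (cases "\<exists>j\<in>A. f j \<noteq> 0")
  case True
  then obtain j where j: "j \<in> A" "f j \<noteq> 0" by blast
  have "sum f A = sum f {j}"
    by (rule sum.mono_neutral_right) (use assms j in auto)
  then show ?thesis using assms(3) j by simp
next
  case False
  then show ?thesis using assms by simp
qed

lemma insert_at_words: "i \<in> idxs K \<Longrightarrow> xs \<in> words K d \<Longrightarrow> insert_at a i xs \<in> words K (Suc d)"
  using set_take_subset[of a xs] set_drop_subset[of a xs] by (auto simp: words_def insert_at_def)

lemma take_words: "zs \<in> words K (d + e) \<Longrightarrow> take d zs \<in> words K d"
  and drop_words: "zs \<in> words K (d + e) \<Longrightarrow> drop d zs \<in> words K e"
  using set_take_subset[of d zs] set_drop_subset[of d zs] by (auto simp: words_def)

text \<open>The supremum of the coefficients serves as the norm: on words that obey the conservation laws it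
  behaves well under brackets, with constants that do not depend on the number of modes.\<close>

definition balanced :: "nat \<Rightarrow> nat \<Rightarrow> real \<Rightarrow> (idx list \<Rightarrow> complex) \<Rightarrow> bool" where
  "balanced K d B c \<longleftrightarrow> (\<forall>xs\<in>words K d. cmod (c xs) \<le> B \<and> (\<not> conserving K xs \<longrightarrow> c xs = 0))"

lemma balanced_insert_at_sum:
  assumes "balanced K (Suc d) B c" "ys \<in> words K d" "j \<in> modes K"
  shows "cmod (\<Sum>a\<le>d. c (insert_at a (j, b) ys)) \<le> real (Suc d) * B"
    and "(\<Sum>a\<le>d. c (insert_at a (j, b) ys)) \<noteq> 0 \<Longrightarrow> 2 * int K dvd letter_sign b * j + momentum ys \<and> letter_sign b + charge ys = 0"
proof -
  have w: "insert_at a (j, b) ys \<in> words K (Suc d)" for a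
    using assms by (intro insert_at_words) (auto simp: idxs_def)
  have "cmod (\<Sum>a\<le>d. c (insert_at a (j, b) ys)) \<le> (\<Sum>a\<le>d. B)"
    by (rule order.trans[OF norm_sum sum_mono]) (use assms w in \<open>auto simp: balanced_def\<close>)
  then show "cmod (\<Sum>a\<le>d. c (insert_at a (j, b) ys)) \<le> real (Suc d) * B" by simp
  assume "(\<Sum>a\<le>d. c (insert_at a (j, b) ys)) \<noteq> 0"
  then obtain a where "c (insert_at a (j, b) ys) \<noteq> 0" by (meson sum.neutral)
  then have "conserving K (insert_at a (j, b) ys)" using assms w by (auto simp: balanced_def)
  then show "2 * int K dvd letter_sign b * j + momentum ys \<and> letter_sign b + charge ys = 0"
    by (simp add: conserving_def momentum_insert_at charge_insert_at)
qed

text \<open>The contraction in the bracket is a sum over all modes \<open>j\<close>. Momentum conservation of the two factors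
  determines \<open>j\<close> modulo \<open>2K\<close>, hence at most one term is nonzero and the bound does not depend on \<open>K\<close>.\<close>

lemma balanced_bracket_coeff:
  assumes c: "balanced K (Suc d) B c" and c': "balanced K (Suc e) B' c'" and B: "B \<ge> 0" "B' \<ge> 0"
  shows "balanced K (d + e) (2 * real (Suc d) * real (Suc e) * B * B') (bracket_coeff K d e c c')"
  unfolding balanced_def
proof (intro ballI conjI impI)
  fix zs assume zs: "zs \<in> words K (d + e)"
  define S where "S = (\<lambda>j b. (\<Sum>a\<le>d. c (insert_at a (j, b) (take d zs))))"
  define S' where "S' = (\<lambda>j b. (\<Sum>a\<le>e. c' (insert_at a (j, b) (drop d zs))))"
  have cb: "bracket_coeff K d e c c' zs = - \<i> * (\<Sum>j\<in>modes K. S j True * S' j False - S j False * S' j True)"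
    by (simp add: bracket_coeff_def S_def S'_def)
  note t = take_words[OF zs] and dr = drop_words[OF zs]
  have 1: "(\<Sum>j\<in>modes K. cmod (S j b * S' j b')) \<le> real (Suc d) * B * (real (Suc e) * B')" for b b'
  proof (rule sum_le_one_term)
    show "0 \<le> real (Suc d) * B * (real (Suc e) * B')" using B by simp
    show "cmod (S j b * S' j b') \<le> real (Suc d) * B * (real (Suc e) * B')" if "j \<in> modes K" for j
      unfolding norm_mult S_def S'_def
      by (intro mult_mono balanced_insert_at_sum[OF c t that] balanced_insert_at_sum[OF c' dr that]) (use B in auto)
    show "i = j" if "i \<in> modes K" "j \<in> modes K" "cmod (S i b * S' i b') \<noteq> 0" "cmod (S j b * S' j b') \<noteq> 0" for i j
      using balanced_insert_at_sum(2)[OF c t, of i b] balanced_insert_at_sum(2)[OF c t, of j b] that modes_unique[of i K j b]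
      by (auto simp: S_def)
  qed simp
  have "cmod (bracket_coeff K d e c c' zs) \<le> (\<Sum>j\<in>modes K. cmod (S j True * S' j False) + cmod (S j False * S' j True))"
    unfolding cb norm_mult by (simp, rule order.trans[OF norm_sum sum_mono], rule norm_triangle_le_diff) (simp add: norm_mult)
  also have "\<dots> \<le> 2 * real (Suc d) * real (Suc e) * B * B'"
    using 1[of True False] 1[of False True] by (simp add: sum.distrib algebra_simps)
  finally show "cmod (bracket_coeff K d e c c' zs) \<le> 2 * real (Suc d) * real (Suc e) * B * B'" .
  assume ns: "\<not> conserving K zs"
  have 2: "S j b * S' j (\<not> b) = 0" if j: "j \<in> modes K" for j b
  proof (rule ccontr)
    assume "S j b * S' j (\<not> b) \<noteq> 0"
    then have "S j b \<noteq> 0" "S' j (\<not> b) \<noteq> 0" by auto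
    from balanced_insert_at_sum(2)[OF c t j this(1)[unfolded S_def]] balanced_insert_at_sum(2)[OF c' dr j this(2)[unfolded S'_def]]
    have a: "2 * int K dvd (letter_sign b * j + momentum (take d zs)) + (letter_sign (\<not> b) * j + momentum (drop d zs))"
      and b: "(letter_sign b + charge (take d zs)) + (letter_sign (\<not> b) + charge (drop d zs)) = 0"
      by (auto intro: dvd_add)
    have "(letter_sign b * j + momentum (take d zs)) + (letter_sign (\<not> b) * j + momentum (drop d zs)) = momentum (take d zs) + momentum (drop d zs)"
      by (simp add: letter_sign_def)
    also have "\<dots> = momentum zs" unfolding momentum_def by (rule sum_list_take_drop)
    finally have m: "2 * int K dvd momentum zs" using a by simp
    have "(letter_sign b + charge (take d zs)) + (letter_sign (\<not> b) + charge (drop d zs)) = charge (take d zs) + charge (drop d zs)"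
      by (simp add: letter_sign_def)
    also have "\<dots> = charge zs" unfolding charge_def by (rule sum_list_take_drop)
    finally show False using ns m b by (simp add: conserving_def)
  qed
  show "bracket_coeff K d e c c' zs = 0"
  proof -
    have "(\<Sum>j\<in>modes K. S j True * S' j False - S j False * S' j True) = (\<Sum>j\<in>modes K. 0)"
    proof (intro sum.cong refl)
      fix j assume "j \<in> modes K"
      then show "S j True * S' j False - S j False * S' j True = 0"
        using 2[of j True] 2[of j False] by auto
    qed
    then show ?thesis by (simp add: cb)
  qed
qed

text \<open>The two contracted letters are conjugate to each other, so their frequencies cancel and frequencies
  add up under the bracket.\<close>

lemma bracket_coeff_phase:
  fixes h :: real
  assumes "\<And>xs. xs \<in> words K (Suc d) \<Longrightarrow> c1 xs = cis (h * frequency xs) * c xs"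
    and "\<And>xs. xs \<in> words K (Suc e) \<Longrightarrow> c1' xs = cis (h * frequency xs) * c' xs"
    and zs: "zs \<in> words K (d + e)"
  shows "bracket_coeff K d e c1 c1' zs = cis (h * frequency zs) * bracket_coeff K d e c c' zs"
proof -
  have fr: "frequency (take d zs) + frequency (drop d zs) = frequency zs"
    unfolding frequency_def by (rule sum_list_take_drop)
  have S: "(\<Sum>a\<le>d. c1 (insert_at a (j, b) (take d zs)))
      = cis (h * of_int (- letter_sign b * (j\<^sup>2 + 1) + frequency (take d zs))) * (\<Sum>a\<le>d. c (insert_at a (j, b) (take d zs)))"
    if "j \<in> modes K" for j b
    unfolding sum_distrib_left
    by (intro sum.cong refl) (use that take_words[OF zs] in \<open>auto simp: assms insert_at_words idxs_def frequency_insert_at\<close>)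
  have S': "(\<Sum>a\<le>e. c1' (insert_at a (j, b) (drop d zs)))
      = cis (h * of_int (- letter_sign b * (j\<^sup>2 + 1) + frequency (drop d zs))) * (\<Sum>a\<le>e. c' (insert_at a (j, b) (drop d zs)))"
    if "j \<in> modes K" for j b
    unfolding sum_distrib_left
    by (intro sum.cong refl) (use that drop_words[OF zs] in \<open>auto simp: assms insert_at_words idxs_def frequency_insert_at\<close>)
  have m: "cis (h * of_int (- letter_sign b * (j\<^sup>2 + 1) + frequency (take d zs))) * x *
      (cis (h * of_int (- letter_sign (\<not> b) * (j\<^sup>2 + 1) + frequency (drop d zs))) * y) = cis (h * frequency zs) * (x * y)" for x y j b
  proof -
    have "h * real_of_int (- letter_sign b * (j\<^sup>2 + 1) + frequency (take d zs)) + h * real_of_int (- letter_sign (\<not> b) * (j\<^sup>2 + 1) + frequency (drop d zs))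
      = h * real_of_int (frequency (take d zs) + frequency (drop d zs))"
      by (simp add: letter_sign_def algebra_simps)
    also have "\<dots> = h * frequency zs" unfolding fr ..
    finally have "cis (h * of_int (- letter_sign b * (j\<^sup>2 + 1) + frequency (take d zs))) * cis (h * of_int (- letter_sign (\<not> b) * (j\<^sup>2 + 1) + frequency (drop d zs)))
      = cis (h * frequency zs)" by (simp only: cis_mult)
    then show ?thesis by (metis mult.assoc mult.left_commute)
  qed
  have P: "(\<Sum>a\<le>d. c1 (insert_at a (j, b) (take d zs))) * (\<Sum>a\<le>e. c1' (insert_at a (j, b') (drop d zs)))
      = cis (h * frequency zs) * ((\<Sum>a\<le>d. c (insert_at a (j, b) (take d zs))) * (\<Sum>a\<le>e. c' (insert_at a (j, b') (drop d zs))))"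
    if "j \<in> modes K" "b' = (\<not> b)" for j b b'
    unfolding S[OF that(1)] S'[OF that(1)] that(2) by (rule m)
  have "(\<Sum>j\<in>modes K.
     (\<Sum>a\<le>d. c1 (insert_at a (j, True) (take d zs))) * (\<Sum>b\<le>e. c1' (insert_at b (j, False) (drop d zs)))
   - (\<Sum>a\<le>d. c1 (insert_at a (j, False) (take d zs))) * (\<Sum>b\<le>e. c1' (insert_at b (j, True) (drop d zs))))
   = cis (h * frequency zs) * (\<Sum>j\<in>modes K.
     (\<Sum>a\<le>d. c (insert_at a (j, True) (take d zs))) * (\<Sum>b\<le>e. c' (insert_at b (j, False) (drop d zs)))
   - (\<Sum>a\<le>d. c (insert_at a (j, False) (take d zs))) * (\<Sum>b\<le>e. c' (insert_at b (j, True) (drop d zs))))"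
  proof (subst sum_distrib_left, rule sum.cong[OF refl])
    fix j assume j: "j \<in> modes K"
    from P[OF j, of False True] P[OF j, of True False]
    show "(\<Sum>a\<le>d. c1 (insert_at a (j, True) (take d zs))) * (\<Sum>b\<le>e. c1' (insert_at b (j, False) (drop d zs)))
   - (\<Sum>a\<le>d. c1 (insert_at a (j, False) (take d zs))) * (\<Sum>b\<le>e. c1' (insert_at b (j, True) (drop d zs)))
   = cis (h * frequency zs) * ((\<Sum>a\<le>d. c (insert_at a (j, True) (take d zs))) * (\<Sum>b\<le>e. c' (insert_at b (j, False) (drop d zs)))
   - (\<Sum>a\<le>d. c (insert_at a (j, False) (take d zs))) * (\<Sum>b\<le>e. c' (insert_at b (j, True) (drop d zs))))"
      by (simp only: simp_thms right_diff_distrib)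
  qed
  then show ?thesis unfolding bracket_coeff_def by (simp only: mult.left_commute)
qed

lemma mon_bound: "(\<Sum>xs\<in>words K d. cmod (ev (mon xs) x)) = (\<Sum>i\<in>idxs K. cmod (x i)) ^ d"
proof (induction d)
  case 0 then show ?case by (simp add: mon_def)
next
  case (Suc d)
  have "(\<Sum>xs\<in>words K (Suc d). cmod (ev (mon xs) x)) = (\<Sum>i\<in>idxs K. cmod (x i) * (\<Sum>xs\<in>words K d. cmod (ev (mon xs) x)))"
    unfolding words_sum_Suc by (simp add: mon_def norm_mult sum_distrib_left)
  then show ?case by (simp add: Suc.IH sum_distrib_right)
qed

lemma hom_bound:
  assumes "balanced K d B c"
  shows "cmod (ev (hom K d c) x) \<le> B * (\<Sum>i\<in>idxs K. cmod (x i)) ^ d"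
proof -
  have "cmod (ev (hom K d c) x) \<le> (\<Sum>xs\<in>words K d. B * cmod (ev (mon xs) x))"
    unfolding hom_def ev_sum
    by (rule order.trans[OF norm_sum sum_mono]) (use assms in \<open>auto simp: norm_mult balanced_def intro!: mult_right_mono\<close>)
  then show ?thesis by (simp add: mon_bound flip: sum_distrib_left)
qed

subsection \<open>The quadratic form of the squared Sobolev norm\<close>

definition sobolev_form :: "nat \<Rightarrow> hpoly" where
  "sobolev_form K = (\<Sum>j\<in>modes K. Cst (of_int (j\<^sup>2 + 1)) * (Var (j, True) * Var (j, False)))"

lemma br_Var:
  assumes "j \<in> modes K"
  shows "br K (Var (j, True)) p = Cst (- \<i>) * pderiv_at (j, False) p"
    and "br K (Var (j, False)) p = Cst \<i> * pderiv_at (j, True) p"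
proof -
  have "br K (Var (j, True)) p = Cst (- \<i>) * (\<Sum>i\<in>modes K. if i = j then pderiv_at (i, False) p else 0)"
    unfolding br_def by (intro arg_cong2[where f = "(*)"] sum.cong refl) auto
  then show "br K (Var (j, True)) p = Cst (- \<i>) * pderiv_at (j, False) p" using assms by simp
  have "br K (Var (j, False)) p = Cst (- \<i>) * (\<Sum>i\<in>modes K. if i = j then - pderiv_at (i, True) p else 0)"
    unfolding br_def by (intro arg_cong2[where f = "(*)"] sum.cong refl) auto
  then show "br K (Var (j, False)) p = Cst \<i> * pderiv_at (j, True) p" using assms by (simp add: Cst_simps)
qed

lemma br_Var_sobolev_form:
  assumes "i \<in> idxs K"
  shows "br K (Var i) (sobolev_form K) = Cst (\<i> * of_int (frequency [i])) * Var i"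
proof -
  obtain j b where i: "i = (j, b)" "j \<in> modes K" using assms by (auto simp: idxs_def)
  have p: "pderiv_at (j, b) (sobolev_form K) = Cst (of_int (j\<^sup>2 + 1)) * Var (j, \<not> b)" for b
  proof -
    have "pderiv_at (j, b) (sobolev_form K) = (\<Sum>k\<in>modes K. if k = j then Cst (of_int (j\<^sup>2 + 1)) * Var (j, \<not> b) else 0)"
      unfolding sobolev_form_def pderiv_at_sum by (intro sum.cong refl) (cases b; auto)
    then show ?thesis using i by simp
  qed
  show ?thesis
    by (cases b) (simp_all add: i br_Var p frequency_def letter_sign_def Cst_simps algebra_simps)
qed

lemma br_mon_sobolev_form:
  "set xs \<subseteq> idxs K \<Longrightarrow> br K (mon xs) (sobolev_form K) = Cst (\<i> * of_int (frequency xs)) * mon xs"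
proof (induction xs)
  case Nil
  have "mon [] = Cst 1" by (simp add: mon_def Cst_simps(2))
  then show ?case by (simp add: frequency_def Cst_simps(1))
next
  case (Cons i xs)
  have "mon (i # xs) = Var i * mon xs" by (simp add: mon_def)
  moreover have "of_int (frequency (i # xs)) = (of_int (frequency [i]) + of_int (frequency xs) :: complex)"
    by (simp add: frequency_def)
  ultimately show ?case using Cons
    by (simp add: br_mult_left br_Var_sobolev_form Cst_simps algebra_simps)
qed

lemma br_hom_sobolev_form: "br K (hom K d c) (sobolev_form K) = hom K d (\<lambda>xs. \<i> * of_int (frequency xs) * c xs)"
  unfolding hom_def br_sum_left
  by (intro sum.cong refl)
    (auto simp: br_Cst_mult br_mon_sobolev_form words_def Cst_simps)

section \<open>Time-dependent Hamiltonians\<close>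

text \<open>A relation instead of an operator: it records families of polynomials whose differentiable
  coefficients are given explicitly. It is closed under brackets, and the product rule for them
  needs no interchange of time derivatives with partial derivatives.\<close>

inductive time_deriv :: "(real \<Rightarrow> hpoly) \<Rightarrow> (real \<Rightarrow> hpoly) \<Rightarrow> bool" where
  base: "(\<And>t. (c has_vector_derivative c' t) (at t)) \<Longrightarrow> time_deriv (\<lambda>t. Cst (c t) * p) (\<lambda>t. Cst (c' t) * p)"
| add: "time_deriv P P' \<Longrightarrow> time_deriv Q Q' \<Longrightarrow> time_deriv (\<lambda>t. P t + Q t) (\<lambda>t. P' t + Q' t)"

lemma time_deriv_const: "time_deriv (\<lambda>t. p) (\<lambda>t. 0)"
  using time_deriv.base[of "\<lambda>t. 1" "\<lambda>t. 0" p] by (simp add: Cst_simps)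

lemma time_deriv_sum:
  assumes "finite A" "\<And>i. i \<in> A \<Longrightarrow> time_deriv (P i) (P' i)"
  shows "time_deriv (\<lambda>t. \<Sum>i\<in>A. P i t) (\<lambda>t. \<Sum>i\<in>A. P' i t)"
  using assms by (induction A rule: finite_induct) (auto intro: time_deriv_const time_deriv.add)

lemma time_deriv_Cst_mult:
  assumes "time_deriv P P'"
  shows "time_deriv (\<lambda>t. Cst a * P t) (\<lambda>t. Cst a * P' t)"
  using assms
proof (induction rule: time_deriv.induct)
  case (base c c' p)
  have "time_deriv (\<lambda>t. Cst (a * c t) * p) (\<lambda>t. Cst (a * c' t) * p)"
    by (rule time_deriv.base) (auto intro!: derivative_eq_intros base)
  then show ?case by (simp add: Cst_simps mult.assoc)
next
  case (add P P' Q Q')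
  then show ?case using time_deriv.add by (simp add: distrib_left)
qed

lemma time_deriv_br:
  assumes "time_deriv P P'" "time_deriv Q Q'"
  shows "time_deriv (\<lambda>t. br K (P t) (Q t)) (\<lambda>t. br K (P' t) (Q t) + br K (P t) (Q' t))"
  using assms(1)
proof (induction rule: time_deriv.induct)
  case (base c c' p)
  note c = base
  show ?case using assms(2)
  proof (induction rule: time_deriv.induct)
    case (base e e' q)
    have "time_deriv (\<lambda>t. Cst (c t * e t) * br K p q) (\<lambda>t. Cst (c' t * e t + c t * e' t) * br K p q)"
    proof (rule time_deriv.base)
      fix t show "((\<lambda>t. c t * e t) has_vector_derivative c' t * e t + c t * e' t) (at t)"
        using has_vector_derivative_mult[OF c[of t] base[of t]] by (simp add: add.commute)
    qed
    then show ?case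
      by (simp only: br_Cst_mult Cst_simps distrib_right mult.assoc mult.left_commute)
  next
    case (add P P' Q Q')
    from time_deriv.add[OF add.IH] show ?case
      by (simp add: br_add_left br_add_right algebra_simps)
  qed
next
  case (add P P' Q Q')
  from time_deriv.add[OF add.IH] show ?case
    by (simp add: br_add_left br_add_right algebra_simps)
qed

lemma time_deriv_hom:
  assumes "\<And>xs t. xs \<in> words K d \<Longrightarrow> ((\<lambda>t. c t xs) has_vector_derivative c' t xs) (at t)"
  shows "time_deriv (\<lambda>t. hom K d (c t)) (\<lambda>t. hom K d (c' t))"
  unfolding hom_def by (intro time_deriv_sum time_deriv.base assms) auto

text \<open>Both sides are derivations in \<open>p\<close>, so the equations of motion of the coordinates determine those of
  every polynomial.\<close>

lemma chain_poly:
  assumes "\<And>i. ((\<lambda>t. x t i) has_vector_derivative ev (br K (Var i) g) (x t0)) (at t0)"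
  shows "((\<lambda>t. ev p (x t)) has_vector_derivative ev (br K p g) (x t0)) (at t0)"
proof (induction p rule: hpoly_induct)
  case (Cst a) then show ?case by simp
next
  case (Var i) then show ?case using assms[of i] by simp
next
  case (add p q)
  then show ?case by (simp add: br_add_left has_vector_derivative_add)
next
  case (mult p q)
  from has_vector_derivative_mult[OF this] show ?case
    by (simp add: br_mult_left algebra_simps)
qed

lemma chain_time_deriv:
  assumes "time_deriv P P'"
    and "\<And>i. ((\<lambda>t. x t i) has_vector_derivative ev (br K (Var i) g) (x t0)) (at t0)"
  shows "((\<lambda>t. ev (P t) (x t)) has_vector_derivative ev (P' t0 + br K (P t0) g) (x t0)) (at t0)"
  using assms(1)
proof (induction rule: time_deriv.induct)
  case (base c c' p)
  from has_vector_derivative_mult[OF base chain_poly[OF assms(2)]]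
  show ?case by (simp add: br_Cst_mult add.commute)
next
  case (add P P' Q Q')
  from has_vector_derivative_add[OF add.IH]
  show ?case by (simp add: br_add_left algebra_simps)
qed

text \<open>The class of time-dependent polynomials used throughout. Shifting time by \<open>s\<close> substeps acts as the
  linear flow of duration \<open>h\<close>; this quasi-periodicity is what allows antiderivatives that stay bounded for all
  times.\<close>

definition hamiltonian :: "nat \<Rightarrow> real \<Rightarrow> nat \<Rightarrow> nat \<Rightarrow> real \<Rightarrow> (real \<Rightarrow> hpoly) \<Rightarrow> bool" where
  "hamiltonian K h s d B P \<longleftrightarrow> (\<exists>c. (\<forall>t. P t = hom K d (c t)) \<and> (\<forall>xs\<in>words K d. continuous_on UNIV (\<lambda>t. c t xs)) \<and>
     (\<forall>t. balanced K d B (c t)) \<and> (\<forall>t. \<forall>xs\<in>words K d. c (t + real s) xs = cis (h * frequency xs) * c t xs))"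

lemma balanced_mono: "balanced K d B c \<Longrightarrow> B \<le> B' \<Longrightarrow> balanced K d B' c"
  by (fastforce simp: balanced_def)

lemma hamiltonian_mono: "hamiltonian K h s d B P \<Longrightarrow> B \<le> B' \<Longrightarrow> hamiltonian K h s d B' P"
  unfolding hamiltonian_def by (erule exE, rule exI) (auto intro: balanced_mono)

lemma hamiltonian_zero: "B \<ge> 0 \<Longrightarrow> hamiltonian K h s d B (\<lambda>t. 0)"
  unfolding hamiltonian_def by (rule exI[of _ "\<lambda>t xs. 0"]) (auto simp: balanced_def)

lemma hamiltonian_add:
  assumes "hamiltonian K h s d B P" "hamiltonian K h s d B' Q"
  shows "hamiltonian K h s d (B + B') (\<lambda>t. P t + Q t)"
proof -
  obtain c c' where
    c: "\<And>t. P t = hom K d (c t)" "\<forall>xs\<in>words K d. continuous_on UNIV (\<lambda>t. c t xs)" "\<And>t. balanced K d B (c t)"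
      "\<And>t xs. xs\<in>words K d \<Longrightarrow> c (t + real s) xs = cis (h * frequency xs) * c t xs" and
    c': "\<And>t. Q t = hom K d (c' t)" "\<forall>xs\<in>words K d. continuous_on UNIV (\<lambda>t. c' t xs)" "\<And>t. balanced K d B' (c' t)"
      "\<And>t xs. xs\<in>words K d \<Longrightarrow> c' (t + real s) xs = cis (h * frequency xs) * c' t xs"
    using assms unfolding hamiltonian_def by metis
  show ?thesis unfolding hamiltonian_def
  proof (intro exI[of _ "\<lambda>t xs. c t xs + c' t xs"] conjI allI ballI)
    fix t show "P t + Q t = hom K d (\<lambda>xs. c t xs + c' t xs)" by (simp add: c c' hom_add)
    show "balanced K d (B + B') (\<lambda>xs. c t xs + c' t xs)"
      using c(3)[of t] c'(3)[of t] by (auto simp: balanced_def intro!: norm_triangle_mono)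
  qed (use c(2) c'(2) in \<open>auto simp: c(4) c'(4) algebra_simps intro!: continuous_intros\<close>)
qed

lemma hamiltonian_Cst_mult:
  assumes "hamiltonian K h s d B P"
  shows "hamiltonian K h s d (cmod a * B) (\<lambda>t. Cst a * P t)"
proof -
  obtain c where
    c: "\<And>t. P t = hom K d (c t)" "\<forall>xs\<in>words K d. continuous_on UNIV (\<lambda>t. c t xs)" "\<And>t. balanced K d B (c t)"
      "\<And>t xs. xs\<in>words K d \<Longrightarrow> c (t + real s) xs = cis (h * frequency xs) * c t xs"
    using assms unfolding hamiltonian_def by metis
  show ?thesis unfolding hamiltonian_def
  proof (intro exI[of _ "\<lambda>t xs. a * c t xs"] conjI allI ballI)
    fix t show "Cst a * P t = hom K d (\<lambda>xs. a * c t xs)" by (simp add: c hom_scale)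
    show "balanced K d (cmod a * B) (\<lambda>xs. a * c t xs)"
      using c(3)[of t] by (auto simp: balanced_def norm_mult intro!: mult_left_mono)
  qed (use c(2) in \<open>auto simp: c(4) algebra_simps intro!: continuous_intros\<close>)
qed

lemma hamiltonian_uminus: "hamiltonian K h s d B P \<Longrightarrow> hamiltonian K h s d B (\<lambda>t. - P t)"
  using hamiltonian_Cst_mult[of K h s d B P "-1"] by (simp add: Cst_simps)

lemma hamiltonian_sum:
  assumes "finite A" "\<And>i. i \<in> A \<Longrightarrow> hamiltonian K h s d (B i) (P i)"
  shows "hamiltonian K h s d (\<Sum>i\<in>A. B i) (\<lambda>t. \<Sum>i\<in>A. P i t)"
  using assms by (induction A rule: finite_induct) (auto intro: hamiltonian_zero hamiltonian_add)

lemma hamiltonian_br: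
  assumes "hamiltonian K h s (Suc d) B P" "hamiltonian K h s (Suc e) B' Q" "B \<ge> 0" "B' \<ge> 0"
  shows "hamiltonian K h s (d + e) (2 * real (Suc d) * real (Suc e) * B * B') (\<lambda>t. br K (P t) (Q t))"
proof -
  obtain c c' where
    c: "\<And>t. P t = hom K (Suc d) (c t)" "\<forall>xs\<in>words K (Suc d). continuous_on UNIV (\<lambda>t. c t xs)" "\<And>t. balanced K (Suc d) B (c t)"
      "\<And>t xs. xs\<in>words K (Suc d) \<Longrightarrow> c (t + real s) xs = cis (h * frequency xs) * c t xs" and
    c': "\<And>t. Q t = hom K (Suc e) (c' t)" "\<forall>xs\<in>words K (Suc e). continuous_on UNIV (\<lambda>t. c' t xs)" "\<And>t. balanced K (Suc e) B' (c' t)"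
      "\<And>t xs. xs\<in>words K (Suc e) \<Longrightarrow> c' (t + real s) xs = cis (h * frequency xs) * c' t xs"
    using assms unfolding hamiltonian_def by metis
  show ?thesis unfolding hamiltonian_def
  proof (intro exI[of _ "\<lambda>t. bracket_coeff K d e (c t) (c' t)"] conjI allI ballI)
    fix t show "br K (P t) (Q t) = hom K (d + e) (bracket_coeff K d e (c t) (c' t))" by (simp add: c c' br_hom)
    show "balanced K (d + e) (2 * real (Suc d) * real (Suc e) * B * B') (bracket_coeff K d e (c t) (c' t))"
      by (rule balanced_bracket_coeff) (use c c' assms in auto)
    show "bracket_coeff K d e (c (t + real s)) (c' (t + real s)) xs = cis (h * frequency xs) * bracket_coeff K d e (c t) (c' t) xs"
      if "xs \<in> words K (d + e)" for xs
      by (rule bracket_coeff_phase) (use c c' that in auto)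
  next
    fix zs assume zs: "zs \<in> words K (d + e)"
    have 1: "continuous_on UNIV (\<lambda>t. c t (insert_at a (j, b) (take d zs)))"
      "continuous_on UNIV (\<lambda>t. c' t (insert_at a (j, b) (drop d zs)))" if "j \<in> modes K" for j a b
      using c(2) c'(2) that take_words[OF zs] drop_words[OF zs] by (auto simp: insert_at_words idxs_def)
    show "continuous_on UNIV (\<lambda>t. bracket_coeff K d e (c t) (c' t) zs)"
      unfolding bracket_coeff_def by (intro continuous_intros 1)
  qed
qed

lemma hamiltonian_bound:
  assumes "hamiltonian K h s d B P"
  shows "cmod (ev (P t) x) \<le> B * (\<Sum>i\<in>idxs K. cmod (x i)) ^ d"
  using assms unfolding hamiltonian_def by (metis hom_bound)

section \<open>Lie series\<close>

text \<open>The Taylor coefficients at \<open>\<lambda> = 0\<close> of the solution of \<open>dA/d\<lambda> = {A, W(\<lambda>)}\<close>, \<open>A(0) = X\<close>, where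
  \<open>W(\<lambda>) = \<Sum>\<^sub>n \<lambda>\<^sup>n W\<^sub>n\<close>.\<close>

fun lie_series :: "nat \<Rightarrow> (nat \<Rightarrow> hpoly) \<Rightarrow> hpoly \<Rightarrow> nat \<Rightarrow> hpoly" where
  "lie_series K W X 0 = X"
| "lie_series K W X (Suc n) = Cst (1 / of_nat (Suc n)) * (\<Sum>i\<le>n. br K (lie_series K W X i) (W (n - i)))"

declare lie_series.simps(2) [simp del]

lemma lie_series_Suc: "Cst (of_nat (Suc n)) * lie_series K W X (Suc n) = (\<Sum>i\<le>n. br K (lie_series K W X i) (W (n - i)))"
proof -
  have "Cst (of_nat (Suc n)) * Cst (1 / of_nat (Suc n)) = 1"
    by (simp add: Cst_simps(2) flip: Cst_simps(4) del: of_nat_Suc)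
  then show ?thesis by (simp only: lie_series.simps mult.assoc[symmetric] mult_1_left)
qed

lemma lie_series_cong:
  assumes "\<And>i. i < n \<Longrightarrow> W i = W' i"
  shows "lie_series K W X n = lie_series K W' X n"
  using assms
proof (induction n rule: less_induct)
  case (less n)
  show ?case
  proof (cases n)
    case (Suc m)
    have "br K (lie_series K W X i) (W (m - i)) = br K (lie_series K W' X i) (W' (m - i))" if "i \<le> m" for i
      using less.IH[of i] less.prems that Suc by auto
    then show ?thesis unfolding Suc lie_series.simps by auto
  qed simp
qed

lemma lie_series_zero: "lie_series K W 0 n = 0"
proof (induction n rule: less_induct)
  case (less n)
  then show ?case by (cases n) (auto simp: lie_series.simps(2))
qed

text \<open>Threefold convolutions, nested in either way, are sums over this set; associativity and
  commutativity of convolution become permutations of triples.\<close>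

definition triples :: "nat \<Rightarrow> (nat \<times> nat \<times> nat) set" where
  "triples m = {(a, b, l). a + b + l = m}"

lemma triples_outer:
  fixes F :: "nat \<Rightarrow> nat \<Rightarrow> nat \<Rightarrow> 'a::comm_monoid_add"
  shows "(\<Sum>i\<le>m. \<Sum>a\<le>i. F a (i - a) (m - i)) = (\<Sum>(a, b, l)\<in>triples m. F a b l)"
  unfolding sum.Sigma[OF finite_atMost, of _ "\<lambda>i. {..i}", simplified]
  by (rule sum.reindex_bij_witness[of _ "\<lambda>(a, b, l). (a + b, a)" "\<lambda>(i, a). (a, i - a, m - i)"])
    (auto simp: triples_def)

lemma triples_inner:
  fixes F :: "nat \<Rightarrow> nat \<Rightarrow> nat \<Rightarrow> 'a::comm_monoid_add"
  shows "(\<Sum>i\<le>m. \<Sum>b\<le>m - i. F i b (m - i - b)) = (\<Sum>(a, b, l)\<in>triples m. F a b l)"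
  unfolding sum.Sigma[OF finite_atMost, of _ "\<lambda>i. {..m - i}", simplified]
  by (rule sum.reindex_bij_witness[of _ "\<lambda>(a, b, l). (a, b)" "\<lambda>(a, b). (a, b, m - a - b)"])
    (auto simp: triples_def)

lemma triples_swap_last:
  fixes F :: "nat \<Rightarrow> nat \<Rightarrow> nat \<Rightarrow> 'a::comm_monoid_add"
  shows "(\<Sum>(a, b, l)\<in>triples m. F a b l) = (\<Sum>(a, b, l)\<in>triples m. F a l b)"
  by (rule sum.reindex_bij_witness[of _ "\<lambda>(a, b, l). (a, l, b)" "\<lambda>(a, b, l). (a, l, b)"])
    (auto simp: triples_def)

lemma triples_swap_first:
  fixes F :: "nat \<Rightarrow> nat \<Rightarrow> nat \<Rightarrow> 'a::comm_monoid_add"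
  shows "(\<Sum>(a, b, l)\<in>triples m. F a b l) = (\<Sum>(a, b, l)\<in>triples m. F b a l)"
  by (rule sum.reindex_bij_witness[of _ "\<lambda>(a, b, l). (b, a, l)" "\<lambda>(a, b, l). (b, a, l)"])
    (auto simp: triples_def)

lemma Cst_Suc_cancel:
  assumes "Cst (of_nat (Suc n)) * p = Cst (of_nat (Suc n)) * q"
  shows "p = q"
proof -
  have "Cst (1 / of_nat (Suc n)) * Cst (of_nat (Suc n)) = 1"
    by (simp add: Cst_simps(2) flip: Cst_simps(4) del: of_nat_Suc)
  then show ?thesis using assms by (metis mult.assoc mult_1_left)
qed

text \<open>In terms of generating functions: if \<open>A\<close> and \<open>A'\<close> solve \<open>dA/d\<lambda> = {A, W}\<close>, then so does \<open>{A, A'}\<close>, by the Jacobi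
  identity.\<close>

lemma lie_series_br:
  "(\<Sum>i\<le>n. br K (lie_series K W X i) (lie_series K W Y (n - i))) = lie_series K W (br K X Y) n"
proof (induction n rule: less_induct)
  case (less n)
  show ?case
  proof (cases n)
    case (Suc m)
    let ?X = "lie_series K W X" and ?Y = "lie_series K W Y"
    have "Cst (of_nat (Suc m)) * (\<Sum>i\<le>Suc m. br K (?X i) (?Y (Suc m - i)))
      = (\<Sum>i\<le>Suc m. br K (Cst (of_nat i) * ?X i) (?Y (Suc m - i)))
      + (\<Sum>i\<le>Suc m. br K (?X i) (Cst (of_nat (Suc m - i)) * ?Y (Suc m - i)))"
      unfolding sum_distrib_left sum.distrib[symmetric] br_Cst_mult
    proof (intro sum.cong refl)
      fix i assume "i \<in> {..Suc m}"
      then have "Suc m = i + (Suc m - i)" by simp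
      then have "Cst (of_nat (Suc m)) = Cst (of_nat i) + Cst (of_nat (Suc m - i))"
        by (metis Cst_simps(3) of_nat_add)
      then show "Cst (of_nat (Suc m)) * br K (?X i) (?Y (Suc m - i)) = Cst (of_nat i) * br K (?X i) (?Y (Suc m - i)) +
         Cst (of_nat (Suc m - i)) * br K (?X i) (?Y (Suc m - i))"
        by (simp only: distrib_right)
    qed
    also have "(\<Sum>i\<le>Suc m. br K (Cst (of_nat i) * ?X i) (?Y (Suc m - i)))
      = (\<Sum>i\<le>m. br K (Cst (of_nat (Suc i)) * ?X (Suc i)) (?Y (m - i)))"
      unfolding sum.atMost_Suc_shift by (simp add: Cst_simps(1) del: of_nat_Suc)
    also have "\<dots> = (\<Sum>i\<le>m. \<Sum>a\<le>i. br K (br K (?X a) (W (i - a))) (?Y (m - i)))"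
      by (simp only: lie_series_Suc br_sum_left)
    also have "\<dots> = (\<Sum>(a, b, l)\<in>triples m. br K (br K (?X a) (W l)) (?Y b))"
      by (subst triples_outer[where F = "\<lambda>a b l. br K (br K (?X a) (W b)) (?Y l)"], subst triples_swap_last) (rule refl)
    also have "(\<Sum>i\<le>Suc m. br K (?X i) (Cst (of_nat (Suc m - i)) * ?Y (Suc m - i)))
      = (\<Sum>i\<le>m. br K (?X i) (Cst (of_nat (Suc (m - i))) * ?Y (Suc (m - i))))"
      unfolding sum.atMost_Suc by (simp add: Cst_simps(1) Suc_diff_le del: of_nat_Suc)
    also have "\<dots> = (\<Sum>i\<le>m. \<Sum>b\<le>m - i. br K (?X i) (br K (?Y b) (W (m - i - b))))"
      by (simp only: lie_series_Suc br_sum_right)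
    also have "\<dots> = (\<Sum>(a, b, l)\<in>triples m. br K (?X a) (br K (?Y b) (W l)))"
      by (rule triples_inner)
    also have "(\<Sum>(a, b, l)\<in>triples m. br K (br K (?X a) (W l)) (?Y b)) + \<dots>
      = (\<Sum>(a, b, l)\<in>triples m. br K (br K (?X a) (?Y b)) (W l))"
      unfolding sum.distrib[symmetric] by (intro sum.cong refl) (auto simp: br_jacobi[of K _ _ "W _"])
    also have "\<dots> = (\<Sum>i\<le>m. br K (\<Sum>a\<le>i. br K (?X a) (?Y (i - a))) (W (m - i)))"
      unfolding br_sum_left by (rule triples_outer[symmetric])
    also have "\<dots> = (\<Sum>i\<le>m. br K (lie_series K W (br K X Y) i) (W (m - i)))"
      by (intro sum.cong refl) (simp add: less.IH Suc)
    also have "\<dots> = Cst (of_nat (Suc m)) * lie_series K W (br K X Y) (Suc m)"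
      by (rule lie_series_Suc[symmetric])
    finally show ?thesis unfolding Suc by (rule Cst_Suc_cancel)
  qed simp
qed

text \<open>The derivative of the Lie series with respect to a parameter on which \<open>W\<close> depends, obtained by
  differentiating the recursion; \<open>W'\<close> is the derivative of \<open>W\<close>.\<close>

fun lie_series_deriv :: "nat \<Rightarrow> (nat \<Rightarrow> hpoly) \<Rightarrow> (nat \<Rightarrow> hpoly) \<Rightarrow> hpoly \<Rightarrow> nat \<Rightarrow> hpoly" where
  "lie_series_deriv K W W' X 0 = 0"
| "lie_series_deriv K W W' X (Suc n) = Cst (1 / of_nat (Suc n)) *
    (\<Sum>i\<le>n. br K (lie_series_deriv K W W' X i) (W (n - i)) + br K (lie_series K W X i) (W' (n - i)))"

declare lie_series_deriv.simps(2) [simp del]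

lemma lie_series_deriv_Suc: "Cst (of_nat (Suc n)) * lie_series_deriv K W W' X (Suc n) =
    (\<Sum>i\<le>n. br K (lie_series_deriv K W W' X i) (W (n - i)) + br K (lie_series K W X i) (W' (n - i)))"
proof -
  have "Cst (of_nat (Suc n)) * Cst (1 / of_nat (Suc n)) = 1"
    by (simp add: Cst_simps(2) flip: Cst_simps(4) del: of_nat_Suc)
  then show ?thesis by (simp only: lie_series_deriv.simps mult.assoc[symmetric] mult_1_left)
qed

lemma time_deriv_lie_series:
  assumes "\<And>i. i < n \<Longrightarrow> time_deriv (W i) (W' i)"
  shows "time_deriv (\<lambda>t. lie_series K (\<lambda>i. W i t) X n) (\<lambda>t. lie_series_deriv K (\<lambda>i. W i t) (\<lambda>i. W' i t) X n)"
  using assms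
proof (induction n rule: less_induct)
  case (less n)
  show ?case
  proof (cases n)
    case 0 then show ?thesis by (simp add: time_deriv_const)
  next
    case (Suc m)
    show ?thesis unfolding Suc lie_series.simps lie_series_deriv.simps
      by (intro time_deriv_Cst_mult time_deriv_sum time_deriv_br) (use less Suc in auto)
  qed
qed

text \<open>A resonant term \<open>\<rho>\<close> commutes with \<open>X\<close>, and by \<open>lie_series_br\<close> this survives the transformation: the Lie
  series of \<open>\<rho>\<close> commutes with that of \<open>X\<close> at every order.\<close>

lemma lie_series_commuting:
  assumes "\<And>m. m \<le> n \<Longrightarrow> br K X (\<rho> m) = 0"
  shows "(\<Sum>i\<le>n. br K (lie_series K W X i) (\<Sum>m\<le>n - i. lie_series K W (\<rho> m) (n - i - m))) = 0"
proof -
  have "(\<Sum>i\<le>n. br K (lie_series K W X i) (\<Sum>m\<le>n - i. lie_series K W (\<rho> m) (n - i - m)))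
    = (\<Sum>(a, b, l)\<in>triples n. br K (lie_series K W X a) (lie_series K W (\<rho> b) l))"
    unfolding br_sum_right by (rule triples_inner)
  also have "\<dots> = (\<Sum>m\<le>n. \<Sum>i\<le>n - m. br K (lie_series K W X i) (lie_series K W (\<rho> m) (n - m - i)))"
    by (subst triples_swap_first, rule triples_inner[symmetric])
  also have "\<dots> = (\<Sum>m\<le>n. lie_series K W (br K X (\<rho> m)) (n - m))"
    by (simp only: lie_series_br)
  also have "\<dots> = 0" using assms by (simp add: lie_series_zero)
  finally show ?thesis .
qed

text \<open>With generating functions the argument reads as follows. Let \<open>A\<close> solve \<open>dA/d\<lambda> = {A, W}\<close> and let
  \<open>\<partial>\<^sub>t W = Q - G - \<lambda> {W, G}\<close>. Then \<open>D = \<partial>\<^sub>t A + \<lambda> {A, G}\<close> satisfies \<open>dD/d\<lambda> = {D, W} + {A, Q}\<close> by the Jacobi identity.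
  Since \<open>{A, Q} = 0\<close> and \<open>D = 0\<close> for \<open>\<lambda> = 0\<close>, it follows that \<open>D = 0\<close>: the Lie series is conserved along
  the flow of \<open>\<lambda> G\<close>, order by order.\<close>

lemma lie_series_deriv_invariant:
  assumes W': "\<And>j. j < M \<Longrightarrow> W' j = Q j - (case j of 0 \<Rightarrow> G | Suc i \<Rightarrow> br K (W i) G)"
    and Q: "\<And>n. n < M \<Longrightarrow> (\<Sum>i\<le>n. br K (lie_series K W X i) (Q (n - i))) = 0"
    and n: "n \<le> M"
  shows "lie_series_deriv K W W' X n = - (case n of 0 \<Rightarrow> 0 | Suc m \<Rightarrow> br K (lie_series K W X m) G)"
  using n
proof (induction n rule: less_induct)
  case (less n)
  show ?case
  proof (cases n)
    case 0 then show ?thesis by simp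
  next
    case (Suc k)
    let ?E = "lie_series K W X"
    have "Cst (of_nat (Suc k)) * lie_series_deriv K W W' X (Suc k)
      = (\<Sum>i\<le>k. br K (lie_series_deriv K W W' X i) (W (k - i))) + (\<Sum>i\<le>k. br K (?E i) (W' (k - i)))"
      by (simp only: lie_series_deriv_Suc sum.distrib)
    also have "(\<Sum>i\<le>k. br K (?E i) (W' (k - i)))
      = (\<Sum>i\<le>k. br K (?E i) (Q (k - i))) - (\<Sum>i\<le>k. br K (?E i) (case k - i of 0 \<Rightarrow> G | Suc i \<Rightarrow> br K (W i) G))"
      unfolding sum_subtractf[symmetric]
      by (intro sum.cong refl) (use less.prems Suc in \<open>simp add: W' br_diff\<close>)
    also have "\<dots> = - (\<Sum>i\<le>k. br K (?E i) (case k - i of 0 \<Rightarrow> G | Suc i \<Rightarrow> br K (W i) G))"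
      using Q[of k] less.prems Suc by simp
    also have "(\<Sum>i\<le>k. br K (lie_series_deriv K W W' X i) (W (k - i)))
      = - (\<Sum>i\<le>k. br K (case i of 0 \<Rightarrow> 0 | Suc m \<Rightarrow> br K (?E m) G) (W (k - i)))"
      unfolding sum_negf[symmetric]
      by (intro sum.cong refl) (use less Suc in \<open>simp add: br_uminus\<close>)
    finally have 1: "Cst (of_nat (Suc k)) * lie_series_deriv K W W' X (Suc k) =
      - (\<Sum>i\<le>k. br K (case i of 0 \<Rightarrow> 0 | Suc m \<Rightarrow> br K (?E m) G) (W (k - i)))
      + - (\<Sum>i\<le>k. br K (?E i) (case k - i of 0 \<Rightarrow> G | Suc i \<Rightarrow> br K (W i) G))" .
    also have "\<dots> = - (Cst (of_nat (Suc k)) * br K (?E k) G)"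
    proof (cases k)
      case 0 then show ?thesis by (simp add: Cst_simps(2))
    next
      case (Suc m)
      have a: "(\<Sum>i\<le>k. br K (case i of 0 \<Rightarrow> 0 | Suc m \<Rightarrow> br K (?E m) G) (W (k - i)))
        = (\<Sum>i\<le>m. br K (br K (?E i) G) (W (m - i)))"
        unfolding Suc sum.atMost_Suc_shift by simp
      have b: "(\<Sum>i\<le>k. br K (?E i) (case k - i of 0 \<Rightarrow> G | Suc i \<Rightarrow> br K (W i) G))
        = (\<Sum>i\<le>m. br K (?E i) (br K (W (m - i)) G)) + br K (?E k) G"
        unfolding Suc sum.atMost_Suc by (simp add: Suc_diff_le)
      have "(\<Sum>i\<le>m. br K (br K (?E i) G) (W (m - i))) + (\<Sum>i\<le>m. br K (?E i) (br K (W (m - i)) G))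
        = (\<Sum>i\<le>m. br K (br K (?E i) (W (m - i))) G)"
        unfolding sum.distrib[symmetric] by (intro sum.cong refl) (simp add: br_jacobi[of K _ _ G])
      also have "\<dots> = br K (Cst (of_nat (Suc m)) * ?E k) G"
        unfolding Suc lie_series_Suc br_sum_left ..
      also have "\<dots> = Cst (of_nat k) * br K (?E k) G"
        by (simp only: br_Cst_mult Suc)
      finally have "(\<Sum>i\<le>m. br K (br K (?E i) G) (W (m - i))) + (\<Sum>i\<le>m. br K (?E i) (br K (W (m - i)) G))
        = Cst (of_nat k) * br K (?E k) G" .
      then have "(\<Sum>i\<le>m. br K (br K (?E i) G) (W (m - i))) + ((\<Sum>i\<le>m. br K (?E i) (br K (W (m - i)) G)) + br K (?E k) G)
        = Cst (of_nat (Suc k)) * br K (?E k) G"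
        by (simp add: Cst_simps(2,3) algebra_simps)
      then show ?thesis unfolding a b minus_add_distrib[symmetric] by (rule arg_cong)
    qed
    finally have "Cst (of_nat (Suc k)) * lie_series_deriv K W W' X (Suc k) = Cst (of_nat (Suc k)) * (- br K (?E k) G)"
      by simp
    from Cst_Suc_cancel[OF this] show ?thesis by (simp add: Suc)
  qed
qed

section \<open>The homological equation\<close>

text \<open>This is the nonresonance estimate. The only zero of \<open>e\<^bsup>i x\<^esup> - 1\<close> with \<open>|x| < 2\<pi>\<close> is the simple zero at the
  origin.\<close>

lemma cis_minus_one_lower:
  fixes c0 :: real
  assumes "0 < c0" "c0 < 2 * pi"
  shows "\<exists>\<kappa>>0. \<forall>x. \<bar>x\<bar> \<le> c0 \<longrightarrow> \<kappa> * \<bar>x\<bar> \<le> cmod (cis x - 1)"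
proof (intro exI conjI allI impI)
  have c4: "0 < cos (c0 / 4)" using assms by (intro cos_gt_zero_pi) auto
  then show "0 < (cos (c0 / 4))\<^sup>2" by simp
  fix x :: real assume x: "\<bar>x\<bar> \<le> c0"
  define y where "y = \<bar>x\<bar> / 4"
  have y: "0 \<le> y" "y \<le> c0 / 4" using x by (auto simp: y_def)
  have cosy: "cos (c0 / 4) \<le> cos y"
    using y assms by (intro cos_monotone_0_pi_le) auto
  have siny: "y * cos (c0 / 4) \<le> sin y"
  proof (cases "y = 0")
    case False
    then have "0 < y" using y by simp
    then obtain z where z: "0 < z" "z < y" "sin y - sin 0 = (y - 0) * cos z"
      using MVT2[of 0 y sin cos] by (auto intro: DERIV_sin)
    have "cos (c0 / 4) \<le> cos z"
      using y z assms by (intro cos_monotone_0_pi_le) auto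
    then show ?thesis using z \<open>0 < y\<close> by simp
  qed simp
  have siny0: "0 \<le> sin y"
    using siny mult_nonneg_nonneg[of y "cos (c0 / 4)"] y c4 by linarith
  have "(cmod (cis x - 1))\<^sup>2 = (cos x - 1)\<^sup>2 + (sin x)\<^sup>2"
    by (simp add: cmod_def)
  also have "\<dots> = 2 - 2 * cos x"
    using sin_cos_squared_add[of x] by (simp add: power2_eq_square algebra_simps)
  also have "cos x = cos (2 * (2 * y))" by (simp add: y_def)
  also have "2 - 2 * cos (2 * (2 * y)) = (2 * sin (2 * y))\<^sup>2"
    by (subst cos_double_sin) (simp add: power2_eq_square)
  also have "2 * sin (2 * y) = 4 * sin y * cos y" by (simp add: sin_double)
  finally have e: "(cmod (cis x - 1))\<^sup>2 = (4 * sin y * cos y)\<^sup>2" .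
  have "4 * (y * cos (c0 / 4)) * cos (c0 / 4) \<le> 4 * sin y * cos y"
    using siny siny0 cosy y c4 by (intro mult_mono) auto
  then have "(cos (c0 / 4))\<^sup>2 * \<bar>x\<bar> \<le> 4 * sin y * cos y"
    by (simp add: y_def power2_eq_square mult_ac)
  moreover have "4 * sin y * cos y \<ge> 0"
    using siny0 cosy c4 by auto
  then have "cmod (cis x - 1) = 4 * sin y * cos y"
    using e by (metis norm_ge_zero power2_eq_imp_eq)
  ultimately show "(cos (c0 / 4))\<^sup>2 * \<bar>x\<bar> \<le> cmod (cis x - 1)" by simp
qed

lemma increment_bound:
  fixes f :: "real \<Rightarrow> complex"
  assumes "a \<le> b" "\<And>t. a \<le> t \<Longrightarrow> t \<le> b \<Longrightarrow> (f has_vector_derivative f' t) (at t)"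
    "\<And>t. a \<le> t \<Longrightarrow> t \<le> b \<Longrightarrow> cmod (f' t) \<le> M"
  shows "cmod (f b - f a) \<le> M * (b - a)"
proof (cases "a = b")
  case False
  then have ab: "a < b" using assms by simp
  have cont: "continuous_on {a..b} f"
    using assms(2) by (intro continuous_at_imp_continuous_on ballI)
      (auto intro: has_vector_derivative_continuous)
  obtain x where x: "x \<in> {a<..<b}" "cmod (f b - f a) \<le> cmod ((b - a) *\<^sub>R f' x)"
    using mvt_general[OF ab cont, of "\<lambda>t h. h *\<^sub>R f' t"] assms(2)
    by (auto simp: has_vector_derivative_def)
  note x(2)
  also have "cmod ((b - a) *\<^sub>R f' x) \<le> (b - a) * M"
    using ab assms(3)[of x] x by (auto intro: mult_left_mono)
  finally show ?thesis by (simp add: mult.commute)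
qed simp

lemma antiderivative_everywhere:
  fixes c :: "real \<Rightarrow> complex"
  assumes "continuous_on UNIV c"
  obtains F where "\<And>t. (F has_vector_derivative c t) (at t)"
proof -
  have "\<exists>F. \<forall>x :: real. - \<infinity> < ereal x \<longrightarrow> ereal x < \<infinity> \<longrightarrow> (F has_vector_derivative c x) (at x)"
    using assms by (intro einterval_antiderivative) (auto simp: continuous_on_eq_continuous_at)
  then show ?thesis using that by auto
qed

lemma has_vector_derivative_shift:
  fixes f :: "real \<Rightarrow> complex"
  assumes "(f has_vector_derivative d) (at (t + p))"
  shows "((\<lambda>t. f (t + p)) has_vector_derivative d) (at t)"
proof -
  have "((\<lambda>t. t + p) has_vector_derivative 1) (at t)"
    by (auto intro!: derivative_eq_intros)
  from vector_diff_chain_at[OF this, of f d] assms show ?thesis by (simp add: o_def)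
qed

lemma zero_derivative_const:
  fixes f :: "real \<Rightarrow> complex"
  assumes "\<And>t. (f has_vector_derivative 0) (at t)"
  shows "f t = f u"
  using has_vector_derivative_zero_constant[of UNIV f] assms by (metis UNIV_I convex_UNIV)

text \<open>The constant of integration is chosen such that \<open>w\<close> inherits the quasi-periodicity. Then
  \<open>(z - 1) w(t)\<close> is the increment of \<open>w\<close> over one period, which bounds \<open>w\<close> uniformly for all times.\<close>

lemma quasi_periodic_antiderivative:
  fixes c :: "real \<Rightarrow> complex"
  assumes cont: "continuous_on UNIV c" and M: "\<And>t. cmod (c t) \<le> M"
    and qp: "\<And>t. c (t + real s) = z * c t" and z: "z \<noteq> 1"
  obtains w where "\<And>t. (w has_vector_derivative c t) (at t)" "\<And>t. w (t + real s) = z * w t"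
    "\<And>t. cmod (w t) \<le> real s * M / cmod (z - 1)"
proof -
  obtain F where F: "\<And>t. (F has_vector_derivative c t) (at t)"
    using antiderivative_everywhere[OF cont] by blast
  define C where "C = (F (0 + real s) - z * F 0) / (z - 1)"
  define w where "w = (\<lambda>t. F t + C)"
  have dw: "(w has_vector_derivative c t) (at t)" for t
    unfolding w_def by (auto intro!: derivative_eq_intros F)
  have inc: "F (t + real s) - z * F t = F (0 + real s) - z * F 0" for t
  proof (rule zero_derivative_const)
    fix t
    have "((\<lambda>t. F (t + real s) - z * F t) has_vector_derivative c (t + real s) - z * c t) (at t)"
      by (auto intro!: derivative_intros has_vector_derivative_shift F)
    then show "((\<lambda>t. F (t + real s) - z * F t) has_vector_derivative 0) (at t)" by (simp add: qp)
  qed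
  have C: "C * (z - 1) = F (0 + real s) - z * F 0" using z by (simp add: C_def)
  have wqp: "w (t + real s) = z * w t" for t
    using inc[of t] C unfolding w_def by algebra
  have "cmod (w t) \<le> real s * M / cmod (z - 1)" for t
  proof -
    have "cmod (w (t + real s) - w t) \<le> M * (t + real s - t)"
      by (rule increment_bound) (use dw M in auto)
    also have "w (t + real s) - w t = (z - 1) * w t" by (simp add: wqp algebra_simps)
    finally have "cmod (w t) * cmod (z - 1) \<le> real s * M" unfolding norm_mult by (simp add: mult.commute)
    then show ?thesis using z by (subst pos_le_divide_eq) auto
  qed
  then show ?thesis using that dw wqp by blast
qed

lemma periodic_shift_int:
  assumes "\<And>t. w (t + real s) = w t"
  shows "w (t + of_int n * real s) = w t"
proof (induction n rule: int_induct[where k = 0])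
  case (step1 i)
  then show ?case using assms[of "t + of_int i * real s"] by (simp add: algebra_simps)
next
  case (step2 i)
  then show ?case using assms[of "t + of_int (i - 1) * real s"] by (simp add: algebra_simps)
qed simp

text \<open>In the resonant case the mean \<open>r\<close> is an obstruction to a bounded antiderivative and has to be
  subtracted.\<close>

lemma periodic_antiderivative:
  fixes c :: "real \<Rightarrow> complex"
  assumes cont: "continuous_on UNIV c" and M: "\<And>t. cmod (c t) \<le> M"
    and per: "\<And>t. c (t + real s) = c t" and s: "s \<ge> 1"
  obtains w r where "\<And>t. (w has_vector_derivative c t - r) (at t)" "\<And>t. w (t + real s) = w t"
    "\<And>t. cmod (w t) \<le> real s * (2 * M)" "cmod r \<le> M"
proof -
  obtain F where F: "\<And>t. (F has_vector_derivative c t) (at t)"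
    using antiderivative_everywhere[OF cont] by blast
  have M0: "0 \<le> M" using M[of 0] norm_ge_zero order.trans by blast
  define r where "r = (F (0 + real s) - F 0) / of_nat s"
  define w where "w = (\<lambda>t. F t - F 0 - of_real t * r)"
  have dw: "(w has_vector_derivative c t - r) (at t)" for t
    unfolding w_def by (auto intro!: derivative_eq_intros F)
  have inc: "F (t + real s) - F t = F (0 + real s) - F 0" for t
  proof (rule zero_derivative_const)
    fix t
    have "((\<lambda>t. F (t + real s) - F t) has_vector_derivative c (t + real s) - c t) (at t)"
      by (auto intro!: derivative_intros has_vector_derivative_shift F)
    then show "((\<lambda>t. F (t + real s) - F t) has_vector_derivative 0) (at t)" by (simp add: per)
  qed
  have r: "of_nat s * r = F (0 + real s) - F 0" using s by (simp add: r_def)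
  have wp: "w (t + real s) = w t" for t
    using inc[of t] r unfolding w_def of_real_add of_real_of_nat_eq by algebra
  have "cmod (F (0 + real s) - F 0) \<le> M * (0 + real s - 0)"
    by (rule increment_bound) (use F M in auto)
  then have r: "cmod r \<le> M"
    using s by (simp add: r_def norm_divide divide_le_eq mult.commute)
  have "cmod (w t) \<le> real s * (2 * M)" for t
  proof -
    define u where "u = t + of_int (- \<lfloor>t / real s\<rfloor>) * real s"
    have u: "0 \<le> u" "u \<le> real s"
    proof -
      have "\<lfloor>t / real s\<rfloor> \<le> t / real s" "t / real s \<le> \<lfloor>t / real s\<rfloor> + 1" by linarith+
      then have "\<lfloor>t / real s\<rfloor> * real s \<le> t / real s * real s"
        "t / real s * real s \<le> (\<lfloor>t / real s\<rfloor> + 1) * real s"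
        by (intro mult_right_mono; simp)+
      moreover have "t / real s * real s = t" using s by simp
      ultimately show "0 \<le> u" "u \<le> real s" by (simp_all add: u_def algebra_simps)
    qed
    have "cmod (w u - w 0) \<le> (2 * M) * (u - 0)"
    proof (rule increment_bound)
      show "cmod (c t - r) \<le> 2 * M" for t
        using M[of t] r norm_triangle_ineq4[of "c t" r] by linarith
    qed (use u dw in auto)
    also have "\<dots> \<le> 2 * M * real s" using u M0 by (simp add: mult_left_mono)
    finally have "cmod (w u) \<le> 2 * M * real s" by (simp add: w_def)
    moreover have "w u = w t" unfolding u_def by (rule periodic_shift_int) (rule wp)
    ultimately show ?thesis by (simp add: mult_ac)
  qed
  then show ?thesis using that dw wp r by blast
qed

text \<open>For \<open>f \<noteq> 0\<close> the divisor is at least \<open>\<kappa> h |f|\<close>. The factor \<open>h\<close> cancels the one in the size \<open>h B\<close> of the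
  right-hand side, and \<open>|f|\<close> remains available to bound \<open>|f| |w|\<close>, which is the size of a coefficient of the bracket of the
  solution with the Sobolev form.\<close>

lemma homological_word:
  fixes c :: "real \<Rightarrow> complex" and f :: int
  assumes cont: "continuous_on UNIV c" and M: "\<And>t. cmod (c t) \<le> h * B"
    and qp: "\<And>t. c (t + real s) = cis (h * f) * c t" and s: "s \<ge> 1"
    and \<kappa>: "\<kappa> > 0" "\<And>x. \<bar>x\<bar> \<le> c0 \<Longrightarrow> \<kappa> * \<bar>x\<bar> \<le> cmod (cis x - 1)"
    and f: "\<bar>h * f\<bar> \<le> c0" and h: "0 < h" "h \<le> c0" and B: "0 \<le> B"
  shows "\<exists>w r. (\<forall>t. (w has_vector_derivative c t + r) (at t)) \<and> (\<forall>t. w (t + real s) = cis (h * f) * w t) \<and>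
    (\<forall>t. cmod (w t) \<le> real s * B / \<kappa> + 2 * c0 * real s * B) \<and>
    (\<forall>t. \<bar>of_int f\<bar> * cmod (w t) \<le> real s * B / \<kappa>) \<and> cmod r \<le> h * B \<and> (f \<noteq> 0 \<longrightarrow> r = 0)"
proof (cases "f = 0")
  case True
  obtain w r where wr: "\<And>t. (w has_vector_derivative c t - r) (at t)" "\<And>t. w (t + real s) = w t"
    "\<And>t. cmod (w t) \<le> real s * (2 * (h * B))" "cmod r \<le> h * B"
    using periodic_antiderivative[OF cont M _ s] qp True by auto
  have "real s * (2 * (h * B)) \<le> 2 * c0 * real s * B"
    using h B by (simp add: mult_left_mono mult_right_mono mult_ac)
  moreover have "0 \<le> real s * B / \<kappa>" using B \<kappa> by simp
  ultimately have "cmod (w t) \<le> real s * B / \<kappa> + 2 * c0 * real s * B" for t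
    using wr(3)[of t] by linarith
  then show ?thesis
    using wr True \<open>0 \<le> real s * B / \<kappa>\<close> by (intro exI[of _ w] exI[of _ "- r"]) auto
next
  case False
  have low: "\<kappa> * (h * \<bar>of_int f\<bar>) \<le> cmod (cis (h * f) - 1)"
    using \<kappa>(2)[OF f] h by (simp add: abs_mult)
  have pos: "0 < \<kappa> * (h * \<bar>of_int f\<bar>)" using False h \<kappa> by simp
  then have z: "cis (h * f) \<noteq> 1" using low by auto
  obtain w where w: "\<And>t. (w has_vector_derivative c t) (at t)" "\<And>t. w (t + real s) = cis (h * f) * w t"
    "\<And>t. cmod (w t) \<le> real s * (h * B) / cmod (cis (h * f) - 1)"
    using quasi_periodic_antiderivative[OF cont M qp z] by blast
  have 1: "\<bar>of_int f\<bar> * cmod (w t) \<le> real s * B / \<kappa>" for t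
  proof -
    have "cmod (w t) \<le> real s * (h * B) / (\<kappa> * (h * \<bar>of_int f\<bar>))"
      using w(3)[of t] by (rule order.trans, intro divide_left_mono[OF low] mult_pos_pos[OF _ pos]) (use B h z in auto)
    also have "\<dots> = real s * B / \<kappa> / \<bar>of_int f\<bar>" using h by simp
    finally have "cmod (w t) \<le> real s * B / \<kappa> / \<bar>of_int f\<bar>" .
    moreover have "0 < \<bar>real_of_int f\<bar>" using False by simp
    ultimately show ?thesis by (subst (asm) pos_le_divide_eq) (simp_all only: mult.commute)
  qed
  have "(1::real) \<le> \<bar>of_int f\<bar>" using False by linarith
  then have "1 * cmod (w t) \<le> \<bar>of_int f\<bar> * cmod (w t)" for t
    by (intro mult_right_mono) auto
  moreover have "0 \<le> 2 * c0 * real s * B" using h B by simp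
  ultimately have 2: "cmod (w t) \<le> real s * B / \<kappa> + 2 * c0 * real s * B" for t
    using 1[of t] by (smt (verit))
  show ?thesis
    by (intro exI[of _ w] exI[of _ 0]) (use w 1 2 h B False in auto)
qed

text \<open>A coefficient-wise application of \<open>homological_word\<close>. The degree is at most \<open>2N + 2\<close>, so the
  step-size restriction keeps \<open>h \<Omega>\<close> inside \<open>[- c0, c0]\<close> for every frequency \<open>\<Omega>\<close> that occurs.\<close>

lemma homological:
  assumes X: "hamiltonian K h s d (h * B) X" and s: "s \<ge> 1"
    and \<kappa>: "\<kappa> > 0" "\<And>x. \<bar>x\<bar> \<le> c0 \<Longrightarrow> \<kappa> * \<bar>x\<bar> \<le> cmod (cis x - 1)"
    and h: "0 < h" and B: "0 \<le> B" and K: "K \<ge> 1"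
    and cfl: "(real N + 1) * h * (real K)\<^sup>2 \<le> c0" and d: "d \<le> 2 * N + 2"
  shows "\<exists>W W' \<rho>. hamiltonian K h s d (real s * B / \<kappa> + 2 * c0 * real s * B) W \<and>
    hamiltonian K h s d (real s * B / \<kappa>) (\<lambda>t. br K (sobolev_form K) (W t)) \<and>
    hamiltonian K h s d (h * B) (\<lambda>t. \<rho>) \<and> br K (sobolev_form K) \<rho> = 0 \<and> time_deriv W W' \<and> (\<forall>t. W' t = X t + \<rho>)"
proof -
  obtain c where
    c: "\<And>t. X t = hom K d (c t)" "\<And>xs. xs\<in>words K d \<Longrightarrow> continuous_on UNIV (\<lambda>t. c t xs)" "\<And>t. balanced K d (h * B) (c t)"
      "\<And>t xs. xs\<in>words K d \<Longrightarrow> c (t + real s) xs = cis (h * frequency xs) * c t xs"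
    using X unfolding hamiltonian_def by metis
  have hc0: "h \<le> c0"
  proof -
    have "h * 1 \<le> h * ((real N + 1) * (real K)\<^sup>2)"
      using K h mult_mono[of 1 "real N + 1" 1 "(real K)\<^sup>2"] by (intro mult_left_mono) auto
    then show ?thesis using cfl by (simp add: mult_ac)
  qed
  define B' where "B' = real s * B / \<kappa> + 2 * c0 * real s * B"
  define good where "good = (\<lambda>xs w r. (\<forall>t. (w has_vector_derivative c t xs + r) (at t)) \<and> (\<forall>t. w (t + real s) = cis (h * frequency xs) * w t) \<and>
    (\<forall>t. cmod (w t) \<le> B') \<and>
    (\<forall>t. \<bar>of_int (frequency xs)\<bar> * cmod (w t) \<le> real s * B / \<kappa>) \<and> cmod r \<le> h * B \<and> (frequency xs \<noteq> 0 \<longrightarrow> r = 0) \<and>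
    (\<not> conserving K xs \<longrightarrow> r = 0 \<and> (\<forall>t. w t = 0)))"
  have B'0: "0 \<le> B'" using B \<kappa> h hc0 by (simp add: B'_def)
  have "\<exists>w r. good xs w r" if xs: "xs \<in> words K d" for xs
  proof (cases "conserving K xs")
    case True
    have "\<bar>2 * frequency xs\<bar> \<le> int d * (int K)\<^sup>2"
      using True by (intro frequency_bound[OF K xs]) (simp add: conserving_def)
    also have "\<dots> \<le> int (2 * N + 2) * (int K)\<^sup>2" using d by (intro mult_right_mono) auto
    finally have "\<bar>frequency xs\<bar> \<le> (int N + 1) * (int K)\<^sup>2" by (simp add: algebra_simps)
    then have "real_of_int \<bar>frequency xs\<bar> \<le> real_of_int ((int N + 1) * (int K)\<^sup>2)" by (rule of_int_le_iff[THEN iffD2])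
    then have fr: "\<bar>real_of_int (frequency xs)\<bar> \<le> (real N + 1) * (real K)\<^sup>2" by simp
    have f: "\<bar>h * frequency xs\<bar> \<le> c0"
    proof -
      have "\<bar>h * frequency xs\<bar> = h * \<bar>real_of_int (frequency xs)\<bar>" using h by (simp add: abs_mult)
      also have "\<dots> \<le> h * ((real N + 1) * (real K)\<^sup>2)" using h fr by (intro mult_left_mono) auto
      also have "\<dots> = (real N + 1) * h * (real K)\<^sup>2" by (simp add: mult_ac)
      finally show ?thesis using cfl by linarith
    qed
    have "\<exists>w r. (\<forall>t. (w has_vector_derivative c t xs + r) (at t)) \<and> (\<forall>t. w (t + real s) = cis (h * frequency xs) * w t) \<and>
      (\<forall>t. cmod (w t) \<le> B') \<and>
      (\<forall>t. \<bar>of_int (frequency xs)\<bar> * cmod (w t) \<le> real s * B / \<kappa>) \<and> cmod r \<le> h * B \<and> (frequency xs \<noteq> 0 \<longrightarrow> r = 0)"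
      unfolding B'_def
    proof (rule homological_word[OF c(2)[OF xs] _ c(4)[OF xs] s \<kappa> f h hc0 B])
      show "cmod (c t xs) \<le> h * B" for t using c(3)[of t] xs by (simp add: balanced_def)
    qed
    then show ?thesis using True unfolding good_def by blast
  next
    case False
    then have "c t xs = 0" for t using c(3)[of t] xs by (simp add: balanced_def)
    then have "good xs (\<lambda>t. 0) 0" using B'0 B \<kappa> h by (simp add: good_def)
    then show ?thesis by blast
  qed
  then have "\<exists>w. \<forall>xs\<in>words K d. \<exists>r. good xs (w xs) r" by (intro bchoice) auto
  then obtain w where "\<forall>xs\<in>words K d. \<exists>r. good xs (w xs) r" ..
  from bchoice[OF this] obtain r where g: "\<And>xs. xs \<in> words K d \<Longrightarrow> good xs (w xs) (r xs)" by blast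
  note g = g[unfolded good_def]
  define W where "W = (\<lambda>t. hom K d (\<lambda>xs. w xs t))"
  define W' where "W' = (\<lambda>t. hom K d (\<lambda>xs. c t xs + r xs))"
  define \<rho> where "\<rho> = hom K d r"
  have cw: "continuous_on UNIV (w xs)" if "xs \<in> words K d" for xs
    using g[OF that] by (auto intro!: continuous_at_imp_continuous_on intro: has_vector_derivative_continuous)
  have "hamiltonian K h s d B' W"
    unfolding hamiltonian_def W_def
    by (intro exI[of _ "\<lambda>t xs. w xs t"]) (use g cw in \<open>auto simp: balanced_def\<close>)
  moreover have "hamiltonian K h s d (real s * B / \<kappa>) (\<lambda>t. br K (sobolev_form K) (W t))"
  proof -
    have "br K (sobolev_form K) (W t) = hom K d (\<lambda>xs. - (\<i> * of_int (frequency xs) * w xs t))" for t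
      by (subst br_antisym) (simp add: W_def br_hom_sobolev_form hom_uminus)
    then show ?thesis
      unfolding hamiltonian_def
      by (intro exI[of _ "\<lambda>t xs. - (\<i> * of_int (frequency xs) * w xs t)"])
        (use g cw in \<open>auto simp: balanced_def norm_mult intro!: continuous_intros\<close>)
  qed
  moreover have "hamiltonian K h s d (h * B) (\<lambda>t. \<rho>)"
  proof -
    have "r xs = cis (h * frequency xs) * r xs" if "xs \<in> words K d" for xs
      using g[OF that] by (cases "frequency xs = 0") auto
    then show ?thesis
      unfolding hamiltonian_def \<rho>_def
      by (intro exI[of _ "\<lambda>t. r"]) (use g in \<open>auto simp: balanced_def\<close>)
  qed
  moreover have "br K (sobolev_form K) \<rho> = 0"
  proof -
    have "br K (sobolev_form K) \<rho> = - hom K d (\<lambda>xs. \<i> * of_int (frequency xs) * r xs)"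
      by (subst br_antisym) (simp add: \<rho>_def br_hom_sobolev_form)
    also have "hom K d (\<lambda>xs. \<i> * of_int (frequency xs) * r xs) = hom K d (\<lambda>xs. 0)"
      by (rule hom_cong) (use g in auto)
    finally show ?thesis by simp
  qed
  moreover have "time_deriv W W'"
    unfolding W_def W'_def by (rule time_deriv_hom) (use g in auto)
  moreover have "\<forall>t. W' t = X t + \<rho>"
    by (simp add: W'_def c(1) \<rho>_def hom_add)
  ultimately show ?thesis unfolding B'_def by blast
qed

section \<open>The almost-invariant\<close>

fun lie_bound :: "nat \<Rightarrow> real \<Rightarrow> nat \<Rightarrow> real" where
  "lie_bound e B 0 = 1"
| "lie_bound e B (Suc n) = (\<Sum>i\<le>n. 2 * real (Suc (e + 2 * i)) * real (Suc (2 * (n - i) + 3)) * lie_bound e B i * B)"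

declare lie_bound.simps(2) [simp del]

lemma lie_bound_nonneg: "B \<ge> 0 \<Longrightarrow> 0 \<le> lie_bound e B n"
proof (induction n rule: less_induct)
  case (less n)
  then show ?case by (cases n) (auto simp: lie_bound.simps(2) intro!: sum_nonneg mult_nonneg_nonneg)
qed

lemma cmod_inverse_Suc: "cmod (1 / of_nat (Suc n)) \<le> 1"
  by (simp add: norm_divide del: of_nat_Suc)

lemma hamiltonian_contract:
  assumes "hamiltonian K h s d B P" "cmod a \<le> 1" "B \<ge> 0"
  shows "hamiltonian K h s d B (\<lambda>t. Cst a * P t)"
  using hamiltonian_mono[OF hamiltonian_Cst_mult[OF assms(1), of a], of B] assms(2,3) by (simp add: mult_left_le_one_le)

lemma lie_series_hamiltonian:
  assumes "\<And>i. i < n \<Longrightarrow> hamiltonian K h s (2 * i + 4) B (W i)" "hamiltonian K h s (Suc e) A (\<lambda>t. X)" "A \<ge> 0" "B \<ge> 0"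
  shows "hamiltonian K h s (Suc (e + 2 * n)) (A * lie_bound e B n) (\<lambda>t. lie_series K (\<lambda>i. W i t) X n)"
  using assms(1)
proof (induction n rule: less_induct)
  case (less n)
  show ?case
  proof (cases n)
    case 0 then show ?thesis using assms by simp
  next
    case (Suc m)
    have "hamiltonian K h s (Suc (e + 2 * n)) (\<Sum>i\<le>m. 2 * real (Suc (e + 2 * i)) * real (Suc (2 * (m - i) + 3)) * (A * lie_bound e B i) * B)
       (\<lambda>t. \<Sum>i\<le>m. br K (lie_series K (\<lambda>i. W i t) X i) (W (m - i) t))"
    proof (rule hamiltonian_sum)
      fix i assume "i \<in> {..m}"
      then have i: "i \<le> m" by simp
      have "hamiltonian K h s (Suc (e + 2 * i)) (A * lie_bound e B i) (\<lambda>t. lie_series K (\<lambda>i. W i t) X i)"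
        using less i Suc by auto
      moreover have "hamiltonian K h s (Suc (2 * (m - i) + 3)) B (W (m - i))"
        using less.prems[of "m - i"] Suc by (simp add: eval_nat_numeral)
      ultimately have "hamiltonian K h s ((e + 2 * i) + (2 * (m - i) + 3))
         (2 * real (Suc (e + 2 * i)) * real (Suc (2 * (m - i) + 3)) * (A * lie_bound e B i) * B)
         (\<lambda>t. br K (lie_series K (\<lambda>i. W i t) X i) (W (m - i) t))"
        by (rule hamiltonian_br) (use assms lie_bound_nonneg in auto)
      moreover have "(e + 2 * i) + (2 * (m - i) + 3) = Suc (e + 2 * n)" using i Suc by simp
      ultimately show "hamiltonian K h s (Suc (e + 2 * n)) (2 * real (Suc (e + 2 * i)) * real (Suc (2 * (m - i) + 3)) * (A * lie_bound e B i) * B)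
         (\<lambda>t. br K (lie_series K (\<lambda>i. W i t) X i) (W (m - i) t))" by (simp only:)
    qed simp
    also have "(\<Sum>i\<le>m. 2 * real (Suc (e + 2 * i)) * real (Suc (2 * (m - i) + 3)) * (A * lie_bound e B i) * B) = A * lie_bound e B n"
      unfolding Suc lie_bound.simps sum_distrib_left by (intro sum.cong refl) (simp only: mult_ac)
    finally show ?thesis
      unfolding Suc lie_series.simps
      by (rule hamiltonian_contract) (use assms lie_bound_nonneg cmod_inverse_Suc in auto)
  qed
qed

fun form_bound :: "real \<Rightarrow> nat \<Rightarrow> real" where
  "form_bound B 0 = 0"
| "form_bound B (Suc n) = B + (\<Sum>i\<le>n. 2 * real (Suc (2 * i + 1)) * real (Suc (2 * (n - i) + 3)) * form_bound B i * B)"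

declare form_bound.simps(2) [simp del]

lemma form_bound_nonneg: "B \<ge> 0 \<Longrightarrow> 0 \<le> form_bound B n"
proof (induction n rule: less_induct)
  case (less n)
  then show ?case by (cases n) (auto simp: form_bound.simps(2) intro!: add_nonneg_nonneg sum_nonneg mult_nonneg_nonneg)
qed

text \<open>The Sobolev form itself has unbounded coefficients. Its first bracket with \<open>W\<close> is bounded by
  assumption, and all other brackets in the recursion are between members of the class.\<close>

lemma lie_series_sobolev_form_hamiltonian:
  assumes "\<And>i. i < n \<Longrightarrow> hamiltonian K h s (2 * i + 4) B (W i)"
    and "\<And>i. i < n \<Longrightarrow> hamiltonian K h s (2 * i + 4) B (\<lambda>t. br K (sobolev_form K) (W i t))" and B: "B \<ge> 0" and "n \<ge> 1"
  shows "hamiltonian K h s (2 * n + 2) (form_bound B n) (\<lambda>t. lie_series K (\<lambda>i. W i t) (sobolev_form K) n)"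
  using assms(1,2,4)
proof (induction n rule: less_induct)
  case (less n)
  then obtain m where Suc: "n = Suc m" by (cases n) auto
  let ?F = "\<lambda>i t. if i = 0 then 0 else br K (lie_series K (\<lambda>i. W i t) (sobolev_form K) i) (W (m - i) t)"
  have "hamiltonian K h s (2 * n + 2) (\<Sum>i\<le>m. 2 * real (Suc (2 * i + 1)) * real (Suc (2 * (m - i) + 3)) * form_bound B i * B)
     (\<lambda>t. \<Sum>i\<le>m. ?F i t)"
  proof (rule hamiltonian_sum)
    fix i assume "i \<in> {..m}"
    then have i: "i \<le> m" by simp
    show "hamiltonian K h s (2 * n + 2) (2 * real (Suc (2 * i + 1)) * real (Suc (2 * (m - i) + 3)) * form_bound B i * B) (?F i)"
    proof (cases "i = 0")
      case True then show ?thesis by (simp add: hamiltonian_zero)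
    next
      case False
      have "hamiltonian K h s (2 * i + 2) (form_bound B i) (\<lambda>t. lie_series K (\<lambda>i. W i t) (sobolev_form K) i)"
        using less i Suc False by auto
      then have "hamiltonian K h s (Suc (2 * i + 1)) (form_bound B i) (\<lambda>t. lie_series K (\<lambda>i. W i t) (sobolev_form K) i)" by simp
      moreover have "hamiltonian K h s (Suc (2 * (m - i) + 3)) B (W (m - i))"
        using less.prems(1)[of "m - i"] Suc by (simp add: eval_nat_numeral)
      ultimately have "hamiltonian K h s ((2 * i + 1) + (2 * (m - i) + 3))
         (2 * real (Suc (2 * i + 1)) * real (Suc (2 * (m - i) + 3)) * form_bound B i * B)
         (\<lambda>t. br K (lie_series K (\<lambda>i. W i t) (sobolev_form K) i) (W (m - i) t))"
        by (rule hamiltonian_br) (use B form_bound_nonneg in auto)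
      moreover have "(2 * i + 1) + (2 * (m - i) + 3) = 2 * n + 2" using i Suc by simp
      ultimately show ?thesis using False by (simp only: if_False)
    qed
  qed simp
  moreover have "hamiltonian K h s (2 * n + 2) B (\<lambda>t. br K (sobolev_form K) (W m t))"
  proof -
    have "2 * n + 2 = 2 * m + 4" using Suc by simp
    then show ?thesis using less.prems(2)[of m] Suc by (simp only: lessI)
  qed
  ultimately have "hamiltonian K h s (2 * n + 2) (form_bound B n) (\<lambda>t. br K (sobolev_form K) (W m t) + (\<Sum>i\<le>m. ?F i t))"
    unfolding Suc form_bound.simps by (intro hamiltonian_add)
  moreover have "br K (sobolev_form K) (W m t) + (\<Sum>i\<le>m. ?F i t) = (\<Sum>i\<le>m. br K (lie_series K (\<lambda>i. W i t) (sobolev_form K) i) (W (m - i) t))" for t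
    by (simp add: sum.atMost_shift)
  ultimately have "hamiltonian K h s (2 * n + 2) (form_bound B n) (\<lambda>t. \<Sum>i\<le>m. br K (lie_series K (\<lambda>i. W i t) (sobolev_form K) i) (W (m - i) t))"
    by simp
  then show ?case
    unfolding Suc lie_series.simps by (rule hamiltonian_contract) (use B form_bound_nonneg cmod_inverse_Suc in auto)
qed

text \<open>The equation for \<open>W'\<close> is the order \<open>m\<close> part of \<open>\<partial>\<^sub>t W = Q - G - \<lambda> {W, G}\<close>, where \<open>Q\<close> is the sum of the Lie
  series of the resonant terms \<open>\<lambda>\<^sup>i \<rho> i\<close>.\<close>

definition generator_upto where
  "generator_upto n B K h s G W W' \<rho> \<longleftrightarrow> (\<forall>m<n. hamiltonian K h s (2 * m + 4) B (W m) \<and>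
     hamiltonian K h s (2 * m + 4) B (\<lambda>t. br K (sobolev_form K) (W m t)) \<and>
     hamiltonian K h s (2 * m + 4) (h * B) (\<lambda>t. \<rho> m) \<and> br K (sobolev_form K) (\<rho> m) = 0 \<and> time_deriv (W m) (W' m) \<and>
     (\<forall>t. W' m t = (\<Sum>i\<le>m. lie_series K (\<lambda>i. W i t) (\<rho> i) (m - i)) - (case m of 0 \<Rightarrow> G t | Suc i \<Rightarrow> br K (W i t) (G t))))"

text \<open>At order \<open>n\<close> the unknowns \<open>W n\<close> and \<open>\<rho> n\<close> enter the equation only through \<open>W' n = \<rho> n + X\<close>, where \<open>X\<close> depends
  on lower orders. This is solved by \<open>homological\<close>, since \<open>X\<close> has degree \<open>2n + 4\<close> and size \<open>O(h)\<close>. The constant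
  \<open>B\<close> is chosen before \<open>K\<close>, \<open>h\<close> and \<open>G\<close>.\<close>

lemma generator_exists:
  fixes c0 \<beta> :: real
  assumes c0: "0 < c0" "c0 < 2 * pi" and s: "s \<ge> 1" and \<beta>: "\<beta> \<ge> 0" and n: "n \<le> N"
  shows "\<exists>B\<ge>0. \<forall>K h G. K \<ge> 1 \<longrightarrow> h > 0 \<longrightarrow> (real N + 1) * h * (real K)\<^sup>2 \<le> c0 \<longrightarrow>
    hamiltonian K h s 4 (h * \<beta>) G \<longrightarrow> (\<exists>W W' \<rho>. generator_upto n B K h s G W W' \<rho>)"
  using n
proof (induction n)
  case 0
  show ?case by (intro exI[of _ 0]) (auto simp: generator_upto_def)
next
  case (Suc n)
  obtain \<kappa> where \<kappa>: "\<kappa> > 0" "\<And>x. \<bar>x\<bar> \<le> c0 \<Longrightarrow> \<kappa> * \<bar>x\<bar> \<le> cmod (cis x - 1)"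
    using cis_minus_one_lower[OF c0] by blast
  obtain B where B: "B \<ge> 0" and ex: "\<And>K h G. K \<ge> 1 \<Longrightarrow> h > 0 \<Longrightarrow> (real N + 1) * h * (real K)\<^sup>2 \<le> c0 \<Longrightarrow>
    hamiltonian K h s 4 (h * \<beta>) G \<Longrightarrow> (\<exists>W W' \<rho>. generator_upto n B K h s G W W' \<rho>)"
    using Suc by (meson Suc_leD)
  define A where "A = (\<Sum>i<n. B * lie_bound (2 * i + 3) B (n - i)) + (\<beta> + 2 * real (Suc (2 * n + 1)) * real (Suc 3) * B * \<beta>)"
  define B1 where "B1 = real s * A / \<kappa> + 2 * c0 * real s * A"
  have A0: "A \<ge> 0" unfolding A_def using B \<beta> lie_bound_nonneg by (intro add_nonneg_nonneg sum_nonneg) auto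
  have B10: "real s * A / \<kappa> \<le> B1" "B1 \<ge> 0" using A0 c0 \<kappa> by (auto simp: B1_def)
  show ?case
  proof (intro exI[of _ "B + B1 + A"] conjI allI impI)
    show "0 \<le> B + B1 + A" using A0 B10 B by simp
    fix K h G
    assume K: "(1::nat) \<le> K" and h: "0 < h" and cfl: "(real N + 1) * h * (real K)\<^sup>2 \<le> c0"
      and G: "hamiltonian K h s 4 (h * \<beta>) G"
    obtain W W' \<rho> where gen: "generator_upto n B K h s G W W' \<rho>" using ex[OF K h cfl G] by blast
    note g = gen[unfolded generator_upto_def, rule_format]
    define X where "X = (\<lambda>t. (\<Sum>i<n. lie_series K (\<lambda>i. W i t) (\<rho> i) (n - i)) - (case n of 0 \<Rightarrow> G t | Suc i \<Rightarrow> br K (W i t) (G t)))"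
    have "hamiltonian K h s (2 * n + 4) (\<Sum>i<n. h * B * lie_bound (2 * i + 3) B (n - i)) (\<lambda>t. \<Sum>i<n. lie_series K (\<lambda>i. W i t) (\<rho> i) (n - i))"
    proof (rule hamiltonian_sum)
      fix i assume "i \<in> {..<n}"
      then have i: "i < n" by simp
      have "hamiltonian K h s (Suc ((2 * i + 3) + 2 * (n - i))) (h * B * lie_bound (2 * i + 3) B (n - i)) (\<lambda>t. lie_series K (\<lambda>i. W i t) (\<rho> i) (n - i))"
      proof (rule lie_series_hamiltonian)
        show "hamiltonian K h s (Suc (2 * i + 3)) (h * B) (\<lambda>t. \<rho> i)" using g[OF i] by (simp add: eval_nat_numeral)
      qed (use g i h B in auto)
      moreover have "Suc ((2 * i + 3) + 2 * (n - i)) = 2 * n + 4" using i by simp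
      ultimately show "hamiltonian K h s (2 * n + 4) (h * B * lie_bound (2 * i + 3) B (n - i)) (\<lambda>t. lie_series K (\<lambda>i. W i t) (\<rho> i) (n - i))"
        by (simp only:)
    qed simp
    moreover have "hamiltonian K h s (2 * n + 4) (h * (\<beta> + 2 * real (Suc (2 * n + 1)) * real (Suc 3) * B * \<beta>))
      (\<lambda>t. case n of 0 \<Rightarrow> G t | Suc i \<Rightarrow> br K (W i t) (G t))"
    proof (cases n)
      case 0
      have "h * \<beta> \<le> h * (\<beta> + 2 * real (Suc (2 * n + 1)) * real (Suc 3) * B * \<beta>)"
        using h B \<beta> by (intro mult_left_mono) auto
      then show ?thesis using hamiltonian_mono[OF G] 0 by simp
    next
      case (Suc i)
      have "hamiltonian K h s (Suc (2 * i + 3)) B (W i)" using g[of i] Suc by (simp add: eval_nat_numeral)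
      moreover have "hamiltonian K h s (Suc 3) (h * \<beta>) G" using G by (simp add: eval_nat_numeral)
      ultimately have 1: "hamiltonian K h s ((2 * i + 3) + 3) (2 * real (Suc (2 * i + 3)) * real (Suc 3) * B * (h * \<beta>)) (\<lambda>t. br K (W i t) (G t))"
        by (rule hamiltonian_br) (use B h \<beta> in auto)
      have "2 * real (Suc (2 * i + 3)) * real (Suc 3) * B * (h * \<beta>) = h * (2 * real (Suc (2 * n + 1)) * real (Suc 3) * B * \<beta>)"
        unfolding Suc by (simp only: mult_Suc_right add_Suc_right mult_ac) (simp add: algebra_simps)
      also have "\<dots> \<le> h * (\<beta> + 2 * real (Suc (2 * n + 1)) * real (Suc 3) * B * \<beta>)"
        using h \<beta> by (intro mult_left_mono) auto
      finally have "hamiltonian K h s ((2 * i + 3) + 3) (h * (\<beta> + 2 * real (Suc (2 * n + 1)) * real (Suc 3) * B * \<beta>)) (\<lambda>t. br K (W i t) (G t))"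
        by (rule hamiltonian_mono[OF 1])
      moreover have "(2 * i + 3) + 3 = 2 * n + 4" using Suc by simp
      ultimately show ?thesis unfolding Suc nat.case by (simp only:)
    qed
    ultimately have X: "hamiltonian K h s (2 * n + 4) (h * A) X"
    proof -
      assume a: "hamiltonian K h s (2 * n + 4) (\<Sum>i<n. h * B * lie_bound (2 * i + 3) B (n - i)) (\<lambda>t. \<Sum>i<n. lie_series K (\<lambda>i. W i t) (\<rho> i) (n - i))"
        and b: "hamiltonian K h s (2 * n + 4) (h * (\<beta> + 2 * real (Suc (2 * n + 1)) * real (Suc 3) * B * \<beta>))
          (\<lambda>t. case n of 0 \<Rightarrow> G t | Suc i \<Rightarrow> br K (W i t) (G t))"
      have "h * A = (\<Sum>i<n. h * B * lie_bound (2 * i + 3) B (n - i)) + h * (\<beta> + 2 * real (Suc (2 * n + 1)) * real (Suc 3) * B * \<beta>)"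
        unfolding A_def distrib_left[of h "sum _ _"] sum_distrib_left by (simp only: mult.assoc)
      then show ?thesis
        using hamiltonian_add[OF a hamiltonian_uminus[OF b]] by (simp only: X_def diff_conv_add_uminus)
    qed
    have "2 * n + 4 \<le> 2 * N + 2" using Suc.prems by simp
    from homological[OF X s \<kappa> h A0 K cfl this]
    obtain V V' \<sigma> where V: "hamiltonian K h s (2 * n + 4) B1 V"
      "hamiltonian K h s (2 * n + 4) (real s * A / \<kappa>) (\<lambda>t. br K (sobolev_form K) (V t))"
      "hamiltonian K h s (2 * n + 4) (h * A) (\<lambda>t. \<sigma>)" "br K (sobolev_form K) \<sigma> = 0" "time_deriv V V'" "\<And>t. V' t = X t + \<sigma>"
      unfolding B1_def by blast
    define U where "U = W(n := V)"
    define U' where "U' = W'(n := V')"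
    define \<tau> where "\<tau> = \<rho>(n := \<sigma>)"
    have cong: "lie_series K (\<lambda>i. U i t) Y k = lie_series K (\<lambda>i. W i t) Y k" if "k \<le> n" for k Y t
      by (rule lie_series_cong) (use that in \<open>simp add: U_def\<close>)
    have "generator_upto (Suc n) (B + B1 + A) K h s G U U' \<tau>"
      unfolding generator_upto_def
    proof (intro allI impI)
      fix m assume m: "m < Suc n"
      show "hamiltonian K h s (2 * m + 4) (B + B1 + A) (U m) \<and>
         hamiltonian K h s (2 * m + 4) (B + B1 + A) (\<lambda>t. br K (sobolev_form K) (U m t)) \<and>
         hamiltonian K h s (2 * m + 4) (h * (B + B1 + A)) (\<lambda>t. \<tau> m) \<and> br K (sobolev_form K) (\<tau> m) = 0 \<and> time_deriv (U m) (U' m) \<and>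
         (\<forall>t. U' m t = (\<Sum>i\<le>m. lie_series K (\<lambda>i. U i t) (\<tau> i) (m - i)) - (case m of 0 \<Rightarrow> G t | Suc i \<Rightarrow> br K (U i t) (G t)))"
      proof (cases "m = n")
        case True
        have e1: "(\<Sum>i\<le>n. lie_series K (\<lambda>i. U i t) (\<tau> i) (n - i)) = (\<Sum>i<n. lie_series K (\<lambda>i. W i t) (\<rho> i) (n - i)) + \<sigma>" for t
          unfolding lessThan_Suc_atMost[symmetric] sum.lessThan_Suc by (simp add: cong \<tau>_def)
        have e2: "(case n of 0 \<Rightarrow> G t | Suc i \<Rightarrow> br K (U i t) (G t)) = (case n of 0 \<Rightarrow> G t | Suc i \<Rightarrow> br K (W i t) (G t))" for t
          by (cases n) (simp_all add: U_def)
        have "h * A \<le> h * (B + B1 + A)" using h B B10 by (intro mult_left_mono) auto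
        then show ?thesis
          unfolding True e1 e2
          using V B A0 B10 by (auto simp: U_def U'_def \<tau>_def X_def algebra_simps intro: hamiltonian_mono)
      next
        case False
        then have m: "m < n" using m by simp
        have e1: "(\<Sum>i\<le>m. lie_series K (\<lambda>i. U i t) (\<tau> i) (m - i)) = (\<Sum>i\<le>m. lie_series K (\<lambda>i. W i t) (\<rho> i) (m - i))" for t
          using m by (intro sum.cong refl) (simp add: cong \<tau>_def)
        have e2: "(case m of 0 \<Rightarrow> G t | Suc i \<Rightarrow> br K (U i t) (G t)) = (case m of 0 \<Rightarrow> G t | Suc i \<Rightarrow> br K (W i t) (G t))" for t
          using m by (cases m) (simp_all add: U_def)
        have "h * B \<le> h * (B + B1 + A)" using h A0 B10 by (intro mult_left_mono) auto
        then show ?thesis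
          unfolding e1 e2
          using g[OF m] m B A0 B10 by (auto simp: U_def U'_def \<tau>_def intro: hamiltonian_mono)
      qed
    qed
    then show "\<exists>W W' \<rho>. generator_upto (Suc n) (B + B1 + A) K h s G W W' \<rho>" by blast
  qed
qed

text \<open>The Lie series of the Sobolev form is truncated after the term of index \<open>N - 1\<close>. By
  \<open>lie_series_deriv_invariant\<close> the total derivatives telescope, and what remains is the bracket of the last term
  with \<open>G\<close>. For \<open>N \<ge> 2\<close> the last term has bounded coefficients, so this bracket is of size \<open>O(h)\<close>; for the
  Sobolev form alone it would not be.\<close>

lemma almost_invariant:
  fixes c0 \<beta> :: real
  assumes c0: "0 < c0" "c0 < 2 * pi" and s: "s \<ge> 1" and \<beta>: "\<beta> \<ge> 0" and N: "N \<ge> 2"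
  shows "\<exists>B\<ge>0. \<forall>K h G. K \<ge> 1 \<longrightarrow> h > 0 \<longrightarrow> (real N + 1) * h * (real K)\<^sup>2 \<le> c0 \<longrightarrow>
    hamiltonian K h s 4 (h * \<beta>) G \<longrightarrow> (\<exists>E E'. time_deriv E E' \<and>
      (\<forall>t x. (\<Sum>i\<in>idxs K. cmod (x i)) \<le> 1 \<longrightarrow>
        cmod (ev (E t) x - ev (sobolev_form K) x) \<le> B * (\<Sum>i\<in>idxs K. cmod (x i)) ^ 4 \<and>
        cmod (ev (E' t + br K (E t) (G t)) x) \<le> h * B * (\<Sum>i\<in>idxs K. cmod (x i)) ^ (2 * N + 2)))"
proof -
  obtain B where B: "B \<ge> 0" and ex: "\<And>K h G. K \<ge> 1 \<Longrightarrow> h > 0 \<Longrightarrow> (real N + 1) * h * (real K)\<^sup>2 \<le> c0 \<Longrightarrow>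
    hamiltonian K h s 4 (h * \<beta>) G \<Longrightarrow> (\<exists>W W' \<rho>. generator_upto (N - 1) B K h s G W W' \<rho>)"
    using generator_exists[OF c0 s \<beta>, of "N - 1" N] by auto
  define B1 where "B1 = (\<Sum>n\<in>{1..<N}. form_bound B n)"
  define B2 where "B2 = 2 * real (Suc (2 * (N - 1) + 1)) * real (Suc 3) * form_bound B (N - 1) * \<beta>"
  have B1: "B1 \<ge> 0" unfolding B1_def using B form_bound_nonneg by (intro sum_nonneg) auto
  have B2: "B2 \<ge> 0" unfolding B2_def using B form_bound_nonneg \<beta> by auto
  show ?thesis
  proof (intro exI[of _ "B1 + B2"] conjI allI impI)
    show "0 \<le> B1 + B2" using B1 B2 by simp
    fix K h G
    assume K: "(1::nat) \<le> K" and h: "0 < h" and cfl: "(real N + 1) * h * (real K)\<^sup>2 \<le> c0"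
      and G: "hamiltonian K h s 4 (h * \<beta>) G"
    obtain W W' \<rho> where gen: "generator_upto (N - 1) B K h s G W W' \<rho>" using ex[OF K h cfl G] by blast
    note g = gen[unfolded generator_upto_def, rule_format]
    define En where "En = (\<lambda>n t. lie_series K (\<lambda>i. W i t) (sobolev_form K) n)"
    define En' where "En' = (\<lambda>n t. lie_series_deriv K (\<lambda>i. W i t) (\<lambda>i. W' i t) (sobolev_form K) n)"
    have En'_eq: "En' n t = - (case n of 0 \<Rightarrow> 0 | Suc m \<Rightarrow> br K (En m t) (G t))" if "n < N" for n t
      unfolding En_def En'_def
    proof (rule lie_series_deriv_invariant[where M = "N - 1" and Q = "\<lambda>j. \<Sum>i\<le>j. lie_series K (\<lambda>i. W i t) (\<rho> i) (j - i)"])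
      show "W' j t = (\<Sum>i\<le>j. lie_series K (\<lambda>i. W i t) (\<rho> i) (j - i)) - (case j of 0 \<Rightarrow> G t | Suc i \<Rightarrow> br K (W i t) (G t))"
        if "j < N - 1" for j using g[OF that] by blast
      show "(\<Sum>i\<le>k. br K (lie_series K (\<lambda>i. W i t) (sobolev_form K) i) (\<Sum>ia\<le>k - i. lie_series K (\<lambda>i. W i t) (\<rho> ia) (k - i - ia))) = 0"
        if "k < N - 1" for k by (rule lie_series_commuting) (use g that in auto)
    qed (use that in simp)
    define E where "E = (\<lambda>t. \<Sum>n<N. En n t)"
    define E' where "E' = (\<lambda>t. \<Sum>n<N. En' n t)"
    have D: "time_deriv E E'"
      unfolding E_def E'_def En_def En'_def
    proof (intro time_deriv_sum time_deriv_lie_series)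
      fix n i assume "n \<in> {..<N}" "i < n"
      then have "i < N - 1" by auto
      then show "time_deriv (W i) (W' i)" using g by blast
    qed simp
    have Nm: "N = Suc (N - 1)" using N by simp
    have rem: "E' t + br K (E t) (G t) = br K (En (N - 1) t) (G t)" for t
    proof -
      have "E' t = (\<Sum>n<N. - (case n of 0 \<Rightarrow> 0 | Suc m \<Rightarrow> br K (En m t) (G t)))"
        unfolding E'_def by (intro sum.cong refl) (simp add: En'_eq)
      also have "\<dots> = - (\<Sum>n<N - 1. br K (En n t) (G t))"
        by (subst Nm, subst sum.lessThan_Suc_shift) (simp add: sum_negf)
      finally have "E' t = - (\<Sum>n<N - 1. br K (En n t) (G t))" .
      moreover have "br K (E t) (G t) = (\<Sum>n<N - 1. br K (En n t) (G t)) + br K (En (N - 1) t) (G t)"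
        unfolding E_def br_sum_left by (subst Nm, subst sum.lessThan_Suc) simp
      ultimately show ?thesis by simp
    qed
    have EnH: "hamiltonian K h s (2 * n + 2) (form_bound B n) (En n)" if "n \<in> {1..<N}" for n
      unfolding En_def by (rule lie_series_sobolev_form_hamiltonian) (use g that B in auto)
    have remH: "hamiltonian K h s (2 * N + 2) (h * B2) (\<lambda>t. br K (En (N - 1) t) (G t))"
    proof -
      have "hamiltonian K h s (Suc (2 * (N - 1) + 1)) (form_bound B (N - 1)) (En (N - 1))"
        using EnH[of "N - 1"] N by auto
      moreover have "hamiltonian K h s (Suc 3) (h * \<beta>) G" using G by (simp add: eval_nat_numeral)
      ultimately have "hamiltonian K h s ((2 * (N - 1) + 1) + 3) (2 * real (Suc (2 * (N - 1) + 1)) * real (Suc 3) * form_bound B (N - 1) * (h * \<beta>)) (\<lambda>t. br K (En (N - 1) t) (G t))"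
        by (rule hamiltonian_br) (use B h \<beta> form_bound_nonneg in auto)
      moreover have "(2 * (N - 1) + 1) + 3 = 2 * N + 2" using N by simp
      moreover have "2 * real (Suc (2 * (N - 1) + 1)) * real (Suc 3) * form_bound B (N - 1) * (h * \<beta>) = h * B2"
        unfolding B2_def by (simp only: mult_ac)
      ultimately show ?thesis by (simp only:)
    qed
    have "cmod (ev (E t) x - ev (sobolev_form K) x) \<le> (B1 + B2) * (\<Sum>i\<in>idxs K. cmod (x i)) ^ 4 \<and>
      cmod (ev (E' t + br K (E t) (G t)) x) \<le> h * (B1 + B2) * (\<Sum>i\<in>idxs K. cmod (x i)) ^ (2 * N + 2)"
      if S: "(\<Sum>i\<in>idxs K. cmod (x i)) \<le> 1" for t x
    proof
      define S where "S = (\<Sum>i\<in>idxs K. cmod (x i))"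
      have S01: "0 \<le> S" "S \<le> 1" using S by (auto simp: S_def intro: sum_nonneg)
      have "{..<N} = insert 0 {1..<N}" using N by auto
      then have "ev (E t) x - ev (sobolev_form K) x = (\<Sum>n\<in>{1..<N}. ev (En n t) x)"
        by (simp add: E_def En_def)
      also have "cmod \<dots> \<le> (\<Sum>n\<in>{1..<N}. form_bound B n * S ^ 4)"
      proof (rule order.trans[OF norm_sum sum_mono])
        fix n assume n: "n \<in> {1..<N}"
        have "cmod (ev (En n t) x) \<le> form_bound B n * S ^ (2 * n + 2)"
          unfolding S_def by (rule hamiltonian_bound[OF EnH[OF n]])
        also have "\<dots> \<le> form_bound B n * S ^ 4"
          using n S01 B form_bound_nonneg by (intro mult_left_mono power_decreasing) auto
        finally show "cmod (ev (En n t) x) \<le> form_bound B n * S ^ 4" .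
      qed
      also have "\<dots> = B1 * S ^ 4" by (simp add: B1_def sum_distrib_right)
      also have "\<dots> \<le> (B1 + B2) * S ^ 4" using B2 S01 by (intro mult_right_mono) auto
      finally show "cmod (ev (E t) x - ev (sobolev_form K) x) \<le> (B1 + B2) * (\<Sum>i\<in>idxs K. cmod (x i)) ^ 4"
        unfolding S_def .
      have "cmod (ev (E' t + br K (E t) (G t)) x) \<le> h * B2 * S ^ (2 * N + 2)"
        unfolding rem S_def by (rule hamiltonian_bound[OF remH])
      also have "\<dots> \<le> h * (B1 + B2) * S ^ (2 * N + 2)"
        using B1 S01 h by (intro mult_right_mono mult_left_mono) auto
      finally show "cmod (ev (E' t + br K (E t) (G t)) x) \<le> h * (B1 + B2) * (\<Sum>i\<in>idxs K. cmod (x i)) ^ (2 * N + 2)"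
        unfolding S_def .
    qed
    with D show "\<exists>E E'. time_deriv E E' \<and>
      (\<forall>t x. (\<Sum>i\<in>idxs K. cmod (x i)) \<le> 1 \<longrightarrow>
        cmod (ev (E t) x - ev (sobolev_form K) x) \<le> (B1 + B2) * (\<Sum>i\<in>idxs K. cmod (x i)) ^ 4 \<and>
        cmod (ev (E' t + br K (E t) (G t)) x) \<le> h * (B1 + B2) * (\<Sum>i\<in>idxs K. cmod (x i)) ^ (2 * N + 2))"
      by blast
  qed
qed

section \<open>The splitting integrator in Fourier coefficients\<close>

definition dft :: "nat \<Rightarrow> (int \<Rightarrow> complex) \<Rightarrow> int \<Rightarrow> complex" where
  "dft K w j = (\<Sum>l\<in>modes K. w l * cis (- (real_of_int j * grid_pt K l))) / of_nat (2 * K)"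

lemma modes_diff_small: "i \<in> modes K \<Longrightarrow> j \<in> modes K \<Longrightarrow> \<bar>i - j\<bar> < 2 * int K"
  by (auto simp: modes_def)

lemma trig_poly_dft:
  assumes K: "K \<ge> 1" and l: "l \<in> modes K"
  shows "trig_poly K (dft K w) (grid_pt K l) = w l"
proof -
  have "trig_poly K (dft K w) (grid_pt K l) = (\<Sum>j\<in>modes K. \<Sum>m\<in>modes K.
     w m / of_nat (2 * K) * cis (pi * real_of_int (l - m) * real_of_int j / real K))"
    unfolding trig_poly_def dft_def sum_divide_distrib sum_distrib_right
    by (intro sum.cong refl) (simp add: grid_pt_def cis_mult field_simps diff_divide_distrib)
  also have "\<dots> = (\<Sum>m\<in>modes K. \<Sum>j\<in>modes K.
     w m / of_nat (2 * K) * cis (pi * real_of_int (l - m) * real_of_int j / real K))"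
    by (rule sum.swap)
  also have "\<dots> = (\<Sum>m\<in>modes K. if l = m then w m else 0)"
  proof (intro sum.cong refl)
    fix m assume "m \<in> modes K"
    then show "(\<Sum>j\<in>modes K. w m / of_nat (2 * K) * cis (pi * real_of_int (l - m) * real_of_int j / real K))
      = (if l = m then w m else 0)"
      unfolding sum_distrib_left[symmetric] using K l modes_diff_small[OF l]
      by (subst sum_cis_grid) auto
  qed
  finally show ?thesis using l by simp
qed

lemma dft_trig_poly:
  assumes K: "K \<ge> 1" and j: "j \<in> modes K"
  shows "dft K (\<lambda>l. trig_poly K c (grid_pt K l)) j = c j"
proof -
  have "dft K (\<lambda>l. trig_poly K c (grid_pt K l)) j = (\<Sum>l\<in>modes K. \<Sum>m\<in>modes K.
     c m / of_nat (2 * K) * cis (pi * real_of_int (m - j) * real_of_int l / real K))"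
    unfolding trig_poly_def dft_def sum_divide_distrib sum_distrib_right
    by (intro sum.cong refl) (simp add: grid_pt_def cis_mult field_simps diff_divide_distrib)
  also have "\<dots> = (\<Sum>m\<in>modes K. \<Sum>l\<in>modes K.
     c m / of_nat (2 * K) * cis (pi * real_of_int (m - j) * real_of_int l / real K))"
    by (rule sum.swap)
  also have "\<dots> = (\<Sum>m\<in>modes K. if m = j then c m else 0)"
  proof (intro sum.cong refl)
    fix m assume "m \<in> modes K"
    then show "(\<Sum>l\<in>modes K. c m / of_nat (2 * K) * cis (pi * real_of_int (m - j) * real_of_int l / real K))
      = (if m = j then c m else 0)"
      unfolding sum_distrib_left[symmetric] using K j modes_diff_small[OF _ j]
      by (subst sum_cis_grid) auto
  qed
  finally show ?thesis using j by simp
qed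

lemma trig_interp_dft:
  assumes "K \<ge> 1"
  shows "trig_interp K u = trig_poly K (dft K (\<lambda>l. u (grid_pt K l)))"
  unfolding trig_interp_def
  by (rule the1_equality[OF trig_interp_ex1[OF assms]])
    (auto simp: trig_space_def trig_poly_dft[OF assms])

definition rotated_grid :: "nat \<Rightarrow> real \<Rightarrow> (int \<Rightarrow> complex) \<Rightarrow> int \<Rightarrow> complex" where
  "rotated_grid K \<alpha> c l = cis (- (\<alpha> * (cmod (trig_poly K c (grid_pt K l)))\<^sup>2)) * trig_poly K c (grid_pt K l)"

lemma phiB_trig_poly:
  assumes "K \<ge> 1"
  shows "phiB K \<alpha> (trig_poly K c) = trig_poly K (dft K (rotated_grid K \<alpha> c))"
  by (simp add: phiB_def trig_interp_dft[OF assms] rotated_grid_def[abs_def])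

lemma trig_poly_cong: "(\<And>j. j \<in> modes K \<Longrightarrow> c j = c' j) \<Longrightarrow> trig_poly K c = trig_poly K c'"
  by (simp add: trig_poly_def)

lemma phiA_trig_poly:
  "phiA K \<alpha> (trig_poly K c) = trig_poly K (\<lambda>j. cis (- ((real_of_int j)\<^sup>2 * \<alpha>)) * c j)"
  unfolding phiA_def by (rule trig_poly_cong) (simp add: fourier_coeff_trig_poly)

text \<open>The Fourier coefficients after \<open>q\<close> factors \<open>\<phi>\<^sub>A \<circ> \<phi>\<^sub>B\<close>. The innermost factor of a step is applied first
  and has index \<open>s\<close>, hence the index \<open>s - q mod s\<close>.\<close>

fun stage :: "nat \<Rightarrow> nat \<Rightarrow> (nat \<Rightarrow> real) \<Rightarrow> (nat \<Rightarrow> real) \<Rightarrow> real \<Rightarrow> (int \<Rightarrow> complex) \<Rightarrow> nat \<Rightarrow> int \<Rightarrow> complex" where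
  "stage K s a b h c 0 = c"
| "stage K s a b h c (Suc q) = (\<lambda>j. cis (- ((real_of_int j)\<^sup>2 * (a (s - q mod s) * h))) *
     dft K (rotated_grid K (b (s - q mod s) * h) (stage K s a b h c q)) j)"

lemma phi_stage:
  assumes "K \<ge> 1"
  shows "phiA K (a (s - q mod s) * h) (phiB K (b (s - q mod s) * h) (trig_poly K (stage K s a b h c q)))
    = trig_poly K (stage K s a b h c (Suc q))"
  by (simp add: phiB_trig_poly[OF assms] phiA_trig_poly)

lemma splitting_step_stage:
  assumes K: "K \<ge> 1" and s: "s \<ge> 1"
  shows "splitting_step K s a b h (trig_poly K (stage K s a b h c (n * s))) = trig_poly K (stage K s a b h c (Suc n * s))"
proof -
  have "foldr (\<lambda>r \<Phi>. phiA K (a r * h) \<circ> phiB K (b r * h) \<circ> \<Phi>) [Suc (s - m)..<Suc s] id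
     (trig_poly K (stage K s a b h c (n * s))) = trig_poly K (stage K s a b h c (n * s + m))" if "m \<le> s" for m
    using that
  proof (induction m)
    case (Suc m)
    then have e: "[Suc (s - Suc m)..<Suc s] = (s - m) # [Suc (s - m)..<Suc s]"
      by (subst upt_conv_Cons) (auto simp: Suc_diff_Suc)
    have m: "(n * s + m) mod s = m" using Suc.prems by simp
    show ?case unfolding e using Suc phi_stage[OF K, of a s "n * s + m" h b c] by (simp add: m)
  qed simp
  from this[of s] show ?thesis by (simp add: splitting_step_def add.commute)
qed

lemma splitting_solution_stage:
  assumes "K \<ge> 1" "s \<ge> 1"
  shows "splitting_solution K s a b h (trig_poly K c) n = trig_poly K (stage K s a b h c (n * s))"
proof (induction n)
  case (Suc n)
  then show ?case using splitting_step_stage[OF assms, of a b h c n] by (simp add: splitting_solution_def)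
qed (simp add: splitting_solution_def)

section \<open>The interaction Hamiltonian\<close>

text \<open>The values at the grid points of \<open>\<psi>\<close> and of its conjugate, expressed in the rotated coefficients
  \<open>u\<^sub>j = e\<^bsup>i j\<^sup>2 \<sigma>\<^esup> \<psi>\<^sub>j\<close>.\<close>

definition grid_value :: "nat \<Rightarrow> real \<Rightarrow> int \<Rightarrow> hpoly" where
  "grid_value K \<sigma> l = (\<Sum>j\<in>modes K. Cst (cis (real_of_int j * grid_pt K l - (real_of_int j)\<^sup>2 * \<sigma>)) * Var (j, True))"
definition grid_conj :: "nat \<Rightarrow> real \<Rightarrow> int \<Rightarrow> hpoly" where
  "grid_conj K \<sigma> l = (\<Sum>j\<in>modes K. Cst (cis (- (real_of_int j * grid_pt K l - (real_of_int j)\<^sup>2 * \<sigma>))) * Var (j, False))"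

text \<open>When conjugate letters take conjugate values, this is \<open>g/2\<close> times the mean of
  \<open>|\<psi>|\<^sup>4\<close> over the grid. Its flow rotates each grid value with angular velocity \<open>g |\<psi>|\<^sup>2\<close>, which is the nonlinear
  substep run at speed \<open>g\<close>.\<close>

definition interaction :: "nat \<Rightarrow> real \<Rightarrow> real \<Rightarrow> hpoly" where
  "interaction K \<sigma> g = Cst (of_real g / 2 / of_nat (2 * K)) * (\<Sum>l\<in>modes K. grid_value K \<sigma> l * (grid_value K \<sigma> l * (grid_conj K \<sigma> l * grid_conj K \<sigma> l)))"

lemma pderiv_at_grid_value:
  assumes "j \<in> modes K"
  shows "pderiv_at (j, True) (grid_value K \<sigma> l) = Cst (cis (real_of_int j * grid_pt K l - (real_of_int j)\<^sup>2 * \<sigma>))"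
    "pderiv_at (j, False) (grid_value K \<sigma> l) = 0"
    "pderiv_at (j, False) (grid_conj K \<sigma> l) = Cst (cis (- (real_of_int j * grid_pt K l - (real_of_int j)\<^sup>2 * \<sigma>)))"
    "pderiv_at (j, True) (grid_conj K \<sigma> l) = 0"
proof -
  have "pderiv_at (j, True) (grid_value K \<sigma> l) = (\<Sum>i\<in>modes K. if i = j then Cst (cis (real_of_int j * grid_pt K l - (real_of_int j)\<^sup>2 * \<sigma>)) else 0)"
    unfolding grid_value_def pderiv_at_sum by (intro sum.cong refl) auto
  then show "pderiv_at (j, True) (grid_value K \<sigma> l) = Cst (cis (real_of_int j * grid_pt K l - (real_of_int j)\<^sup>2 * \<sigma>))"
    using assms by simp
  have "pderiv_at (j, False) (grid_conj K \<sigma> l) = (\<Sum>i\<in>modes K. if i = j then Cst (cis (- (real_of_int j * grid_pt K l - (real_of_int j)\<^sup>2 * \<sigma>))) else 0)"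
    unfolding grid_conj_def pderiv_at_sum by (intro sum.cong refl) auto
  then show "pderiv_at (j, False) (grid_conj K \<sigma> l) = Cst (cis (- (real_of_int j * grid_pt K l - (real_of_int j)\<^sup>2 * \<sigma>)))"
    using assms by simp
  show "pderiv_at (j, False) (grid_value K \<sigma> l) = 0" "pderiv_at (j, True) (grid_conj K \<sigma> l) = 0"
    by (simp_all add: grid_value_def grid_conj_def pderiv_at_sum)
qed

lemma ev_numeral [simp]: "ev (numeral n) x = numeral n"
proof -
  have "ev (of_nat k) x = of_nat k" for k by (induction k) simp_all
  from this[of "numeral n"] show ?thesis by simp
qed

lemma idxs_sum: "(\<Sum>i\<in>idxs K. F i) = (\<Sum>j\<in>modes K. F (j, True) + (F (j, False) :: 'a::comm_monoid_add))"
  unfolding idxs_def sum.cartesian_product' by (simp add: UNIV_bool add.commute)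

lemma pderiv_at_Cst_mult: "pderiv_at k (Cst a * p) = Cst a * pderiv_at k p" by simp

lemma ev_pderiv_at_interaction:
  assumes j: "j \<in> modes K" and Y: "\<And>l. l \<in> modes K \<Longrightarrow> ev (grid_value K \<sigma> l) x = v l"
    and Z: "\<And>l. l \<in> modes K \<Longrightarrow> ev (grid_conj K \<sigma> l) x = cnj (v l)"
  shows "ev (pderiv_at (j, False) (interaction K \<sigma> g)) x = of_real g * cis ((real_of_int j)\<^sup>2 * \<sigma>) * dft K (\<lambda>l. of_real ((cmod (v l))\<^sup>2) * v l) j"
    and "ev (pderiv_at (j, True) (interaction K \<sigma> g)) x = cnj (of_real g * cis ((real_of_int j)\<^sup>2 * \<sigma>) * dft K (\<lambda>l. of_real ((cmod (v l))\<^sup>2) * v l) j)"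
proof -
  have "ev (pderiv_at (j, False) (interaction K \<sigma> g)) x = of_real g / of_nat (2 * K) * (\<Sum>l\<in>modes K. v l * v l * cnj (v l) *
      cis (- (real_of_int j * grid_pt K l - (real_of_int j)\<^sup>2 * \<sigma>)))"
    unfolding interaction_def pderiv_at_Cst_mult pderiv_at_sum ev_simps ev_sum sum_distrib_left
    by (intro sum.cong refl) (simp add: pderiv_at_grid_value[OF j] Y Z)
  also have "(\<Sum>l\<in>modes K. v l * v l * cnj (v l) * cis (- (real_of_int j * grid_pt K l - (real_of_int j)\<^sup>2 * \<sigma>)))
    = cis ((real_of_int j)\<^sup>2 * \<sigma>) * (\<Sum>l\<in>modes K. of_real ((cmod (v l))\<^sup>2) * v l * cis (- (real_of_int j * grid_pt K l)))"
    unfolding sum_distrib_left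
  proof (intro sum.cong refl)
    fix l
    have "cis (- (real_of_int j * grid_pt K l - (real_of_int j)\<^sup>2 * \<sigma>)) = cis ((real_of_int j)\<^sup>2 * \<sigma>) * cis (- (real_of_int j * grid_pt K l))"
      by (simp add: cis_mult)
    then show "v l * v l * cnj (v l) * cis (- (real_of_int j * grid_pt K l - (real_of_int j)\<^sup>2 * \<sigma>)) =
      cis ((real_of_int j)\<^sup>2 * \<sigma>) * (of_real ((cmod (v l))\<^sup>2) * v l * cis (- (real_of_int j * grid_pt K l)))"
      by (simp only: complex_norm_square mult_ac)
  qed
  finally show 1: "ev (pderiv_at (j, False) (interaction K \<sigma> g)) x = of_real g * cis ((real_of_int j)\<^sup>2 * \<sigma>) * dft K (\<lambda>l. of_real ((cmod (v l))\<^sup>2) * v l) j"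
    by (simp add: dft_def)
  have "ev (pderiv_at (j, True) (interaction K \<sigma> g)) x = of_real g / of_nat (2 * K) * (\<Sum>l\<in>modes K. v l * cnj (v l) * cnj (v l) *
      cis (real_of_int j * grid_pt K l - (real_of_int j)\<^sup>2 * \<sigma>))"
    unfolding interaction_def pderiv_at_Cst_mult pderiv_at_sum ev_simps ev_sum sum_distrib_left
    by (intro sum.cong refl) (simp add: pderiv_at_grid_value[OF j] Y Z)
  also have "(\<Sum>l\<in>modes K. v l * cnj (v l) * cnj (v l) * cis (real_of_int j * grid_pt K l - (real_of_int j)\<^sup>2 * \<sigma>))
    = cnj (cis ((real_of_int j)\<^sup>2 * \<sigma>) * (\<Sum>l\<in>modes K. of_real ((cmod (v l))\<^sup>2) * v l * cis (- (real_of_int j * grid_pt K l))))"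
    unfolding sum_distrib_left cnj_sum
  proof (intro sum.cong refl)
    fix l
    have "cis (real_of_int j * grid_pt K l - (real_of_int j)\<^sup>2 * \<sigma>) = cnj (cis ((real_of_int j)\<^sup>2 * \<sigma>) * cis (- (real_of_int j * grid_pt K l)))"
      by (simp add: cis_mult cis_cnj)
    then show "v l * cnj (v l) * cnj (v l) * cis (real_of_int j * grid_pt K l - (real_of_int j)\<^sup>2 * \<sigma>) =
      cnj (cis ((real_of_int j)\<^sup>2 * \<sigma>) * (of_real ((cmod (v l))\<^sup>2) * v l * cis (- (real_of_int j * grid_pt K l))))"
      by (simp only: complex_norm_square complex_cnj_mult complex_cnj_cnj mult_ac)
  qed
  finally show "ev (pderiv_at (j, True) (interaction K \<sigma> g)) x = cnj (of_real g * cis ((real_of_int j)\<^sup>2 * \<sigma>) * dft K (\<lambda>l. of_real ((cmod (v l))\<^sup>2) * v l) j)"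
    by (simp add: dft_def)
qed

subsection \<open>Coefficients of the interaction Hamiltonian\<close>

definition value_coeff :: "nat \<Rightarrow> real \<Rightarrow> int \<Rightarrow> idx \<Rightarrow> complex" where
  "value_coeff K \<sigma> l i = (case i of (j, b) \<Rightarrow> if b then cis (real_of_int j * grid_pt K l - (real_of_int j)\<^sup>2 * \<sigma>) else 0)"
definition conj_coeff :: "nat \<Rightarrow> real \<Rightarrow> int \<Rightarrow> idx \<Rightarrow> complex" where
  "conj_coeff K \<sigma> l i = (case i of (j, b) \<Rightarrow> if b then 0 else cis (- (real_of_int j * grid_pt K l - (real_of_int j)\<^sup>2 * \<sigma>)))"

lemma grid_value_linear: "grid_value K \<sigma> l = (\<Sum>i\<in>idxs K. Cst (value_coeff K \<sigma> l i) * Var i)"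
  and grid_conj_linear: "grid_conj K \<sigma> l = (\<Sum>i\<in>idxs K. Cst (conj_coeff K \<sigma> l i) * Var i)"
  unfolding idxs_sum grid_value_def grid_conj_def
  by (simp_all add: value_coeff_def conj_coeff_def Cst_simps(1))

lemma linear_mult_hom:
  "(\<Sum>i\<in>idxs K. Cst (F i) * Var i) * hom K d c = hom K (Suc d) (\<lambda>xs. F (hd xs) * c (tl xs))"
  by (simp add: hom_Suc hom_scale sum_distrib_right mult.left_commute mult.assoc)

lemma linear_hom: "(\<Sum>i\<in>idxs K. Cst (F i) * Var i) = hom K (Suc 0) (\<lambda>xs. F (hd xs))"
  using linear_mult_hom[of F K 0 "\<lambda>xs. 1"] by (simp add: Cst_simps)

definition interaction_coeff :: "nat \<Rightarrow> real \<Rightarrow> real \<Rightarrow> idx list \<Rightarrow> complex" where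
  "interaction_coeff K \<sigma> g xs = (if map snd xs = [True, True, False, False] then
     of_real g * (cis (real_of_int (frequency xs) * \<sigma>) / 2 / of_nat (2 * K) * (\<Sum>l\<in>modes K. cis (real_of_int (momentum xs) * grid_pt K l))) else 0)"

lemma interaction_hom: "interaction K \<sigma> g = hom K 4 (interaction_coeff K \<sigma> g)"
proof -
  have "grid_value K \<sigma> l * (grid_value K \<sigma> l * (grid_conj K \<sigma> l * grid_conj K \<sigma> l)) = hom K 4
     (\<lambda>xs. value_coeff K \<sigma> l (hd xs) * (value_coeff K \<sigma> l (hd (tl xs)) * (conj_coeff K \<sigma> l (hd (tl (tl xs))) * conj_coeff K \<sigma> l (hd (tl (tl (tl xs)))))))" for l
  proof -
    have "(4::nat) = Suc (Suc (Suc (Suc 0)))" by simp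
    then show ?thesis
      unfolding grid_value_linear grid_conj_linear by (subst (4) linear_hom) (simp only: linear_mult_hom)
  qed
  then have "interaction K \<sigma> g = hom K 4 (\<lambda>xs. of_real g / 2 / of_nat (2 * K) * (\<Sum>l\<in>modes K.
    value_coeff K \<sigma> l (hd xs) * (value_coeff K \<sigma> l (hd (tl xs)) * (conj_coeff K \<sigma> l (hd (tl (tl xs))) * conj_coeff K \<sigma> l (hd (tl (tl (tl xs))))))))"
    unfolding interaction_def hom_scale by (simp add: hom_sum)
  also have "\<dots> = hom K 4 (interaction_coeff K \<sigma> g)"
  proof (rule hom_cong)
    fix xs assume "xs \<in> words K 4"
    then have "length xs = 4" by (simp add: words_def)
    then obtain j1 b1 j2 b2 j3 b3 j4 b4 where xs: "xs = [(j1, b1), (j2, b2), (j3, b3), (j4, b4)]"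
      by (auto simp: eval_nat_numeral length_Suc_conv)
    show "of_real g / 2 / of_nat (2 * K) * (\<Sum>l\<in>modes K.
      value_coeff K \<sigma> l (hd xs) * (value_coeff K \<sigma> l (hd (tl xs)) * (conj_coeff K \<sigma> l (hd (tl (tl xs))) * conj_coeff K \<sigma> l (hd (tl (tl (tl xs)))))))
      = interaction_coeff K \<sigma> g xs"
    proof (cases "b1 \<and> b2 \<and> \<not> b3 \<and> \<not> b4")
      case True
      have "value_coeff K \<sigma> l (hd xs) * (value_coeff K \<sigma> l (hd (tl xs)) * (conj_coeff K \<sigma> l (hd (tl (tl xs))) * conj_coeff K \<sigma> l (hd (tl (tl (tl xs)))))) =
        cis (real_of_int (frequency xs) * \<sigma>) * cis (real_of_int (momentum xs) * grid_pt K l)" for l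
        using True by (simp add: xs value_coeff_def conj_coeff_def cis_mult frequency_def momentum_def letter_sign_def algebra_simps)
      then show ?thesis using True by (simp add: interaction_coeff_def xs flip: sum_distrib_left)
    next
      case False
      then show ?thesis by (auto simp: interaction_coeff_def xs value_coeff_def conj_coeff_def)
    qed
  qed
  finally show ?thesis .
qed

text \<open>Applied to the product of four waves, this is the origin of momentum conservation modulo \<open>2K\<close>.\<close>

lemma sum_cis_grid_zero:
  assumes K: "K \<ge> 1" and m: "\<not> 2 * int K dvd m"
  shows "(\<Sum>l\<in>modes K. cis (real_of_int m * grid_pt K l)) = 0"
proof -
  define m' where "m' = m mod (2 * int K)"
  have "cis (real_of_int m * grid_pt K l) = cis (pi * real_of_int m' * real_of_int l / real K)" for l
  proof -
    have "m = 2 * int K * (m div (2 * int K)) + m'" by (simp add: m'_def)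
    then have "real_of_int m = real_of_int (2 * int K * (m div (2 * int K)) + m')" by (rule arg_cong)
    also have "\<dots> = 2 * real K * real_of_int (m div (2 * int K)) + real_of_int m'" by simp
    finally have "real_of_int m * grid_pt K l = 2 * pi * real_of_int ((m div (2 * int K)) * l) + pi * real_of_int m' * real_of_int l / real K"
      using K by (simp add: grid_pt_def field_simps)
    then show ?thesis by (simp add: cis_mult[symmetric] cis_multiple_2pi del: of_int_mult)
  qed
  moreover have "\<bar>m'\<bar> < 2 * int K" "m' \<noteq> 0" using K m by (auto simp: m'_def dvd_eq_mod_eq_0)
  ultimately show ?thesis using sum_cis_grid[OF K, of m'] by simp
qed

lemma interaction_coeff_balanced:
  assumes "K \<ge> 1" "\<bar>g\<bar> \<le> 2 * M"
  shows "balanced K 4 M (interaction_coeff K \<sigma> g)"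
  unfolding balanced_def
proof (intro ballI conjI impI)
  fix xs assume "xs \<in> words K 4"
  have "cmod (\<Sum>l\<in>modes K. cis (real_of_int (momentum xs) * grid_pt K l)) \<le> (\<Sum>l\<in>modes K. 1)"
    by (rule order.trans[OF norm_sum sum_mono]) simp
  also have "\<dots> = 2 * real K" by (simp add: modes_def)
  finally have "\<bar>g\<bar> * cmod (\<Sum>l\<in>modes K. cis (real_of_int (momentum xs) * grid_pt K l)) \<le> (2 * M) * (2 * real K)"
    using assms by (intro mult_mono) auto
  then show "cmod (interaction_coeff K \<sigma> g xs) \<le> M"
    using assms by (auto simp: interaction_coeff_def norm_mult norm_divide field_simps)
  assume ns: "\<not> conserving K xs"
  show "interaction_coeff K \<sigma> g xs = 0"
  proof (cases "map snd xs = [True, True, False, False]")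
    case True
    then obtain j1 j2 j3 j4 where xs: "xs = [(j1, True), (j2, True), (j3, False), (j4, False)]"
      by (auto simp: map_eq_Cons_conv)
    have "charge xs = 0" by (simp add: xs charge_def letter_sign_def)
    then have "\<not> 2 * int K dvd momentum xs" using ns by (simp add: conserving_def)
    then show ?thesis using sum_cis_grid_zero[OF assms(1)] by (simp add: interaction_coeff_def)
  qed (simp add: interaction_coeff_def)
qed

text \<open>Every nonlinear substep is run in unit time with the speed \<open>profile\<close>. It has mean one and vanishes at
  the integers, where the phases of the Hamiltonian jump, so the Hamiltonian is continuous in time.\<close>

definition profile :: "real \<Rightarrow> real" where "profile t = 1 - cos (2 * pi * t)"

lemma profile_bounds: "0 \<le> profile t" "profile t \<le> 2" by (simp_all add: profile_def)

lemma profile_of_int [simp]: "profile (of_int n) = 0"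
proof -
  have "cos (2 * pi * real_of_int n) = 1" by (simp add: cos_one_2pi_int mult_ac)
  then show ?thesis by (simp add: profile_def)
qed

lemma profile_periodic: "profile (t + real s) = profile t"
proof -
  have "cos (2 * pi * t + 2 * pi * real_of_int (int s)) = cos (2 * pi * t)"
    by (subst cos_add) (simp only: cos_int_2pin sin_int_2pin mult_1_right mult_zero_right diff_zero)
  then show ?thesis by (simp add: profile_def algebra_simps)
qed

lemma continuous_profile: "isCont profile t"
  unfolding profile_def[abs_def] by (intro continuous_intros)

text \<open>Away from the integers \<open>F \<lfloor>t\<rfloor>\<close> is locally constant; at the integers the vanishing profile outweighs the
  bounded jump.\<close>

lemma profile_floor_continuous:
  fixes F :: "int \<Rightarrow> complex"
  assumes "\<And>q. cmod (F q) \<le> M"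
  shows "continuous_on UNIV (\<lambda>t. of_real (profile t) * F \<lfloor>t\<rfloor>)"
proof (intro continuous_at_imp_continuous_on ballI)
  fix t :: real
  show "isCont (\<lambda>t. of_real (profile t) * F \<lfloor>t\<rfloor>) t"
  proof (cases "of_int \<lfloor>t\<rfloor> = t")
    case True
    then have p: "profile t = 0" by (metis profile_of_int)
    have "((\<lambda>u. of_real (profile u) * F \<lfloor>u\<rfloor>) \<longlongrightarrow> 0) (at t)"
    proof (rule Lim_null_comparison)
      show "\<forall>\<^sub>F u in at t. cmod (of_real (profile u) * F \<lfloor>u\<rfloor>) \<le> profile u * M"
        using assms profile_bounds by (intro always_eventually allI) (auto simp: norm_mult intro!: mult_left_mono)
      have "((\<lambda>u. profile u * M) \<longlongrightarrow> profile t * M) (at t)"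
        using continuous_profile[of t] by (intro tendsto_intros) (simp add: isCont_def)
      then show "((\<lambda>u. profile u * M) \<longlongrightarrow> 0) (at t)" by (simp add: p)
    qed
    then show ?thesis by (simp add: isCont_def p)
  next
    case False
    then have "t \<in> {of_int \<lfloor>t\<rfloor><..<of_int \<lfloor>t\<rfloor> + 1}"
      using of_int_floor_le[of t] floor_correct[of t] by (auto simp: less_le)
    then have "\<forall>\<^sub>F u in nhds t. u \<in> {of_int \<lfloor>t\<rfloor><..<of_int \<lfloor>t\<rfloor> + 1}"
      by (intro eventually_nhds_in_open) auto
    then have ev: "\<forall>\<^sub>F u in nhds t. of_real (profile u) * F \<lfloor>u\<rfloor> = of_real (profile u) * F \<lfloor>t\<rfloor>"
    proof eventually_elim
      case (elim u)
      then have "\<lfloor>u\<rfloor> = \<lfloor>t\<rfloor>" by (auto intro!: floor_unique)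
      then show ?case by simp
    qed
    have "isCont (\<lambda>u. of_real (profile u) * F \<lfloor>t\<rfloor>) t"
      by (intro continuous_intros continuous_profile)
    then show ?thesis by (subst isCont_cong[OF ev])
  qed
qed

text \<open>Integer arguments, instead of natural ones, let the quasi-periodicity in time hold on the whole real line.\<close>

definition coupling :: "nat \<Rightarrow> (nat \<Rightarrow> real) \<Rightarrow> int \<Rightarrow> real" where
  "coupling s b q = b (s - nat (q mod int s))"

text \<open>The duration of the linear flow that precedes substep \<open>q\<close>.\<close>

definition elapsed :: "nat \<Rightarrow> (nat \<Rightarrow> real) \<Rightarrow> real \<Rightarrow> int \<Rightarrow> real" where
  "elapsed s a h q = h * (of_int (q div int s) + (\<Sum>r<nat (q mod int s). a (s - r)))"

definition timed_interaction :: "nat \<Rightarrow> nat \<Rightarrow> (nat \<Rightarrow> real) \<Rightarrow> (nat \<Rightarrow> real) \<Rightarrow> real \<Rightarrow> real \<Rightarrow> hpoly" where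
  "timed_interaction K s a b h t = interaction K (elapsed s a h \<lfloor>t\<rfloor>) (h * profile t * coupling s b \<lfloor>t\<rfloor>)"

lemma coupling_bound:
  assumes "s \<ge> 1" "\<forall>r\<in>{1..s}. \<bar>b r\<bar> \<le> \<beta>"
  shows "\<bar>coupling s b q\<bar> \<le> \<beta>"
proof -
  have "0 \<le> q mod int s" "q mod int s < int s" using assms by simp_all
  then have "s - nat (q mod int s) \<in> {1..s}" by auto
  then show ?thesis using assms by (simp add: coupling_def)
qed

lemma timed_interaction_hamiltonian:
  assumes K: "K \<ge> 1" and s: "s \<ge> 1" and h: "h > 0" and b: "\<forall>r\<in>{1..s}. \<bar>b r\<bar> \<le> \<beta>"
  shows "hamiltonian K h s 4 (h * \<beta>) (timed_interaction K s a b h)"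
  unfolding hamiltonian_def
proof (intro exI[of _ "\<lambda>t. interaction_coeff K (elapsed s a h \<lfloor>t\<rfloor>) (h * profile t * coupling s b \<lfloor>t\<rfloor>)"] conjI allI ballI)
  fix t
  show "timed_interaction K s a b h t = hom K 4 (interaction_coeff K (elapsed s a h \<lfloor>t\<rfloor>) (h * profile t * coupling s b \<lfloor>t\<rfloor>))"
    by (simp add: timed_interaction_def interaction_hom)
  have "h * profile t * \<bar>coupling s b \<lfloor>t\<rfloor>\<bar> \<le> h * 2 * \<beta>"
    using profile_bounds[of t] coupling_bound[OF s b, of "\<lfloor>t\<rfloor>"] h by (intro mult_mono) auto
  then have "\<bar>h * profile t * coupling s b \<lfloor>t\<rfloor>\<bar> \<le> 2 * (h * \<beta>)"
    using profile_bounds[of t] h by (simp add: abs_mult mult_ac)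
  then show "balanced K 4 (h * \<beta>) (interaction_coeff K (elapsed s a h \<lfloor>t\<rfloor>) (h * profile t * coupling s b \<lfloor>t\<rfloor>))"
    by (rule interaction_coeff_balanced[OF K])
next
  fix t :: real and xs assume "xs \<in> words K 4"
  have fl: "\<lfloor>t + real s\<rfloor> = \<lfloor>t\<rfloor> + int s" by linarith
  have "elapsed s a h (\<lfloor>t\<rfloor> + int s) = h + elapsed s a h \<lfloor>t\<rfloor>"
    using s by (simp add: elapsed_def algebra_simps)
  moreover have "coupling s b (\<lfloor>t\<rfloor> + int s) = coupling s b \<lfloor>t\<rfloor>"
    by (simp add: coupling_def)
  moreover have "cis (frequency xs * (h + elapsed s a h \<lfloor>t\<rfloor>)) = cis (h * frequency xs) * cis (frequency xs * elapsed s a h \<lfloor>t\<rfloor>)"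
    by (simp add: cis_mult algebra_simps)
  ultimately show "interaction_coeff K (elapsed s a h \<lfloor>t + real s\<rfloor>) (h * profile (t + real s) * coupling s b \<lfloor>t + real s\<rfloor>) xs =
    cis (h * frequency xs) * interaction_coeff K (elapsed s a h \<lfloor>t\<rfloor>) (h * profile t * coupling s b \<lfloor>t\<rfloor>) xs"
    unfolding fl profile_periodic interaction_coeff_def by simp
next
  fix xs assume xs: "xs \<in> words K 4"
  define F where "F = (\<lambda>q. interaction_coeff K (elapsed s a h q) (h * coupling s b q) xs)"
  have "cmod (F q) \<le> h * \<beta>" for q
  proof -
    have "\<bar>h * coupling s b q\<bar> \<le> h * \<beta>"
      using coupling_bound[OF s b, of q] h by (simp add: abs_mult)
    moreover have "0 \<le> h * \<beta>" using calculation by linarith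
    ultimately have "\<bar>h * coupling s b q\<bar> \<le> 2 * (h * \<beta>)" by linarith
    from interaction_coeff_balanced[OF K this] xs show ?thesis by (auto simp: F_def balanced_def)
  qed
  then have "continuous_on UNIV (\<lambda>t. of_real (profile t) * F \<lfloor>t\<rfloor>)" by (rule profile_floor_continuous)
  moreover have "of_real (profile t) * F \<lfloor>t\<rfloor> = interaction_coeff K (elapsed s a h \<lfloor>t\<rfloor>) (h * profile t * coupling s b \<lfloor>t\<rfloor>) xs" for t
    by (simp add: F_def interaction_coeff_def)
  ultimately show "continuous_on UNIV (\<lambda>t. interaction_coeff K (elapsed s a h \<lfloor>t\<rfloor>) (h * profile t * coupling s b \<lfloor>t\<rfloor>) xs)" by simp
qed

section \<open>Trajectories\<close>

definition profile_integral :: "nat \<Rightarrow> real \<Rightarrow> real" where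
  "profile_integral q t = t - real q - sin (2 * pi * t) / (2 * pi)"

text \<open>The rotated coefficients (and their conjugates) after the nonlinear flow has been run for the time
  \<open>\<alpha>\<close> within a substep that starts from \<open>c\<close>. The value \<open>0\<close> outside the modes makes the equation of motion
  hold for every letter.\<close>

definition trajectory :: "nat \<Rightarrow> real \<Rightarrow> (int \<Rightarrow> complex) \<Rightarrow> real \<Rightarrow> idx \<Rightarrow> complex" where
  "trajectory K \<sigma> c \<alpha> i = (case i of (j, b) \<Rightarrow> if j \<in> modes K then
     (let u = cis ((real_of_int j)\<^sup>2 * \<sigma>) * dft K (rotated_grid K \<alpha> c) j in if b then u else cnj u) else 0)"

lemma profile_integral_deriv: "(profile_integral q has_real_derivative profile t) (at t)"
  unfolding profile_integral_def[abs_def] profile_def by (auto intro!: derivative_eq_intros)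

lemma profile_integral_ends: "profile_integral q (real q) = 0" "profile_integral q (real q + 1) = 1"
proof -
  have "sin (2 * pi * real_of_int (int q)) = 0" by (simp only: sin_int_2pin)
  then have 1: "sin (2 * pi * real q) = 0" by simp
  have "sin (2 * pi * real_of_int (int q + 1)) = 0" by (simp only: sin_int_2pin)
  then have 2: "sin (2 * pi * (real q + 1)) = 0" by simp
  show "profile_integral q (real q) = 0" "profile_integral q (real q + 1) = 1" using 1 2 by (simp_all add: profile_integral_def)
qed

lemma trajectory_ev:
  assumes K: "K \<ge> 1" and l: "l \<in> modes K"
  shows "ev (grid_value K \<sigma> l) (trajectory K \<sigma> c \<alpha>) = rotated_grid K \<alpha> c l" "ev (grid_conj K \<sigma> l) (trajectory K \<sigma> c \<alpha>) = cnj (rotated_grid K \<alpha> c l)"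
proof -
  have c: "cis (real_of_int j * grid_pt K l - (real_of_int j)\<^sup>2 * \<sigma>) * cis ((real_of_int j)\<^sup>2 * \<sigma>) = cis (real_of_int j * grid_pt K l)" for j
    by (simp add: cis_mult)
  have "ev (grid_value K \<sigma> l) (trajectory K \<sigma> c \<alpha>) = trig_poly K (dft K (rotated_grid K \<alpha> c)) (grid_pt K l)"
    unfolding grid_value_def trig_poly_def ev_sum
  proof (intro sum.cong refl)
    fix j assume j: "j \<in> modes K"
    have "ev (Cst (cis (real_of_int j * grid_pt K l - (real_of_int j)\<^sup>2 * \<sigma>)) * Var (j, True)) (trajectory K \<sigma> c \<alpha>)
      = (cis (real_of_int j * grid_pt K l - (real_of_int j)\<^sup>2 * \<sigma>) * cis ((real_of_int j)\<^sup>2 * \<sigma>)) * dft K (rotated_grid K \<alpha> c) j"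
      using j by (simp add: trajectory_def mult.assoc)
    also have "\<dots> = dft K (rotated_grid K \<alpha> c) j * cis (real_of_int j * grid_pt K l)"
      unfolding c by (rule mult.commute)
    finally show "ev (Cst (cis (real_of_int j * grid_pt K l - (real_of_int j)\<^sup>2 * \<sigma>)) * Var (j, True)) (trajectory K \<sigma> c \<alpha>)
      = dft K (rotated_grid K \<alpha> c) j * cis (real_of_int j * grid_pt K l)" .
  qed
  then show Y: "ev (grid_value K \<sigma> l) (trajectory K \<sigma> c \<alpha>) = rotated_grid K \<alpha> c l" by (simp add: trig_poly_dft[OF K l])
  have "ev (grid_conj K \<sigma> l) (trajectory K \<sigma> c \<alpha>) = cnj (ev (grid_value K \<sigma> l) (trajectory K \<sigma> c \<alpha>))"
    unfolding grid_value_def grid_conj_def ev_sum cnj_sum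
    by (intro sum.cong refl) (simp add: trajectory_def Let_def cis_cnj)
  then show "ev (grid_conj K \<sigma> l) (trajectory K \<sigma> c \<alpha>) = cnj (rotated_grid K \<alpha> c l)" by (simp add: Y)
qed

lemma rotated_grid_deriv:
  assumes "(\<alpha> has_real_derivative g) (at t)"
  shows "((\<lambda>t. rotated_grid K (\<alpha> t) c l) has_vector_derivative
    - \<i> * of_real g * (of_real ((cmod (rotated_grid K (\<alpha> t) c l))\<^sup>2) * rotated_grid K (\<alpha> t) c l)) (at t)"
proof -
  define v where "v = trig_poly K c (grid_pt K l)"
  define n where "n = (cmod v)\<^sup>2"
  have 1: "((\<lambda>t. - (\<alpha> t * n)) has_vector_derivative - (g * n)) (at t)"
    using assms by (auto intro!: derivative_eq_intros simp: has_real_derivative_iff_has_vector_derivative[symmetric])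
  have 2: "(cis has_vector_derivative \<i> * cis y) (at y)" for y
  proof -
    have "((\<lambda>x. exp (\<i> * of_real x)) has_vector_derivative \<i> * exp (\<i> * of_real y)) (at y)"
      by (rule has_vector_derivative_real_field[of "\<lambda>z. exp (\<i> * z)"]) (auto intro!: derivative_eq_intros)
    then show ?thesis by (simp add: cis_conv_exp[abs_def])
  qed
  from vector_diff_chain_at[OF 1 2]
  have 3: "((\<lambda>t. cis (- (\<alpha> t * n))) has_vector_derivative (- (g * n)) *\<^sub>R (\<i> * cis (- (\<alpha> t * n)))) (at t)"
    by (simp add: o_def)
  have "((\<lambda>t. cis (- (\<alpha> t * n)) * v) has_vector_derivative (- (g * n)) *\<^sub>R (\<i> * cis (- (\<alpha> t * n))) * v) (at t)"
    by (rule has_vector_derivative_mult_left[OF 3])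
  moreover have "(- (g * n)) *\<^sub>R (\<i> * cis (- (\<alpha> t * n))) * v = - \<i> * of_real g * (of_real ((cmod (cis (- (\<alpha> t * n)) * v))\<^sup>2) * (cis (- (\<alpha> t * n)) * v))"
    by (simp add: scaleR_conv_of_real norm_mult n_def mult_ac)
  ultimately show ?thesis unfolding rotated_grid_def v_def n_def by simp
qed

lemma dft_deriv:
  assumes "\<And>l. l \<in> modes K \<Longrightarrow> ((\<lambda>t. w t l) has_vector_derivative a * w' l) (at t)"
  shows "((\<lambda>t. dft K (w t) j) has_vector_derivative a * dft K w' j) (at t)"
proof -
  have "((\<lambda>t. dft K (w t) j) has_vector_derivative
     (\<Sum>l\<in>modes K. a * w' l * cis (- (real_of_int j * grid_pt K l))) / of_nat (2 * K)) (at t)"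
    unfolding dft_def by (intro has_vector_derivative_divide has_vector_derivative_sum has_vector_derivative_mult_left assms) auto
  then show ?thesis by (simp add: dft_def sum_distrib_left mult.assoc)
qed

text \<open>The nonlinear flow preserves the moduli of the grid values, so its phases are explicit and the
  equation of motion can be read off after a discrete Fourier transform.\<close>

lemma trajectory_ode:
  assumes K: "K \<ge> 1" and \<alpha>: "(\<alpha> has_real_derivative g) (at t)"
  shows "((\<lambda>t. trajectory K \<sigma> c (\<alpha> t) i) has_vector_derivative
    ev (br K (Var i) (interaction K \<sigma> g)) (trajectory K \<sigma> c (\<alpha> t))) (at t)"
proof -
  obtain j b where i: "i = (j, b)" by force
  show ?thesis
  proof (cases "j \<in> modes K")
    case False
    have "br K (Var (j, b)) (interaction K \<sigma> g) = Cst (- \<i>) * (\<Sum>k\<in>modes K. 0)"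
      unfolding br_def by (intro arg_cong2[where f = "(*)"] sum.cong refl) (use False in auto)
    then show ?thesis using False by (simp add: i trajectory_def)
  next
    case True
    define u where "u = (\<lambda>t. cis ((real_of_int j)\<^sup>2 * \<sigma>) * dft K (rotated_grid K (\<alpha> t) c) j)"
    define u' where "u' = of_real g * cis ((real_of_int j)\<^sup>2 * \<sigma>) *
      dft K (\<lambda>l. of_real ((cmod (rotated_grid K (\<alpha> t) c l))\<^sup>2) * rotated_grid K (\<alpha> t) c l) j"
    have "((\<lambda>t. u t) has_vector_derivative cis ((real_of_int j)\<^sup>2 * \<sigma>) *
      ((- \<i> * of_real g) * dft K (\<lambda>l. of_real ((cmod (rotated_grid K (\<alpha> t) c l))\<^sup>2) * rotated_grid K (\<alpha> t) c l) j)) (at t)"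
      unfolding u_def by (intro has_vector_derivative_mult_right dft_deriv rotated_grid_deriv \<alpha>)
    then have u: "(u has_vector_derivative - \<i> * u') (at t)" by (simp add: u'_def mult_ac)
    note pds = ev_pderiv_at_interaction[OF True, of \<sigma> "trajectory K \<sigma> c (\<alpha> t)" "rotated_grid K (\<alpha> t) c" g, OF trajectory_ev[OF K], folded u'_def]
    show ?thesis
    proof (cases b)
      case True
      have "(\<lambda>t. trajectory K \<sigma> c (\<alpha> t) i) = u" using \<open>j \<in> modes K\<close> True by (simp add: i trajectory_def u_def)
      then show ?thesis using u True \<open>j \<in> modes K\<close> by (simp add: i br_Var pds)
    next
      case False
      have "(\<lambda>t. trajectory K \<sigma> c (\<alpha> t) i) = (\<lambda>t. cnj (u t))" using \<open>j \<in> modes K\<close> False by (simp add: i trajectory_def u_def fun_eq_iff)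
      moreover have "((\<lambda>t. cnj (u t)) has_vector_derivative cnj (- \<i> * u')) (at t)"
        by (rule has_vector_derivative_cnj[OF u])
      ultimately show ?thesis using False \<open>j \<in> modes K\<close> by (simp add: i br_Var pds)
    qed
  qed
qed

definition sobolev_sq :: "nat \<Rightarrow> (idx \<Rightarrow> complex) \<Rightarrow> real" where
  "sobolev_sq K x = (\<Sum>j\<in>modes K. ((real_of_int j)\<^sup>2 + 1) * (cmod (x (j, True)))\<^sup>2)"

lemma sobolev_sq_nonneg: "0 \<le> sobolev_sq K x" unfolding sobolev_sq_def by (intro sum_nonneg) auto

lemma ev_sobolev_form:
  assumes "\<And>j. x (j, False) = cnj (x (j, True))"
  shows "ev (sobolev_form K) x = of_real (sobolev_sq K x)"
  unfolding sobolev_form_def sobolev_sq_def of_real_sum ev_sum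
proof (intro sum.cong refl)
  fix j :: int
  have "(of_int (j\<^sup>2 + 1) :: complex) = of_real ((real_of_int j)\<^sup>2 + 1)" by simp
  then show "ev (Cst (of_int (j\<^sup>2 + 1)) * (Var (j, True) * Var (j, False))) x
    = of_real (((real_of_int j)\<^sup>2 + 1) * (cmod (x (j, True)))\<^sup>2)"
    by (simp only: ev_simps assms of_real_mult complex_norm_square)
qed

text \<open>The term \<open>4 / K\<close> is there for the induction: passing from \<open>K\<close> to \<open>K + 1\<close> adds at most
  \<open>2 / (K\<^sup>2 + 1) \<le> 4 / K - 4 / (K + 1)\<close>.\<close>

lemma sum_inverse_modes:
  assumes "K \<ge> 1"
  shows "(\<Sum>j\<in>modes K. 1 / ((real_of_int j)\<^sup>2 + 1)) \<le> 6 - 4 / real K"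
  using assms
proof (induction K rule: nat_induct_at_least)
  case base
  have "modes 1 = {- 1, 0}" by (auto simp: modes_def)
  then show ?case by simp
next
  case (Suc K)
  note step = Suc
  have "modes (Suc K) = insert (- int K - 1) (insert (int K) (modes K))" by (auto simp: modes_def)
  then have "(\<Sum>j\<in>modes (Suc K). 1 / ((real_of_int j)\<^sup>2 + 1)) =
    1 / ((real_of_int (- int K - 1))\<^sup>2 + 1) + (1 / ((real K)\<^sup>2 + 1) + (\<Sum>j\<in>modes K. 1 / ((real_of_int j)\<^sup>2 + 1)))"
    using step by (subst \<open>modes (Suc K) = _\<close>) (subst sum.insert; auto simp: modes_def)+
  also have "1 / ((real_of_int (- int K - 1))\<^sup>2 + 1) \<le> 1 / ((real K)\<^sup>2 + 1)"
    by (intro divide_left_mono mult_pos_pos add_nonneg_pos zero_le_power2 zero_less_one)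
      (auto simp: power2_eq_square algebra_simps)
  also have "1 / ((real K)\<^sup>2 + 1) + (1 / ((real K)\<^sup>2 + 1) + (\<Sum>j\<in>modes K. 1 / ((real_of_int j)\<^sup>2 + 1)))
    \<le> 2 / ((real K)\<^sup>2 + 1) + (6 - 4 / real K)" using step by simp
  also have "2 / ((real K)\<^sup>2 + 1) \<le> 4 / (real K * (real K + 1))"
  proof -
    have "real K * (real K + 1) \<le> 2 * ((real K)\<^sup>2 + 1)"
      using zero_le_power2[of "real K - 1"] by (simp add: power2_eq_square algebra_simps)
    then have "4 / (2 * ((real K)\<^sup>2 + 1)) \<le> 4 / (real K * (real K + 1))"
      using step by (intro divide_left_mono mult_pos_pos add_nonneg_pos) auto
    moreover have "4 / (2 * ((real K)\<^sup>2 + 1)) = 2 / ((real K)\<^sup>2 + 1)"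
      by (subst mult_divide_mult_cancel_left[of 2 2, symmetric]) auto
    ultimately show ?thesis by (simp only:)
  qed
  also have "4 / (real K * (real K + 1)) = 4 / real K - 4 / (real K + 1)"
    using step by (simp add: field_simps)
  finally show ?case by (simp add: add.commute)
qed

text \<open>The embedding of \<open>H\<^sup>1\<close> into \<open>\<ell>\<^sup>1\<close>, by the Cauchy-Schwarz inequality. Each mode is counted twice, and
  \<open>2 sqrt 6 \<le> 5\<close>.\<close>

lemma sum_idxs_bound:
  assumes K: "K \<ge> 1" and x: "\<And>j. x (j, False) = cnj (x (j, True))"
  shows "(\<Sum>i\<in>idxs K. cmod (x i)) \<le> 5 * sqrt (sobolev_sq K x)"
proof -
  let ?w = "\<lambda>j. sqrt ((real_of_int j)\<^sup>2 + 1)"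
  have w: "?w j > 0" for j by (simp add: add_nonneg_pos)
  have "(\<Sum>i\<in>idxs K. cmod (x i)) = 2 * (\<Sum>j\<in>modes K. cmod (x (j, True)))"
    unfolding idxs_sum by (simp add: x sum_distrib_left)
  moreover have "(\<Sum>j\<in>modes K. cmod (x (j, True)))\<^sup>2 \<le> 6 * sobolev_sq K x"
  proof -
    have "(\<Sum>j\<in>modes K. cmod (x (j, True))) = (\<Sum>j\<in>modes K. (1 / ?w j) * (?w j * cmod (x (j, True))))"
      using w by (intro sum.cong refl) (simp add: less_imp_neq[symmetric] del: real_sqrt_eq_zero_cancel_iff)
    then have "(\<Sum>j\<in>modes K. cmod (x (j, True)))\<^sup>2 \<le> (\<Sum>j\<in>modes K. (1 / ?w j)\<^sup>2) * (\<Sum>j\<in>modes K. (?w j * cmod (x (j, True)))\<^sup>2)"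
      by (simp only: Cauchy_Schwarz_ineq_sum)
    also have "(\<Sum>j\<in>modes K. (?w j * cmod (x (j, True)))\<^sup>2) = sobolev_sq K x"
      unfolding sobolev_sq_def by (intro sum.cong refl) (simp add: power_mult_distrib)
    also have "(\<Sum>j\<in>modes K. (1 / ?w j)\<^sup>2) = (\<Sum>j\<in>modes K. 1 / ((real_of_int j)\<^sup>2 + 1))"
      by (intro sum.cong refl) (simp add: power_divide)
    also have "\<dots> * sobolev_sq K x \<le> 6 * sobolev_sq K x"
      using sum_inverse_modes[OF K] K by (intro mult_right_mono sobolev_sq_nonneg) (auto intro: order.trans)
    finally show ?thesis .
  qed
  ultimately have "(\<Sum>i\<in>idxs K. cmod (x i))\<^sup>2 \<le> (5 * sqrt (sobolev_sq K x))\<^sup>2"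
    using sobolev_sq_nonneg[of K x] by (simp add: power_mult_distrib)
  then show ?thesis by (rule power2_le_imp_le) (simp add: sobolev_sq_nonneg)
qed

lemma trajectory_real: "trajectory K \<sigma> c \<alpha> (j, False) = cnj (trajectory K \<sigma> c \<alpha> (j, True))"
  by (simp add: trajectory_def)

lemma sobolev_sq_trajectory_0:
  assumes "K \<ge> 1"
  shows "sobolev_sq K (trajectory K \<sigma> c 0) = (H1_norm (trig_poly K c))\<^sup>2"
proof -
  have "rotated_grid K 0 c = (\<lambda>l. trig_poly K c (grid_pt K l))" by (simp add: rotated_grid_def fun_eq_iff)
  then show ?thesis
    unfolding sobolev_sq_def H1_norm_trig_poly
    by (intro sum.cong refl) (simp add: trajectory_def norm_mult dft_trig_poly[OF assms])
qed

text \<open>When \<open>q + 1\<close> is a multiple of \<open>s\<close>, a full time step is completed, and the consistency condition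
  \<open>a\<^sub>1 + \<dots> + a\<^sub>s = 1\<close> is what makes its duration equal to \<open>h\<close>.\<close>

lemma elapsed_Suc:
  assumes s: "s \<ge> 1" and a: "(\<Sum>r=1..s. a r) = 1"
  shows "elapsed s a h (int q + 1) = elapsed s a h (int q) + h * a (s - q mod s)"
proof -
  have sh: "(\<Sum>r<s. a (s - r)) = 1"
  proof -
    have "(\<Sum>r<s. a (s - r)) = (\<Sum>r=1..s. a r)"
      by (rule sum.reindex_bij_witness[of _ "\<lambda>r. s - r" "\<lambda>r. s - r"]) auto
    then show ?thesis using a by simp
  qed
  have n: "int q div int s = int (q div s)" "nat (int q mod int s) = q mod s"
    "(int q + 1) div int s = int (Suc q div s)" "nat ((int q + 1) mod int s) = Suc q mod s"
    using zdiv_int[of q s] zdiv_int[of "Suc q" s] by (simp_all add: add.commute flip: zmod_int of_nat_Suc)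
  show ?thesis
  proof (cases "Suc (q mod s) = s")
    case True
    then have d: "Suc q div s = Suc (q div s)" "Suc q mod s = 0" by (simp_all add: div_Suc mod_Suc)
    have "(\<Sum>r<q mod s. a (s - r)) + a (s - q mod s) = 1"
    proof -
      have "(\<Sum>r<Suc (q mod s). a (s - r)) = 1" using sh by (simp only: True)
      then show ?thesis by (simp only: sum.lessThan_Suc)
    qed
    then have e: "(\<Sum>r<q mod s. a (s - r)) = 1 - a (s - q mod s)" by simp
    show ?thesis unfolding elapsed_def n d e by (simp add: algebra_simps)
  next
    case False
    then have d: "Suc q div s = q div s" "Suc q mod s = Suc (q mod s)" by (auto simp: div_Suc mod_Suc)
    show ?thesis unfolding elapsed_def n d by (simp add: algebra_simps)
  qed
qed

text \<open>The linear substep multiplies by \<open>e\<^bsup>- i j\<^sup>2 a h\<^esup>\<close> while \<open>\<sigma>\<close> increases by \<open>a h\<close>; the two phases cancel, so the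
  rotated coefficients are continuous from one substep to the next.\<close>

lemma trajectory_glue:
  assumes K: "K \<ge> 1" and s: "s \<ge> 1" and a: "(\<Sum>r=1..s. a r) = 1"
  shows "trajectory K (elapsed s a h (int q)) (stage K s a b h c q) (b (s - q mod s) * h)
    = trajectory K (elapsed s a h (int (Suc q))) (stage K s a b h c (Suc q)) 0"
proof
  fix i :: idx
  obtain j B where i: "i = (j, B)" by force
  show "trajectory K (elapsed s a h (int q)) (stage K s a b h c q) (b (s - q mod s) * h) i
    = trajectory K (elapsed s a h (int (Suc q))) (stage K s a b h c (Suc q)) 0 i"
  proof (cases "j \<in> modes K")
    case True
    define d where "d = dft K (rotated_grid K (b (s - q mod s) * h) (stage K s a b h c q)) j"
    have "rotated_grid K 0 c = (\<lambda>l. trig_poly K c (grid_pt K l))" for c by (simp add: rotated_grid_def fun_eq_iff)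
    then have "dft K (rotated_grid K 0 (stage K s a b h c (Suc q))) j = stage K s a b h c (Suc q) j"
      by (simp only: dft_trig_poly[OF K True])
    also have "\<dots> = cis (- ((real_of_int j)\<^sup>2 * (a (s - q mod s) * h))) * d" by (simp add: d_def)
    finally have "cis ((real_of_int j)\<^sup>2 * elapsed s a h (int (Suc q))) * dft K (rotated_grid K 0 (stage K s a b h c (Suc q))) j
      = (cis ((real_of_int j)\<^sup>2 * elapsed s a h (int (Suc q))) * cis (- ((real_of_int j)\<^sup>2 * (a (s - q mod s) * h)))) * d"
      by simp
    also have "cis ((real_of_int j)\<^sup>2 * elapsed s a h (int (Suc q))) * cis (- ((real_of_int j)\<^sup>2 * (a (s - q mod s) * h)))
      = cis ((real_of_int j)\<^sup>2 * elapsed s a h (int q))"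
      using elapsed_Suc[OF s a, of h q] by (simp add: cis_mult algebra_simps)
    finally show ?thesis using True by (simp only: i trajectory_def d_def split Let_def if_True)
  qed (simp add: i trajectory_def)
qed

section \<open>The bootstrap argument\<close>

text \<open>Otherwise consider the first time at which \<open>f\<close> reaches \<open>c\<close>.\<close>

lemma continuity_bootstrap:
  fixes f :: "real \<Rightarrow> real"
  assumes cont: "continuous_on {a..b} f" and a: "f a < c"
    and step: "\<And>t. t \<in> {a..b} \<Longrightarrow> (\<And>u. u \<in> {a..t} \<Longrightarrow> f u \<le> c) \<Longrightarrow> f t < c"
    and t: "t \<in> {a..b}"
  shows "f t < c"
proof (rule ccontr)
  assume "\<not> f t < c"
  define A where "A = {a..b} \<inter> f -` {c..}"
  have "compact A"
  proof -
    have "closed A"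
      unfolding A_def by (rule continuous_closed_preimage[OF cont]) auto
    moreover have "bounded A"
      by (rule bounded_subset[of "{a..b}"]) (auto simp: A_def)
    ultimately show ?thesis by (simp add: compact_eq_bounded_closed)
  qed
  moreover have "A \<noteq> {}" using t \<open>\<not> f t < c\<close> by (auto simp: A_def)
  ultimately obtain m where m: "m \<in> A" "\<And>u. u \<in> A \<Longrightarrow> m \<le> u"
    using compact_attains_inf[of A] by blast
  have below: "f u < c" if "a \<le> u" "u < m" for u
    using m(2)[of u] that m(1) by (force simp: A_def)
  have "f m = c"
  proof -
    have "continuous_on {a..m} f" using cont m(1) by (auto simp: A_def intro: continuous_on_subset)
    then obtain u where u: "a \<le> u" "u \<le> m" "f u = c"
      using IVT'[of f a c m] a m(1) by (auto simp: A_def)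
    then show ?thesis using below[of u] by (cases "u = m") auto
  qed
  then have "f u \<le> c" if "u \<in> {a..m}" for u
    using below[of u] that by (cases "u = m") auto
  from step[OF _ this] m(1) \<open>f m = c\<close> show False by (auto simp: A_def)
qed

lemma timed_interaction_on_interval:
  assumes "t \<in> {real q..real q + 1}"
  shows "timed_interaction K s a b h t = interaction K (elapsed s a h (int q)) (h * profile t * coupling s b (int q))"
proof (cases "t = real q + 1")
  case True
  then have "t = of_int (int q + 1)" by simp
  then have "profile t = 0" by (simp only: profile_of_int)
  then show ?thesis by (simp add: timed_interaction_def interaction_def Cst_simps(1))
next
  case False
  then have "\<lfloor>t\<rfloor> = int q" using assms by (intro floor_unique) auto
  then show ?thesis by (simp add: timed_interaction_def)
qed

lemma continuous_sobolev_sq_trajectory: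
  assumes "\<And>i t. ((\<lambda>t. x t i) has_vector_derivative x' t i) (at t)"
  shows "continuous_on A (\<lambda>t. sobolev_sq K (x t))"
proof -
  have "continuous_on A (\<lambda>t. x t i)" for i
    using has_vector_derivative_continuous[OF assms] by (intro continuous_at_imp_continuous_on) blast
  then show ?thesis unfolding sobolev_sq_def by (intro continuous_intros)
qed

text \<open>While the squared norm is at most \<open>4 \<epsilon>\<^sup>2\<close>, the \<open>\<ell>\<^sup>1\<close>-norm is at most \<open>10 \<epsilon>\<close>, so \<open>E\<close> is close to the squared norm
  and drifts slowly. If the accumulated error is at most \<open>\<epsilon>\<^sup>2\<close>, the squared norm is in fact at most \<open>2 \<epsilon>\<^sup>2\<close>, and
  the estimate propagates through each substep by continuity.\<close>

lemma invariant_along_integrator: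
  fixes \<epsilon> :: real
  assumes K: "K \<ge> 1" and s: "s \<ge> 1" and h: "h > 0" and a: "(\<Sum>r=1..s. a r) = 1"
    and D: "time_deriv E E'" and B: "B \<ge> 0" and \<epsilon>: "0 < \<epsilon>" "10 * \<epsilon> \<le> 1"
    and bd: "\<And>t x. (\<Sum>i\<in>idxs K. cmod (x i)) \<le> 1 \<Longrightarrow>
        cmod (ev (E t) x - ev (sobolev_form K) x) \<le> B * (\<Sum>i\<in>idxs K. cmod (x i)) ^ 4 \<and>
        cmod (ev (E' t + br K (E t) (timed_interaction K s a b h t)) x) \<le> h * B * (\<Sum>i\<in>idxs K. cmod (x i)) ^ (2 * N + 2)"
    and c: "(H1_norm (trig_poly K c))\<^sup>2 \<le> \<epsilon>\<^sup>2"
    and small: "2 * (B * (10 * \<epsilon>) ^ 4) + real M * h * (B * (10 * \<epsilon>) ^ (2 * N + 2)) \<le> \<epsilon>\<^sup>2"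
  shows "\<bar>(H1_norm (trig_poly K (stage K s a b h c M)))\<^sup>2 - (H1_norm (trig_poly K c))\<^sup>2\<bar>
    \<le> 2 * (B * (10 * \<epsilon>) ^ 4) + real M * h * (B * (10 * \<epsilon>) ^ (2 * N + 2))"
proof -
  define D1 where "D1 = B * (10 * \<epsilon>) ^ 4"
  define D2 where "D2 = B * (10 * \<epsilon>) ^ (2 * N + 2)"
  have D0: "0 \<le> D1" "0 \<le> D2" using B \<epsilon> by (simp_all add: D1_def D2_def)
  define x where "x = (\<lambda>q t. trajectory K (elapsed s a h (int q)) (stage K s a b h c q) (profile_integral q t * (b (s - q mod s) * h)))"
  define e where "e = (\<lambda>q t. ev (E t) (x q t))"
  define H where "H = (\<lambda>q t. sobolev_sq K (x q t))"
  have coupling: "coupling s b (int q) = b (s - q mod s)" for q by (simp add: coupling_def flip: zmod_int)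
  have "((\<lambda>t. profile_integral q t * (b (s - q mod s) * h)) has_real_derivative h * profile t * coupling s b (int q)) (at t)" for q t
    using DERIV_cmult_right[OF profile_integral_deriv[of q t], of "b (s - q mod s) * h"] by (simp add: coupling mult_ac)
  from trajectory_ode[OF K this]
  have ode: "((\<lambda>t. x q t i) has_vector_derivative
      ev (br K (Var i) (interaction K (elapsed s a h (int q)) (h * profile t * coupling s b (int q)))) (x q t)) (at t)" for q t i
    unfolding x_def .
  have de: "(e q has_vector_derivative ev (E' t + br K (E t) (timed_interaction K s a b h t)) (x q t)) (at t)"
    if "t \<in> {real q..real q + 1}" for q t
    unfolding e_def timed_interaction_on_interval[OF that] by (rule chain_time_deriv[OF D ode])
  have contH: "continuous_on A (H q)" for A q
    unfolding H_def by (rule continuous_sobolev_sq_trajectory[OF ode])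
  have real: "x q t (j, False) = cnj (x q t (j, True))" for q t j unfolding x_def by (rule trajectory_real)
  have S: "(\<Sum>i\<in>idxs K. cmod (x q t i)) \<le> 10 * \<epsilon>" if "H q t \<le> 4 * \<epsilon>\<^sup>2" for q t
  proof -
    have "(\<Sum>i\<in>idxs K. cmod (x q t i)) \<le> 5 * sqrt (H q t)"
      unfolding H_def by (rule sum_idxs_bound[OF K]) (rule real)
    also have "sqrt (H q t) \<le> sqrt ((2 * \<epsilon>)\<^sup>2)"
      using that by (intro real_sqrt_le_mono) (simp add: power_mult_distrib)
    also have "sqrt ((2 * \<epsilon>)\<^sup>2) = 2 * \<epsilon>" using \<epsilon> by (subst real_sqrt_abs) simp
    finally show ?thesis by simp
  qed
  have sobolev_form: "ev (sobolev_form K) (x q t) = of_real (H q t)" for q t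
    unfolding H_def by (rule ev_sobolev_form) (rule real)
  have close: "cmod (e q t - of_real (H q t)) \<le> D1" if "H q t \<le> 4 * \<epsilon>\<^sup>2" for q t
  proof -
    have "cmod (e q t - of_real (H q t)) \<le> B * (\<Sum>i\<in>idxs K. cmod (x q t i)) ^ 4"
      using bd[of "x q t" t] S[OF that] \<epsilon> unfolding sobolev_form e_def by linarith
    also have "\<dots> \<le> D1"
      unfolding D1_def using B S[OF that] by (intro mult_left_mono power_mono sum_nonneg) auto
    finally show ?thesis .
  qed
  have drift: "cmod (ev (E' t + br K (E t) (timed_interaction K s a b h t)) (x q t)) \<le> h * D2" if "H q t \<le> 4 * \<epsilon>\<^sup>2" for q t
  proof -
    have "cmod (ev (E' t + br K (E t) (timed_interaction K s a b h t)) (x q t)) \<le> h * B * (\<Sum>i\<in>idxs K. cmod (x q t i)) ^ (2 * N + 2)"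
      using bd[of "x q t" t] S[OF that] \<epsilon> by linarith
    also have "\<dots> \<le> h * B * (10 * \<epsilon>) ^ (2 * N + 2)"
      using B h S[OF that] by (intro mult_left_mono power_mono sum_nonneg) auto
    finally show ?thesis by (simp add: D2_def)
  qed
  have start: "H q (real q) = (H1_norm (trig_poly K (stage K s a b h c q)))\<^sup>2" for q
    by (simp add: H_def x_def profile_integral_ends sobolev_sq_trajectory_0[OF K])
  have glue: "x q (real q + 1) = x (Suc q) (real (Suc q))" for q
  proof -
    have "x q (real q + 1) = trajectory K (elapsed s a h (int q)) (stage K s a b h c q) (b (s - q mod s) * h)"
      by (simp only: x_def profile_integral_ends mult_1_left)
    also have "\<dots> = trajectory K (elapsed s a h (int (Suc q))) (stage K s a b h c (Suc q)) 0" by (rule trajectory_glue[OF K s a])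
    also have "\<dots> = x (Suc q) (real (Suc q))" by (simp only: x_def profile_integral_ends mult_zero_left)
    finally show ?thesis .
  qed
  have H0: "H 0 0 \<le> \<epsilon>\<^sup>2" using start[of 0] c by simp
  have close0: "cmod (e 0 0 - of_real (H 0 0)) \<le> D1" using H0 by (intro close) (auto intro: order.trans)
  have near: "\<bar>H q t - H 0 0\<bar> \<le> 2 * D1 + real M * h * D2"
    if "H q t \<le> 4 * \<epsilon>\<^sup>2" "cmod (e q t - e 0 0) \<le> real M * h * D2" for q t
  proof -
    have "\<bar>H q t - H 0 0\<bar> = cmod (of_real (H q t) - of_real (H 0 0))" by (simp flip: of_real_diff)
    also have "of_real (H q t) - of_real (H 0 0) = - (e q t - of_real (H q t)) + (e q t - e 0 0) + (e 0 0 - of_real (H 0 0))"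
      by simp
    also have "cmod \<dots> \<le> cmod (e q t - of_real (H q t)) + cmod (e q t - e 0 0) + cmod (e 0 0 - of_real (H 0 0))"
      using norm_triangle_ineq[of "- (e q t - of_real (H q t)) + (e q t - e 0 0)" "e 0 0 - of_real (H 0 0)"]
        norm_triangle_ineq[of "- (e q t - of_real (H q t))" "e q t - e 0 0"]
        norm_minus_cancel[of "e q t - of_real (H q t)"] by linarith
    finally show ?thesis using close[OF that(1)] that(2) close0 by linarith
  qed
  have small': "2 * D1 + real M * h * D2 \<le> \<epsilon>\<^sup>2" using small by (simp add: D1_def D2_def)
  have below: "H q t \<le> 2 * \<epsilon>\<^sup>2"
    if "H q t \<le> 4 * \<epsilon>\<^sup>2" "cmod (e q t - e 0 0) \<le> real M * h * D2" for q t
    using near[OF that] small' H0 by linarith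
  have e2: "0 < \<epsilon>\<^sup>2" using \<epsilon> by simp
  have inv: "cmod (e q (real q) - e 0 0) \<le> real q * h * D2 \<and> H q (real q) \<le> 2 * \<epsilon>\<^sup>2" if "q \<le> M" for q
    using that
  proof (induction q)
    case 0
    have "H 0 0 \<le> 2 * \<epsilon>\<^sup>2" using H0 e2 by linarith
    then show ?case by simp
  next
    case (Suc q)
    have e_inc: "cmod (e q t - e 0 0) \<le> (real q + (t - real q)) * h * D2"
      if t: "t \<in> {real q..real q + 1}" and u: "\<And>u. u \<in> {real q..t} \<Longrightarrow> H q u \<le> 4 * \<epsilon>\<^sup>2" for t
    proof -
      have "cmod (e q t - e q (real q)) \<le> h * D2 * (t - real q)"
      proof (rule increment_bound)
        show "(e q has_vector_derivative ev (E' v + br K (E v) (timed_interaction K s a b h v)) (x q v)) (at v)"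
          if "real q \<le> v" "v \<le> t" for v using that t by (intro de) auto
        show "cmod (ev (E' v + br K (E v) (timed_interaction K s a b h v)) (x q v)) \<le> h * D2"
          if "real q \<le> v" "v \<le> t" for v using that u by (intro drift) auto
      qed (use t in auto)
      moreover have "cmod (e q t - e 0 0) \<le> cmod (e q t - e q (real q)) + cmod (e q (real q) - e 0 0)"
        using norm_triangle_ineq[of "e q t - e q (real q)" "e q (real q) - e 0 0"] by simp
      moreover have "cmod (e q (real q) - e 0 0) \<le> real q * h * D2" using Suc by simp
      moreover have "h * D2 * (t - real q) + real q * h * D2 = (real q + (t - real q)) * h * D2"
        by (simp add: algebra_simps)
      ultimately show ?thesis by linarith
    qed
    have le_M: "(real q + (t - real q)) * h * D2 \<le> real M * h * D2" if "t \<in> {real q..real q + 1}" for t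
      using that Suc.prems h D0 by (intro mult_right_mono) auto
    have all: "H q t < 4 * \<epsilon>\<^sup>2" if "t \<in> {real q..real q + 1}" for t
    proof (rule continuity_bootstrap[OF contH _ _ that])
      have "H q (real q) \<le> 2 * \<epsilon>\<^sup>2" using Suc by simp
      then show "H q (real q) < 4 * \<epsilon>\<^sup>2" using e2 by linarith
      fix t assume t: "t \<in> {real q..real q + 1}" and u: "\<And>u. u \<in> {real q..t} \<Longrightarrow> H q u \<le> 4 * \<epsilon>\<^sup>2"
      have "H q t \<le> 4 * \<epsilon>\<^sup>2" using u[of t] t by simp
      then have "H q t \<le> 2 * \<epsilon>\<^sup>2" using e_inc[OF t u] le_M[OF t] by (intro below) auto
      then show "H q t < 4 * \<epsilon>\<^sup>2" using e2 by linarith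
    qed
    have q1: "real q + 1 \<in> {real q..real q + 1}" by simp
    have e1: "cmod (e q (real q + 1) - e 0 0) \<le> (real q + (real q + 1 - real q)) * h * D2"
      by (rule e_inc[OF q1]) (use all in \<open>auto intro: less_imp_le\<close>)
    have "H q (real q + 1) \<le> 2 * \<epsilon>\<^sup>2"
      by (rule below) (use all[OF q1] e1 le_M[OF q1] in \<open>auto intro: less_imp_le\<close>)
    moreover have "e q (real q + 1) = e (Suc q) (real (Suc q))" "H q (real q + 1) = H (Suc q) (real (Suc q))"
      unfolding e_def H_def glue by (simp_all add: add.commute)
    ultimately show ?case using e1 by (simp add: add.commute)
  qed
  have "\<bar>H M (real M) - H 0 0\<bar> \<le> 2 * D1 + real M * h * D2"
  proof (rule near)
    show "H M (real M) \<le> 4 * \<epsilon>\<^sup>2" using inv[of M] e2 by linarith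
  qed (use inv[of M] in simp)
  then show ?thesis using start[of M] start[of 0] by (simp add: D1_def D2_def)
qed

theorem theorem3p1:
  fixes N s :: nat and c\<^sub>0 \<beta> :: real
  assumes "N \<ge> 2" and "0 < c\<^sub>0" and "c\<^sub>0 < 2 * pi" and "s \<ge> 1" and "\<beta> > 0"
  shows "\<exists>C \<epsilon>\<^sub>0 :: real. C > 0 \<and> \<epsilon>\<^sub>0 > 0 \<and>
    (\<forall>(K::nat) (h::real) (a::nat \<Rightarrow> real) (b::nat \<Rightarrow> real) (\<epsilon>::real) (\<psi>\<^sub>0::real \<Rightarrow> complex).
       K \<ge> 1 \<longrightarrow> h > 0 \<longrightarrow> (real N + 1) * h * (real K)\<^sup>2 \<le> c\<^sub>0 \<longrightarrow>
       (\<Sum>r=1..s. a r) = 1 \<longrightarrow> (\<Sum>r=1..s. b r) = 1 \<longrightarrow> (\<forall>r\<in>{1..s}. \<bar>b r\<bar> \<le> \<beta>) \<longrightarrow>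
       0 < \<epsilon> \<longrightarrow> \<epsilon> \<le> \<epsilon>\<^sub>0 \<longrightarrow> \<psi>\<^sub>0 \<in> trig_space K \<longrightarrow> H1_norm \<psi>\<^sub>0 \<le> \<epsilon> \<longrightarrow>
       (\<forall>n::nat. real n * h \<le> \<epsilon> powi (- int N + 1) \<longrightarrow>
          \<epsilon> powi (- 2) *
            \<bar>(H1_norm (splitting_solution K s a b h \<psi>\<^sub>0 n))\<^sup>2 - (H1_norm \<psi>\<^sub>0)\<^sup>2\<bar> \<le> C * \<epsilon>))"
proof -
  obtain B where B: "B \<ge> 0" and ex: "\<And>K h G. K \<ge> 1 \<Longrightarrow> h > 0 \<Longrightarrow> (real N + 1) * h * (real K)\<^sup>2 \<le> c\<^sub>0 \<Longrightarrow>
    hamiltonian K h s 4 (h * \<beta>) G \<Longrightarrow> (\<exists>E E'. time_deriv E E' \<and>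
      (\<forall>t x. (\<Sum>i\<in>idxs K. cmod (x i)) \<le> 1 \<longrightarrow>
        cmod (ev (E t) x - ev (sobolev_form K) x) \<le> B * (\<Sum>i\<in>idxs K. cmod (x i)) ^ 4 \<and>
        cmod (ev (E' t + br K (E t) (G t)) x) \<le> h * B * (\<Sum>i\<in>idxs K. cmod (x i)) ^ (2 * N + 2)))"
    using almost_invariant[OF assms(2,3,4) less_imp_le[OF assms(5)] assms(1)] by blast
  \<comment> \<open>The drift is at most \<open>Q \<epsilon>\<^sup>4\<close>; the powers of \<open>10\<close> stem from the bound \<open>10 \<epsilon>\<close> of the \<open>\<ell>\<^sup>1\<close>-norm.
     The choice of \<open>\<epsilon>\<^sub>0\<close> below ensures \<open>10 \<epsilon> \<le> 1\<close> and \<open>Q \<epsilon> \<le> 1\<close>.\<close>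
  define Q where "Q = 2 * (B * 10 ^ 4) + real s * (B * 10 ^ (2 * N + 2))"
  have Q: "Q \<ge> 0" using B by (simp add: Q_def)
  show ?thesis
  proof (rule exI[of _ "Q + 1"], rule exI[of _ "1 / (10 * (Q + 1))"], intro conjI allI impI)
    show "0 < Q + 1" "0 < 1 / (10 * (Q + 1))" using Q by simp_all
    fix K :: nat and h \<epsilon> :: real and a b :: "nat \<Rightarrow> real" and \<psi>\<^sub>0 :: "real \<Rightarrow> complex" and n :: nat
    assume K: "K \<ge> 1" and h: "h > 0" and cfl: "(real N + 1) * h * (real K)\<^sup>2 \<le> c\<^sub>0"
      and a: "(\<Sum>r=1..s. a r) = 1" and b: "\<forall>r\<in>{1..s}. \<bar>b r\<bar> \<le> \<beta>"
      and \<epsilon>: "0 < \<epsilon>" "\<epsilon> \<le> 1 / (10 * (Q + 1))" and \<psi>: "\<psi>\<^sub>0 \<in> trig_space K" "H1_norm \<psi>\<^sub>0 \<le> \<epsilon>"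
      and n: "real n * h \<le> \<epsilon> powi (- int N + 1)"
    obtain c where c: "\<psi>\<^sub>0 = trig_poly K c" using \<psi> by (auto simp: trig_space_def)
    have \<epsilon>Q: "10 * (\<epsilon> * (Q + 1)) \<le> 1" using \<epsilon>(2) Q by (simp add: field_simps)
    have "\<epsilon> * 1 \<le> \<epsilon> * (Q + 1)" using Q \<epsilon> by (intro mult_left_mono) auto
    then have \<epsilon>1: "10 * \<epsilon> \<le> 1" using \<epsilon>Q by linarith
    have Q\<epsilon>: "Q * \<epsilon> \<le> 1" using \<epsilon>Q \<epsilon>(1) by (simp add: algebra_simps)
    obtain E E' where E: "time_deriv E E'" "\<And>t x. (\<Sum>i\<in>idxs K. cmod (x i)) \<le> 1 \<Longrightarrow>
        cmod (ev (E t) x - ev (sobolev_form K) x) \<le> B * (\<Sum>i\<in>idxs K. cmod (x i)) ^ 4 \<and>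
        cmod (ev (E' t + br K (E t) (timed_interaction K s a b h t)) x) \<le> h * B * (\<Sum>i\<in>idxs K. cmod (x i)) ^ (2 * N + 2)"
      using ex[OF K h cfl timed_interaction_hamiltonian[OF K assms(4) h b]] by blast
    define R where "R = 2 * (B * (10 * \<epsilon>) ^ 4) + real (n * s) * h * (B * (10 * \<epsilon>) ^ (2 * N + 2))"
    have R: "R \<le> Q * \<epsilon> ^ 4"
    proof -
      have "\<epsilon> powi (- int N + 1) * \<epsilon> ^ (2 * N + 2) = \<epsilon> powi (- int N + 1) * \<epsilon> powi (int (2 * N + 2))"
        by (simp only: power_int_of_nat)
      also have "\<dots> = \<epsilon> powi ((- int N + 1) + int (2 * N + 2))"
        using \<epsilon> by (subst power_int_add) auto
      also have "(- int N + 1) + int (2 * N + 2) = int (N + 3)" by simp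
      also have "\<epsilon> powi (int (N + 3)) = \<epsilon> ^ (N + 3)" by (simp only: power_int_of_nat)
      also have "\<dots> \<le> \<epsilon> ^ 4" using \<epsilon> \<epsilon>1 assms(1) by (intro power_decreasing) auto
      finally have pw: "\<epsilon> powi (- int N + 1) * \<epsilon> ^ (2 * N + 2) \<le> \<epsilon> ^ 4" .
      have "real n * h * \<epsilon> ^ (2 * N + 2) \<le> \<epsilon> powi (- int N + 1) * \<epsilon> ^ (2 * N + 2)"
        using n \<epsilon> by (intro mult_right_mono) auto
      then have "real n * h * \<epsilon> ^ (2 * N + 2) \<le> \<epsilon> ^ 4" using pw by linarith
      then have "real s * (B * 10 ^ (2 * N + 2)) * (real n * h * \<epsilon> ^ (2 * N + 2)) \<le> real s * (B * 10 ^ (2 * N + 2)) * \<epsilon> ^ 4"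
        using B by (intro mult_left_mono) auto
      moreover have "R = 2 * (B * 10 ^ 4) * \<epsilon> ^ 4 + real s * (B * 10 ^ (2 * N + 2)) * (real n * h * \<epsilon> ^ (2 * N + 2))"
        by (simp only: R_def power_mult_distrib of_nat_mult mult_ac)
      moreover have "Q * \<epsilon> ^ 4 = 2 * (B * 10 ^ 4) * \<epsilon> ^ 4 + real s * (B * 10 ^ (2 * N + 2)) * \<epsilon> ^ 4"
        by (simp only: Q_def distrib_right)
      ultimately show ?thesis by linarith
    qed
    have "R \<le> \<epsilon>\<^sup>2"
    proof -
      have "R \<le> (Q * \<epsilon>) * \<epsilon> * \<epsilon>\<^sup>2" using R by (simp add: eval_nat_numeral mult_ac)
      also have "\<dots> \<le> 1 * 1 * \<epsilon>\<^sup>2"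
        using Q\<epsilon> \<epsilon> \<epsilon>1 Q by (intro mult_right_mono mult_mono) auto
      finally show ?thesis by simp
    qed
    have c1: "(H1_norm (trig_poly K c))\<^sup>2 \<le> \<epsilon>\<^sup>2"
    proof -
      have "0 \<le> H1_norm (trig_poly K c)"
        unfolding H1_norm_def
        by (cases "(\<lambda>x. (cmod (trig_poly K c x))\<^sup>2 + (cmod (vector_derivative (trig_poly K c) (at x)))\<^sup>2) integrable_on {0..2 * pi}")
          (auto intro!: real_sqrt_ge_zero divide_nonneg_nonneg integral_nonneg simp: not_integrable_integral)
      then show ?thesis using \<psi>(2) by (simp add: c power_mono)
    qed
    have "\<bar>(H1_norm (trig_poly K (stage K s a b h c (n * s))))\<^sup>2 - (H1_norm (trig_poly K c))\<^sup>2\<bar> \<le> R"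
      unfolding R_def
      by (rule invariant_along_integrator[OF K assms(4) h a E(1) B \<epsilon>(1) \<epsilon>1 E(2) c1])
        (use \<open>R \<le> \<epsilon>\<^sup>2\<close> in \<open>simp_all add: R_def\<close>)
    then have "\<bar>(H1_norm (splitting_solution K s a b h \<psi>\<^sub>0 n))\<^sup>2 - (H1_norm \<psi>\<^sub>0)\<^sup>2\<bar> \<le> Q * \<epsilon> ^ 4"
      unfolding c splitting_solution_stage[OF K assms(4)] using R by linarith
    then have "\<epsilon> powi (- 2) * \<bar>(H1_norm (splitting_solution K s a b h \<psi>\<^sub>0 n))\<^sup>2 - (H1_norm \<psi>\<^sub>0)\<^sup>2\<bar> \<le> \<epsilon> powi (- 2) * (Q * \<epsilon> ^ 4)"
      using \<epsilon> by (intro mult_left_mono) auto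
    also have "\<epsilon> powi (- 2) * (Q * \<epsilon> ^ 4) = Q * \<epsilon> * \<epsilon>"
      using \<epsilon> by (simp add: power_int_minus eval_nat_numeral field_simps)
    also have "\<dots> \<le> (Q + 1) * \<epsilon>"
    proof -
      have "Q * \<epsilon> * \<epsilon> \<le> 1 * \<epsilon>" using Q\<epsilon> \<epsilon> by (intro mult_right_mono) auto
      also have "\<dots> \<le> (Q + 1) * \<epsilon>" using Q \<epsilon> by (intro mult_right_mono) auto
      finally show ?thesis .
    qed
    finally show "\<epsilon> powi (- 2) * \<bar>(H1_norm (splitting_solution K s a b h \<psi>\<^sub>0 n))\<^sup>2 - (H1_norm \<psi>\<^sub>0)\<^sup>2\<bar> \<le> (Q + 1) * \<epsilon>" .
  qed
qed

end
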